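(* The generating function $$\vec{\mathbf H}(z,t,\mathbf p)=\sum_{d\ge1}\frac{z^d}{d!}\sum_{r\ge0}t^r\sum_{\alpha\vdash d}\vec{H}^r(\alpha)\,p_\alpha$$ is the unique formal power series solution, in the indeterminates $z$, $t$, $\mathbf p=(p_1,p_2,\dots)$, of the partial differential equation $$\frac{1}{2t}\left(z\frac{\partial\vec{\mathbf H}}{\partial z}-zp_1\right)=\frac12\sum_{i,j\ge1}\left((i+j)p_ip_j\frac{\partial\vec{\mathbf H}}{\partial p_{i+j}}+ij\,p_{i+j}\frac{\partial^2\vec{\mathbf H}}{\partial p_i\,\partial p_j}+ij\,p_{i+j}\frac{\partial\vec{\mathbf H}}{\partial p_i}\frac{\partial\vec{\mathbf H}}{\partial p_j}\right)$$ with the initial condition $[z^0]\vec{\mathbf H}=0$.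
   Context: For a partition $\alpha\vdash d$ and an integer $r\ge 0$, the monotone single Hurwitz number $\vec{H}^r(\alpha)$ is the number of factorizations $(a_1\,b_1)(a_2\,b_2)\cdots(a_r\,b_r)=\sigma$ in the symmetric group $S_d$ (i.e. the number of sequences of $r$ transpositions, $\sigma$ being their product) such that: each $(a_i\,b_i)$ is a transposition, written with $a_i<b_i$; $\sigma$ has cycle type $\alpha$; the subgroup $\langle (a_1\,b_1),\dots,(a_r\,b_r)\rangle$ acts transitively on $\{1,\dots,d\}$; and $b_1\le b_2\le\cdots\le b_r$. For a partition $\alpha$ with $\ell(\alpha)$ parts, $p_\alpha=\prod_{j=1}^{\ell(\alpha)}p_{\alpha_j}$. The notation $[A]B$ means the coefficient of $A$ in $B$. Formal power series are over $\mathbb Q$. *)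

theory Defs
  imports
    Complex_Main
    "HOL-Library.Multiset_Order"
    "HOL-Computational_Algebra.Fraction_Field"
    "HOL-Combinatorics.Orbits"
    "HOL-Algebra.Sym_Groups"
begin

section \<open>Formal power series in an arbitrary set of indeterminates\<close>

text \<open>A monomial in the indeterminates \<open>'v\<close> is a finite multiset over \<open>'v\<close>, and a formal power
  series is an arbitrary function from monomials to coefficients. This is a ring even when \<open>'v\<close> is
  infinite, because a monomial has only finitely many factorizations.\<close>

typedef ('v, 'a) mps = "UNIV :: ('v multiset \<Rightarrow> 'a) set"
  morphisms mps_coeff Abs_mps ..

lemma mps_coeff_Abs [simp]: "mps_coeff (Abs_mps f) = f"
  by (simp add: Abs_mps_inverse)

lemma mps_eq_iff: "f = g \<longleftrightarrow> (\<forall>m. mps_coeff f m = mps_coeff g m)"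
  by (metis mps_coeff_inject ext)

lemma mps_eqI: "(\<And>m. mps_coeff f m = mps_coeff g m) \<Longrightarrow> f = g"
  by (simp add: mps_eq_iff)

definition splits :: "'v multiset \<Rightarrow> ('v multiset \<times> 'v multiset) set" where
  "splits m = {(a, b). a + b = m}"

lemma finite_subseteq_mset: "finite {a. a \<subseteq># m}"
proof (induction m)
  case empty
  show ?case by simp
next
  case (add x m)
  have "{a. a \<subseteq># add_mset x m} \<subseteq> {a. a \<subseteq># m} \<union> add_mset x ` {a. a \<subseteq># m}"
  proof
    fix a assume "a \<in> {a. a \<subseteq># add_mset x m}"
    then have a: "a \<subseteq># add_mset x m" by simp
    show "a \<in> {a. a \<subseteq># m} \<union> add_mset x ` {a. a \<subseteq># m}"
    proof (cases "x \<in># a")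
      case True
      then obtain b where "a = add_mset x b" by (metis mset_add)
      with a show ?thesis by auto
    next
      case False
      with a have "a \<subseteq># m"
        by (metis diff_single_trivial insert_DiffM2 subset_eq_diff_conv add_mset_add_single)
      then show ?thesis by simp
    qed
  qed
  with add show ?case by (meson finite_UnI finite_imageI finite_subset)
qed

lemma finite_splits [simp]: "finite (splits m)"
proof (rule finite_subset)
  show "splits m \<subseteq> {a. a \<subseteq># m} \<times> {a. a \<subseteq># m}" by (auto simp: splits_def)
qed (simp add: finite_subseteq_mset)

instantiation mps :: (type, comm_ring_1) comm_ring_1
begin

definition zero_mps_def: "0 = Abs_mps (\<lambda>_. 0)"
definition one_mps_def: "1 = Abs_mps (\<lambda>m. if m = {#} then 1 else 0)"
definition plus_mps_def: "f + g = Abs_mps (\<lambda>m. mps_coeff f m + mps_coeff g m)"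
definition uminus_mps_def: "- f = Abs_mps (\<lambda>m. - mps_coeff f m)"
definition minus_mps_def: "f - g = Abs_mps (\<lambda>m. mps_coeff f m - mps_coeff g m)"
definition times_mps_def:
  "f * g = Abs_mps (\<lambda>m. \<Sum>(a, b)\<in>splits m. mps_coeff f a * mps_coeff g b)"

instance
proof
  fix f g h :: "('a, 'b) mps"
  show "f * g * h = f * (g * h)"
  proof (rule mps_eqI)
    fix m
    let ?c = mps_coeff
    have "?c (f * g * h) m =
        (\<Sum>(s, c)\<in>splits m. \<Sum>(a, b)\<in>splits s. ?c f a * ?c g b * ?c h c)"
      by (simp add: times_mps_def sum_distrib_right case_prod_beta)
    also have "\<dots> = (\<Sum>((s, c), (a, b))\<in>Sigma (splits m) (\<lambda>(s, c). splits s).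
        ?c f a * ?c g b * ?c h c)"
      by (subst sum.Sigma [symmetric]) (auto simp: case_prod_beta)
    also have "\<dots> = (\<Sum>((a, s), (b, c))\<in>Sigma (splits m) (\<lambda>(a, s). splits s).
        ?c f a * (?c g b * ?c h c))"
      by (rule sum.reindex_bij_witness
          [where i = "\<lambda>((a, s), (b, c)). ((a + b, c), (a, b))"
             and j = "\<lambda>((s, c), (a, b)). ((a, b + c), (b, c))"])
        (auto simp: splits_def ac_simps)
    also have "\<dots> = (\<Sum>(a, s)\<in>splits m. \<Sum>(b, c)\<in>splits s. ?c f a * (?c g b * ?c h c))"
      by (subst sum.Sigma [symmetric]) (auto simp: case_prod_beta)
    also have "\<dots> = ?c (f * (g * h)) m"
      by (simp add: times_mps_def sum_distrib_left case_prod_beta)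
    finally show "?c (f * g * h) m = ?c (f * (g * h)) m" .
  qed
  show "f * g = g * f"
    unfolding times_mps_def
    by (rule mps_eqI, simp)
      (rule sum.reindex_bij_witness [where i = prod.swap and j = prod.swap],
        auto simp: splits_def ac_simps)
  show "1 * f = f"
  proof (rule mps_eqI)
    fix m
    have "mps_coeff (1 * f) m =
        (\<Sum>x\<in>splits m. if x = ({#}, m) then mps_coeff f m else 0)"
      unfolding times_mps_def one_mps_def
      by (auto simp: splits_def intro!: sum.cong)
    also have "\<dots> = mps_coeff f m"
      by (simp add: sum.delta) (simp add: splits_def)
    finally show "mps_coeff (1 * f) m = mps_coeff f m" .
  qed
  show "(f + g) * h = f * h + g * h"
    by (rule mps_eqI)
      (simp add: times_mps_def plus_mps_def case_prod_beta sum.distrib distrib_right)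
  show "(0 :: ('a, 'b) mps) \<noteq> 1"
    by (auto simp: zero_mps_def one_mps_def mps_eq_iff intro!: exI [of _ "{#}"])
qed (rule mps_eqI, simp add: zero_mps_def plus_mps_def uminus_mps_def minus_mps_def ac_simps)+

end

lemma mps_coeff_ring [simp]:
  "mps_coeff 0 m = 0"
  "mps_coeff (f + g) m = mps_coeff f m + mps_coeff g m"
  "mps_coeff (- f) m = - mps_coeff f m"
  "mps_coeff (f - g) m = mps_coeff f m - mps_coeff g m"
  by (simp_all add: zero_mps_def plus_mps_def uminus_mps_def minus_mps_def)

lemma mps_coeff_mult:
  "mps_coeff (f * g) m = (\<Sum>(a, b)\<in>splits m. mps_coeff f a * mps_coeff g b)"
  by (simp add: times_mps_def)

instance mps :: (wellorder, idom) idom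
proof
  fix f g :: "('a, 'b) mps"
  assume "f \<noteq> 0" "g \<noteq> 0"
  define a where "a = (LEAST m. mps_coeff f m \<noteq> 0)"
  define b where "b = (LEAST m. mps_coeff g m \<noteq> 0)"
  have a: "mps_coeff f a \<noteq> 0" "\<And>m. m < a \<Longrightarrow> mps_coeff f m = 0"
    using \<open>f \<noteq> 0\<close> LeastI_ex [of "\<lambda>m. mps_coeff f m \<noteq> 0"] not_less_Least
    unfolding a_def mps_eq_iff by auto
  have b: "mps_coeff g b \<noteq> 0" "\<And>m. m < b \<Longrightarrow> mps_coeff g m = 0"
    using \<open>g \<noteq> 0\<close> LeastI_ex [of "\<lambda>m. mps_coeff g m \<noteq> 0"] not_less_Least
    unfolding b_def mps_eq_iff by auto
  have "mps_coeff f (fst x) * mps_coeff g (snd x) =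
      (if x = (a, b) then mps_coeff f a * mps_coeff g b else 0)" if "x \<in> splits (a + b)" for x
  proof (cases "fst x < a \<or> snd x < b")
    case True
    then show ?thesis using a b by auto
  next
    case False
    then have "a \<le> fst x" "b \<le> snd x" by auto
    moreover have "fst x + snd x = a + b" using that by (auto simp: splits_def)
    ultimately have "x = (a, b)"
      by (metis add_le_less_mono add_less_le_mono leD order_le_less prod.collapse)
    then show ?thesis by simp
  qed
  then have "mps_coeff (f * g) (a + b) =
      (\<Sum>x\<in>splits (a + b). if x = (a, b) then mps_coeff f a * mps_coeff g b else 0)"
    by (auto simp: mps_coeff_mult case_prod_beta intro!: sum.cong)
  also have "\<dots> = mps_coeff f a * mps_coeff g b"
    by (simp add: sum.delta) (simp add: splits_def)
  finally show "f * g \<noteq> 0" using a(1) b(1) by (metis mps_coeff_ring(1) mult_eq_0_iff)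
qed

definition mps_const :: "'a \<Rightarrow> ('v, 'a :: comm_ring_1) mps" where
  "mps_const c = Abs_mps (\<lambda>m. if m = {#} then c else 0)"

definition mps_var :: "'v \<Rightarrow> ('v, 'a :: comm_ring_1) mps" where
  "mps_var v = Abs_mps (\<lambda>m. if m = {#v#} then 1 else 0)"

definition mps_deriv :: "'v \<Rightarrow> ('v, 'a :: comm_ring_1) mps \<Rightarrow> ('v, 'a) mps" where
  "mps_deriv v f = Abs_mps (\<lambda>m. of_nat (Suc (count m v)) * mps_coeff f (add_mset v m))"

text \<open>The coefficient \<open>[v^n] f\<close>, a power series in the indeterminates other than \<open>v\<close>.\<close>

definition mps_pow_coeff :: "'v \<Rightarrow> nat \<Rightarrow> ('v, 'a :: comm_ring_1) mps \<Rightarrow> ('v, 'a) mps" where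
  "mps_pow_coeff v n f =
     Abs_mps (\<lambda>m. if v \<in># m then 0 else mps_coeff f (m + replicate_mset n v))"

text \<open>Infinite sums of power series are taken coefficientwise. They are meaningful only for locally
  finite families, in which each monomial occurs in finitely many members.\<close>

definition locally_finite :: "'i set \<Rightarrow> ('i \<Rightarrow> ('v, 'a :: comm_ring_1) mps) \<Rightarrow> bool" where
  "locally_finite I F \<longleftrightarrow> (\<forall>m. finite {i \<in> I. mps_coeff (F i) m \<noteq> 0})"

definition mps_sum :: "'i set \<Rightarrow> ('i \<Rightarrow> ('v, 'a :: comm_ring_1) mps) \<Rightarrow> ('v, 'a) mps" where
  "mps_sum I F = Abs_mps (\<lambda>m. \<Sum>i | i \<in> I \<and> mps_coeff (F i) m \<noteq> 0. mps_coeff (F i) m)"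

text \<open>The embedding of a domain in its field of fractions.\<close>

definition to_fract :: "'a :: idom \<Rightarrow> 'a fract" where
  "to_fract x = Fract x 1"


section \<open>The indeterminates \<open>z\<close>, \<open>t\<close>, \<open>p\<^sub>1\<close>, \<open>p\<^sub>2\<close>, \dots\<close>

text \<open>\<open>Ind_p k\<close> stands for \<open>p\<^sub>k\<^sub>+\<^sub>1\<close>, so that there is no indeterminate \<open>p\<^sub>0\<close>.\<close>

datatype indet = Ind_z | Ind_t | Ind_p nat

abbreviation ind_p :: "nat \<Rightarrow> indet" where
  "ind_p i \<equiv> Ind_p (i - 1)"

text \<open>The order on indeterminates serves only to show that the power series form a domain.\<close>

fun indet_index :: "indet \<Rightarrow> nat" where
  "indet_index Ind_z = 0"
| "indet_index Ind_t = 1"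
| "indet_index (Ind_p k) = k + 2"

lemma indet_index_inject: "indet_index u = indet_index v \<Longrightarrow> u = v"
  by (cases u; cases v) auto

instantiation indet :: wellorder
begin

definition less_eq_indet_def: "u \<le> v \<longleftrightarrow> indet_index u \<le> indet_index v"
definition less_indet_def: "u < v \<longleftrightarrow> indet_index u < indet_index v"

instance
proof
  fix P :: "indet \<Rightarrow> bool" and u :: indet
  assume step: "\<And>u. (\<And>v. v < u \<Longrightarrow> P v) \<Longrightarrow> P u"
  show "P u"
    by (induction u rule: measure_induct_rule [of indet_index])
      (auto intro: step simp: less_indet_def)
qed (auto simp: less_eq_indet_def less_indet_def intro: indet_index_inject)

end

abbreviation z_var :: "(indet, rat) mps" where "z_var \<equiv> mps_var Ind_z"
abbreviation t_var :: "(indet, rat) mps" where "t_var \<equiv> mps_var Ind_t"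
abbreviation p_var :: "nat \<Rightarrow> (indet, rat) mps" where "p_var i \<equiv> mps_var (ind_p i)"


section \<open>Monotone single Hurwitz numbers\<close>

definition partitions :: "nat \<Rightarrow> nat multiset set" where
  "partitions d = {\<alpha>. 0 \<notin># \<alpha> \<and> sum_mset \<alpha> = d}"

text \<open>Fixed points contribute parts equal to \<open>1\<close>.\<close>

definition cycle_type :: "nat \<Rightarrow> (nat \<Rightarrow> nat) \<Rightarrow> nat multiset" where
  "cycle_type d \<sigma> = image_mset card (mset_set (Orbits.orbit \<sigma> ` {1..d}))"

text \<open>A transposition \<open>(a b)\<close> with \<open>a < b\<close> is encoded by the pair \<open>(a, b)\<close>.\<close>

definition transps :: "(nat \<times> nat) list \<Rightarrow> (nat \<Rightarrow> nat) list" where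
  "transps fs = map (\<lambda>(a, b). transpose a b) fs"

definition transitive_on :: "nat \<Rightarrow> (nat \<Rightarrow> nat) set \<Rightarrow> bool" where
  "transitive_on d G \<longleftrightarrow> (\<forall>x\<in>{1..d}. \<forall>y\<in>{1..d}. \<exists>g\<in>G. g x = y)"

definition monotone_factorizations :: "nat \<Rightarrow> nat multiset \<Rightarrow> (nat \<times> nat) list set" where
  "monotone_factorizations r \<alpha> = (let d = sum_mset \<alpha> in
     {fs. length fs = r \<and>
          (\<forall>(a, b)\<in>set fs. 1 \<le> a \<and> a < b \<and> b \<le> d) \<and>
          cycle_type d (foldr (\<circ>) (transps fs) id) = \<alpha> \<and>
          transitive_on d (generate (sym_group d) (set (transps fs))) \<and>
          sorted (map snd fs)})"

definition monotone_hurwitz :: "nat \<Rightarrow> nat multiset \<Rightarrow> nat" where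
  "monotone_hurwitz r \<alpha> = card (monotone_factorizations r \<alpha>)"

definition p_monomial :: "nat multiset \<Rightarrow> (indet, rat) mps" where
  "p_monomial \<alpha> = (\<Prod>i\<in>#\<alpha>. p_var i)"

definition hurwitz_series :: "(indet, rat) mps" where
  "hurwitz_series =
     mps_sum {1..} (\<lambda>d. mps_const (1 / fact d) * z_var ^ d *
       mps_sum UNIV (\<lambda>r. t_var ^ r *
         (\<Sum>\<alpha>\<in>partitions d. of_nat (monotone_hurwitz r \<alpha>) * p_monomial \<alpha>)))"


section \<open>The summands of the differential equation\<close>

definition join_cut_term :: "(indet, rat) mps \<Rightarrow> nat \<Rightarrow> nat \<Rightarrow> (indet, rat) mps" where
  "join_cut_term F i j =
     of_nat (i + j) * p_var i * p_var j * mps_deriv (ind_p (i + j)) F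
     + of_nat (i * j) * p_var (i + j) * mps_deriv (ind_p i) (mps_deriv (ind_p j) F)
     + of_nat (i * j) * p_var (i + j) * mps_deriv (ind_p i) F * mps_deriv (ind_p j) F"


section \<open>The sums above are meaningful\<close>

lemma mps_coeff_var_multE:
  fixes f :: "('v, 'a :: comm_ring_1) mps"
  assumes "mps_coeff (mps_var v * f) m \<noteq> 0"
  obtains n where "m = add_mset v n" "mps_coeff f n \<noteq> 0"
proof -
  have "(\<Sum>x\<in>splits m. mps_coeff (mps_var v) (fst x) * mps_coeff f (snd x)) \<noteq> 0"
    using assms by (simp add: mps_coeff_mult case_prod_beta)
  then obtain x where x: "x \<in> splits m" "mps_coeff (mps_var v) (fst x) * mps_coeff f (snd x) \<noteq> 0"
    by (rule sum.not_neutral_contains_not_neutral)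
  then have "fst x = {#v#}" "mps_coeff f (snd x) \<noteq> 0"
    by (auto simp: mps_var_def split: if_splits)
  moreover have "m = fst x + snd x" using x(1) by (auto simp: splits_def)
  ultimately show ?thesis using that by simp
qed

lemma mps_coeff_var_mult: "mps_coeff (mps_var v * f) m \<noteq> 0 \<Longrightarrow> v \<in># m"
  by (erule mps_coeff_var_multE) simp

lemma join_cut_locally_finite:
  "locally_finite ({1..} \<times> {1..}) (\<lambda>(i, j). join_cut_term F i j)"
  unfolding locally_finite_def
proof
  fix m :: "indet multiset"
  define S where "S = {k. Ind_p k \<in># m}"
  have "finite (Ind_p -` set_mset m)"
    by (rule finite_vimageI) (auto simp: inj_def)
  then have S: "finite S" by (simp add: S_def vimage_def)
  have "x \<in> Suc ` S \<times> Suc ` S \<union> (\<Union>k\<in>S. {..Suc k} \<times> {..Suc k})"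
    if x: "x \<in> {x \<in> {1..} \<times> {1..}. mps_coeff (case x of (i, j) \<Rightarrow> join_cut_term F i j) m \<noteq> 0}" for x
  proof -
    obtain i j where ij: "x = (i, j)" "i \<ge> 1" "j \<ge> 1" using x by auto
    have "mps_coeff (join_cut_term F i j) m \<noteq> 0" using x ij by simp
    moreover have "join_cut_term F i j =
        p_var i * (p_var j * (of_nat (i + j) * mps_deriv (ind_p (i + j)) F))
        + p_var (i + j) * (of_nat (i * j) * (mps_deriv (ind_p i) (mps_deriv (ind_p j) F)
          + mps_deriv (ind_p i) F * mps_deriv (ind_p j) F))"
      by (simp add: join_cut_term_def algebra_simps)
    moreover have "p_var i * (p_var j * G) = p_var j * (p_var i * G)" for G
      by (simp add: ac_simps)
    ultimately have "(ind_p i \<in># m \<and> ind_p j \<in># m) \<or> ind_p (i + j) \<in># m"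
      by (metis mps_coeff_ring(2) add.right_neutral add.left_neutral mps_coeff_var_mult)
    then show ?thesis
    proof
      assume "ind_p i \<in># m \<and> ind_p j \<in># m"
      then have "i - 1 \<in> S" "j - 1 \<in> S" by (auto simp: S_def)
      then have "Suc (i - 1) \<in> Suc ` S" "Suc (j - 1) \<in> Suc ` S" by blast+
      then show ?thesis using ij by simp
    next
      assume "ind_p (i + j) \<in># m"
      then have "i + j - 1 \<in> S" by (simp add: S_def)
      then show ?thesis using ij by (intro UnI2 UN_I [of "i + j - 1"]) auto
    qed
  qed
  then have "{x \<in> {1..} \<times> {1..}. mps_coeff (case x of (i, j) \<Rightarrow> join_cut_term F i j) m \<noteq> 0}
      \<subseteq> Suc ` S \<times> Suc ` S \<union> (\<Union>k\<in>S. {..Suc k} \<times> {..Suc k})"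
    by (rule subsetI)
  moreover have "finite (Suc ` S \<times> Suc ` S \<union> (\<Union>k\<in>S. {..Suc k} \<times> {..Suc k}))"
    using S by simp
  ultimately show "finite {x \<in> {1..} \<times> {1..}. mps_coeff (case x of (i, j) \<Rightarrow> join_cut_term F i j) m \<noteq> 0}"
    by (rule finite_subset)
qed

lemma two_t_nonzero: "2 * to_fract t_var \<noteq> 0"
proof -
  have "mps_coeff (2 * t_var) {#Ind_t#} = 2"
    unfolding mult_2 mps_coeff_ring mps_var_def mps_coeff_Abs by simp
  then have "2 * t_var \<noteq> 0" by (metis mps_coeff_ring(1) zero_neq_numeral)
  moreover have "2 * to_fract t_var = to_fract (2 * t_var)"
    unfolding to_fract_def mult_2
    by (subst add_fract) (simp_all only: one_neq_zero not_False_eq_True mult_1_right)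
  ultimately show ?thesis by (simp add: to_fract_def Zero_fract_def eq_fract)
qed

lemma mps_coeff_var_power_mult:
  assumes "mps_coeff (mps_var v ^ n * f) m \<noteq> 0"
  shows "n \<le> count m v"
  using assms
proof (induction n arbitrary: m)
  case (Suc n)
  have "mps_coeff (mps_var v * (mps_var v ^ n * f)) m \<noteq> 0"
    using Suc.prems by (simp add: ac_simps)
  then obtain k where "m = add_mset v k" "mps_coeff (mps_var v ^ n * f) k \<noteq> 0"
    by (rule mps_coeff_var_multE)
  with Suc.IH [of k] show ?case by simp
qed simp

lemma var_power_locally_finite: "locally_finite I (\<lambda>n. mps_var v ^ n * F n)"
  unfolding locally_finite_def
proof
  fix m
  show "finite {n \<in> I. mps_coeff (mps_var v ^ n * F n) m \<noteq> 0}"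
    by (rule finite_subset [of _ "{..count m v}"]) (auto dest: mps_coeff_var_power_mult)
qed

lemma const_var_power_locally_finite:
  "locally_finite I (\<lambda>n. mps_const (c n) * mps_var v ^ n * F n)"
  using var_power_locally_finite [of I v "\<lambda>n. mps_const (c n) * F n"]
  by (simp add: ac_simps)

lemma finite_partitions: "finite (partitions d)"
proof (rule finite_subset)
  show "partitions d \<subseteq> mset ` {xs. set xs \<subseteq> {..d} \<and> length xs \<le> d}"
  proof
    fix \<alpha> assume "\<alpha> \<in> partitions d"
    then have \<alpha>: "0 \<notin># \<alpha>" "sum_mset \<alpha> = d" by (auto simp: partitions_def)
    have "x \<le> d" if "x \<in># \<alpha>" for x
      using that \<alpha>(2) by (metis le_add1 mset_add sum_mset.add_mset)
    moreover have "size \<alpha> \<le> sum_mset \<alpha>" using \<alpha>(1)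
      by (induction \<alpha>) auto
    ultimately show "\<alpha> \<in> mset ` {xs. set xs \<subseteq> {..d} \<and> length xs \<le> d}"
      using \<alpha>(2) ex_mset [of \<alpha>] by (force simp: image_iff)
  qed
qed (simp add: finite_lists_length_le)

lemma finite_monotone_factorizations: "finite (monotone_factorizations r \<alpha>)"
proof (rule finite_subset)
  let ?d = "sum_mset \<alpha>"
  show "monotone_factorizations r \<alpha> \<subseteq> {fs. set fs \<subseteq> {..?d} \<times> {..?d} \<and> length fs = r}"
    by (fastforce simp: monotone_factorizations_def Let_def)
qed (simp add: finite_lists_length_eq)

end

theory Submission
  imports Defs "HOL-Library.Infinite_Set"
begin

text \<open>
  A monotone factorization of length \<open>r\<close> is a term of the complete homogeneous symmetric polynomial
  \<open>h\<^sub>r\<close> in the Jucys--Murphy elements \<open>J\<^sub>b = (1 b) + \<dots> + (b-1 b)\<close>. These are symmetric functions of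
  the \<open>J\<^sub>b\<close>, hence central, and this stays true when one also records the orbits of the subgroup
  generated by the factors, because only the relations \<open>(a b)(b c) = (b c)(c a)\<close> and the commutation of
  disjoint transpositions are used. So the sum over the transitive monotone factorizations of an
  expression that is equivariant under relabelling and depends on a marked point does not depend on that
  point, and marking \<open>d\<close> amounts to averaging over all points.

  In a transitive factorization of length \<open>r + 1\<close> in \<open>S\<^sub>d\<close> the last transposition is \<open>(a d)\<close>. If the
  other factors are still transitive, then averaging over \<open>d\<close> turns the sum over \<open>a\<close> into the sum over
  all transpositions, which cut a cycle or join two cycles of the product: these are the first two terms
  of the equation. Otherwise the other factors form a shuffle, determined by monotonicity, of two
  transitive factorizations on complementary sets, and \<open>(a d)\<close> joins a cycle of the one to a cycle of the
  other: this is the quadratic term. Uniqueness holds because the equation expresses the coefficients of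
  \<open>t\<^sup>r\<close> by those of smaller powers of \<open>t\<close>.
\<close>


section \<open>Centrality of monotone words\<close>

text \<open>Relabelling by a permutation destroys the order of the second entries, so conjugation
  does not act on monotone words and no evident bijection moves the marked point. Centrality is an
  equality of sums only. It is therefore stated for sums of arbitrary functions of words that
  respect the relations, with values in an abelian group; the relations are imposed on the functions
  instead of passing to a quotient algebra. The relation \<open>(a b)(a b) = 1\<close> is not among
  them, since it changes the generated subgroup.

  The constants arise as follows. The average over the \<open>d\<close> points in the linear terms
  is the factor \<open>d\<close> produced by z d/dz. Sums over ordered pairs of points match the sum
  over ordered pairs \<open>(i, j)\<close> once the common factor 1/2 is cleared. In the quadratic
  term only the component \<open>A\<close> of \<open>d\<close> carries a mark, so the average is
  over \<open>card A\<close> points, while the other end of \<open>(a d)\<close> already runs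
  through the whole complement. After division by d! the quotient \<open>d / card A\<close> and the
  number of sets \<open>A\<close> of size \<open>n\<close> combine to 1/n! times 1/(d-n)!.

  The sum over \<open>i\<close> and \<open>j\<close> is infinite; it is handled one coefficient at a
  time, with a cut-off \<open>N\<close>.\<close>

definition wperm :: "(nat \<times> nat) list \<Rightarrow> nat \<Rightarrow> nat" where
  "wperm fs = foldr (\<circ>) (transps fs) id"

text \<open>The letters come from an arbitrary set because the two components of a split word live
  on arbitrary subsets of \<open>{1..d}\<close>.\<close>

definition mwords :: "nat set \<Rightarrow> nat \<Rightarrow> (nat \<times> nat) list set" where
  "mwords S r = {fs. length fs = r \<and> (\<forall>(a, b)\<in>set fs. a \<in> S \<and> b \<in> S \<and> a < b) \<and> sorted (map snd fs)}"

definition relabel :: "(nat \<Rightarrow> nat) \<Rightarrow> (nat \<times> nat) list \<Rightarrow> (nat \<times> nat) list" where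
  "relabel \<phi> = map (map_prod \<phi> \<phi>)"

lemma relabel_simps [simp]:
  "relabel \<phi> [] = []"
  "relabel \<phi> ((a, b) # fs) = (\<phi> a, \<phi> b) # relabel \<phi> fs"
  "relabel \<phi> (fs @ gs) = relabel \<phi> fs @ relabel \<phi> gs"
  "length (relabel \<phi> fs) = length fs"
  by (simp_all add: relabel_def)

lemma set_relabel: "set (relabel \<phi> fs) = map_prod \<phi> \<phi> ` set fs"
  by (simp add: relabel_def)

lemma finite_mwords [simp]: "finite S \<Longrightarrow> finite (mwords S r)"
  by (rule finite_subset [where B = "{fs. set fs \<subseteq> S \<times> S \<and> length fs = r}"])
    (auto simp: mwords_def intro: finite_lists_length_eq)

lemma mwords_0 [simp]: "mwords S 0 = {[]}"
  by (auto simp: mwords_def)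

text \<open>The three relations hold in the symmetric group and keep the orbits of the generated
  subgroup. The flip is present because relabelling need not preserve \<open>a < b\<close> inside a
  letter.\<close>

definition braid_invariant :: "((nat \<times> nat) list \<Rightarrow> 'b) \<Rightarrow> bool" where
  "braid_invariant f \<longleftrightarrow>
     (\<forall>u v a b. f (u @ (a, b) # v) = f (u @ (b, a) # v)) \<and>
     (\<forall>u v a b c d. distinct [a, b, c, d] \<longrightarrow>
        f (u @ (a, b) # (c, d) # v) = f (u @ (c, d) # (a, b) # v)) \<and>
     (\<forall>u v a b c. distinct [a, b, c] \<longrightarrow>
        f (u @ (a, b) # (b, c) # v) = f (u @ (b, c) # (c, a) # v))"

lemma
  assumes "braid_invariant f"
  shows braid_flip: "f (u @ (a, b) # v) = f (u @ (b, a) # v)"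
    and braid_commute: "distinct [a, b, c, d] \<Longrightarrow>
      f (u @ (a, b) # (c, d) # v) = f (u @ (c, d) # (a, b) # v)"
    and braid_triangle: "distinct [a, b, c] \<Longrightarrow>
      f (u @ (a, b) # (b, c) # v) = f (u @ (b, c) # (c, a) # v)"
  using assms unfolding braid_invariant_def by blast+

text \<open>\<open>jm_append b\<close> is the right multiplication by the Jucys--Murphy element
  \<open>\<Sum>a<b. (a b)\<close> on functions of words.\<close>

definition jm_append :: "nat \<Rightarrow> ((nat \<times> nat) list \<Rightarrow> 'b :: ab_group_add) \<Rightarrow> (nat \<times> nat) list \<Rightarrow> 'b" where
  "jm_append b f u = (\<Sum>a\<in>{1..<b}. f (u @ [(a, b)]))"

abbreviation wsum :: "nat \<Rightarrow> nat \<Rightarrow> ((nat \<times> nat) list \<Rightarrow> 'b :: ab_group_add) \<Rightarrow> 'b" where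
  "wsum b r f \<equiv> sum f (mwords {1..b} r)"

section \<open>Recurrences of the complete homogeneous polynomials in the Jucys-Murphy
  elements\<close>

lemma braid_invariant_append:
  assumes "braid_invariant f"
  shows "braid_invariant (\<lambda>u. f (u @ w))"
  unfolding braid_invariant_def append_assoc append_Cons
  using braid_flip [OF assms] braid_commute [OF assms] braid_triangle [OF assms] by blast

lemma braid_invariant_sum:
  assumes "\<And>i. i \<in> I \<Longrightarrow> braid_invariant (f i)"
  shows "braid_invariant (\<lambda>u. \<Sum>i\<in>I. f i u)"
  unfolding braid_invariant_def
  by (intro conjI allI impI sum.cong refl braid_flip [OF assms] braid_commute [OF assms]
      braid_triangle [OF assms])

lemma braid_invariant_add:
  assumes "braid_invariant f" "braid_invariant g"
  shows "braid_invariant (\<lambda>u. f u + g u)"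
  unfolding braid_invariant_def
  by (intro conjI allI impI arg_cong2 [where f = "(+)"] assms [THEN braid_flip]
      assms [THEN braid_commute] assms [THEN braid_triangle])

lemma braid_invariant_jm_append:
  "braid_invariant f \<Longrightarrow> braid_invariant (jm_append b f)"
  unfolding jm_append_def [abs_def] by (intro braid_invariant_sum braid_invariant_append)

text \<open>By monotonicity the largest second entry comes last, so a word in which
  \<open>Suc b\<close> occurs ends in such a letter.\<close>

lemma mwords_Suc_snoc:
  "{fs \<in> mwords {1..Suc b} (Suc r). \<not> fs \<in> mwords {1..b} (Suc r)} =
    (\<lambda>(fs, a). fs @ [(a, Suc b)]) ` (mwords {1..Suc b} r \<times> {1..<Suc b})" (is "?L = ?R")
proof (intro equalityI subsetI)
  fix fs assume fs: "fs \<in> ?L"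
  then obtain gs a c where gs: "fs = gs @ [(a, c)]"
    by (cases fs rule: rev_cases) (auto simp: mwords_def)
  have "c = Suc b"
  proof (rule ccontr)
    assume "c \<noteq> Suc b"
    then have "c \<le> b" using fs gs by (auto simp: mwords_def)
    moreover have "\<forall>(x, y)\<in>set fs. y \<le> c"
      using fs by (force simp: mwords_def gs sorted_append)
    ultimately have "fs \<in> mwords {1..b} (Suc r)"
      using fs by (fastforce simp: mwords_def)
    then show False using fs by simp
  qed
  then show "fs \<in> ?R"
    using fs gs by (auto simp: mwords_def sorted_append intro!: image_eqI [of _ _ "(gs, a)"])
next
  fix fs assume "fs \<in> ?R"
  then show "fs \<in> ?L" by (fastforce simp: mwords_def sorted_append)
qed

text \<open>The recurrence h_{r+1}(J_1, ..., J_{b+1}) = h_{r+1}(J_1, ..., J_b) + h_r(J_1, ...,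
  J_{b+1}) J_{b+1}.\<close>

lemma wsum_Suc:
  "wsum (Suc b) (Suc r) f = wsum b (Suc r) f + wsum (Suc b) r (jm_append (Suc b) f)"
proof -
  have "mwords {1..Suc b} (Suc r) = mwords {1..b} (Suc r) \<union>
      {fs \<in> mwords {1..Suc b} (Suc r). \<not> fs \<in> mwords {1..b} (Suc r)}"
    by (fastforce simp: mwords_def)
  then have "wsum (Suc b) (Suc r) f = wsum b (Suc r) f +
      sum f {fs \<in> mwords {1..Suc b} (Suc r). \<not> fs \<in> mwords {1..b} (Suc r)}"
    by (simp add: sum.union_disjoint [symmetric] disjoint_iff)
  also have "sum f {fs \<in> mwords {1..Suc b} (Suc r). \<not> fs \<in> mwords {1..b} (Suc r)} =
      (\<Sum>(fs, a)\<in>mwords {1..Suc b} r \<times> {1..<Suc b}. f (fs @ [(a, Suc b)]))"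
    unfolding mwords_Suc_snoc
    by (subst sum.reindex) (auto simp: inj_on_def case_prod_beta)
  finally show ?thesis by (simp only: jm_append_def [abs_def] sum.cartesian_product)
qed

text \<open>Three applications of the recurrence leave the last two Jucys-Murphy elements only in
  the combinations J_{k+1} + J_{k+2} and J_{k+2} J_{k+1}, next to sums with fewer letters. Neither
  element alone is invariant under exchanging \<open>k + 1\<close> and \<open>k + 2\<close>, but
  these two combinations are.\<close>

lemma wsum_two_steps:
  "wsum (Suc (Suc k)) (Suc (Suc r)) f = wsum k (Suc (Suc r)) f
     + wsum (Suc (Suc k)) (Suc r) (\<lambda>u. jm_append (Suc (Suc k)) f u + jm_append (Suc k) f u)
     - wsum (Suc (Suc k)) r (jm_append (Suc (Suc k)) (jm_append (Suc k) f))"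
  using wsum_Suc [of f "Suc k" "Suc r"] wsum_Suc [of f k "Suc r"]
    wsum_Suc [of "jm_append (Suc k) f" "Suc k" r]
  by (simp add: sum.distrib algebra_simps)

lemma relabel_id:
  assumes "\<And>a b. (a, b) \<in> set fs \<Longrightarrow> \<phi> a = a \<and> \<phi> b = b"
  shows "relabel \<phi> fs = fs"
  using assms unfolding relabel_def by (intro map_idI) (force simp: map_prod_def)

lemma wsum_relabel_id:
  assumes "\<And>a. a \<le> k \<Longrightarrow> \<phi> a = a"
  shows "wsum k r (\<lambda>fs. f (relabel \<phi> fs)) = wsum k r f"
  by (intro sum.cong refl arg_cong [where f = f] relabel_id) (auto simp: mwords_def intro!: assms)

text \<open>Conjugation by \<open>s\<close> exchanges the letters \<open>(a, i)\<close> and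
  \<open>(a, Suc i)\<close> for \<open>a < i\<close> and flips \<open>(i, Suc i)\<close>.\<close>

lemma jm_append_e1_relabel:
  assumes f: "braid_invariant f" and i: "i \<ge> 1" and s: "s = transpose i (Suc i)"
  shows "jm_append (Suc i) (\<lambda>u. f (relabel s u)) u + jm_append i (\<lambda>u. f (relabel s u)) u =
    jm_append (Suc i) f (relabel s u) + jm_append i f (relabel s u)"
proof -
  have I: "{1..<Suc i} = insert i {1..<i}" using i by auto
  have s': "s i = Suc i" "s (Suc i) = i" "\<And>a. a < i \<Longrightarrow> s a = a"
    using s by (auto simp: transpose_def)
  show ?thesis
    unfolding jm_append_def I
    by (simp add: s' braid_flip [OF f, of _ "Suc i" i] cong: sum.cong_simp)
qed

text \<open>Conjugation exchanges the second entries \<open>i\<close> and \<open>Suc i\<close> of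
  the two letters. Disjoint letters commute back into place, whereas the terms whose letters share
  \<open>c\<close> and the terms containing the letter \<open>(i, Suc i)\<close> exchange their
  roles.\<close>

lemma jm_append_e2_relabel:
  assumes f: "braid_invariant f" and i: "i \<ge> 1" and s: "s = transpose i (Suc i)"
  shows "jm_append (Suc i) (jm_append i (\<lambda>u. f (relabel s u))) u =
    jm_append (Suc i) (jm_append i f) (relabel s u)"
proof -
  have I: "{1..<Suc i} = insert i {1..<i}" using i by auto
  have s': "s i = Suc i" "s (Suc i) = i" "\<And>a. a < i \<Longrightarrow> s a = a"
    using s by (auto simp: transpose_def)
  define w where "w = relabel s u"
  let ?G1 = "\<lambda>a c. f (w @ [(a, i), (c, Suc i)])"
  let ?G2 = "\<lambda>a c. f (w @ [(a, Suc i), (c, i)])"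
  let ?K = "\<lambda>c. f (w @ [(i, Suc i), (c, i)])"
  \<comment> \<open>On the diagonal the points \<open>c\<close>, \<open>i\<close>,
    \<open>Suc i\<close> form a triangle, and two rotations lead to \<open>?K c\<close> instead of
    \<open>?G2 c c\<close>. The missing \<open>?G2 c c\<close> is supplied by \<open>K\<close>
    below.\<close>
  have G1: "?G1 a c = ?G2 c a + (if a = c then ?K c - ?G2 c c else 0)" if "a < i" "c < i" for a c
  proof (cases "a = c")
    case True
    have "?G1 c c = f (w @ [(i, c), (c, Suc i)])"
      using braid_flip [OF f, of w c i] by simp
    also have "\<dots> = f (w @ [(c, Suc i), (Suc i, i)])"
      using braid_triangle [OF f, of i c "Suc i" w "[]"] that by simp
    also have "\<dots> = f (w @ [(Suc i, i), (i, c)])"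
      using braid_triangle [OF f, of c "Suc i" i w "[]"] that by simp
    also have "\<dots> = ?K c"
      using braid_flip [OF f, of w "Suc i" i] braid_flip [OF f, of "w @ [(i, Suc i)]" c i] by simp
    finally show ?thesis using True by simp
  next
    case False
    then show ?thesis using that braid_commute [OF f, of a i c "Suc i" w "[]"] by simp
  qed
  have K: "f (w @ [(Suc i, i), (c, Suc i)]) = ?G2 c c" if "c < i" for c
  proof -
    have "f (w @ [(Suc i, i), (c, Suc i)]) = f (w @ [(i, Suc i), (Suc i, c)])"
      using braid_flip [OF f, of w "Suc i" i] braid_flip [OF f, of "w @ [(i, Suc i)]" c "Suc i"]
      by simp
    also have "\<dots> = f (w @ [(Suc i, c), (c, i)])"
      using braid_triangle [OF f, of i "Suc i" c w "[]"] that by simp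
    also have "\<dots> = ?G2 c c" using braid_flip [OF f, of w "Suc i" c] by simp
    finally show ?thesis .
  qed
  have "(\<Sum>a\<in>{1..<i}. \<Sum>c\<in>{1..<i}. ?G1 a c) =
      (\<Sum>a\<in>{1..<i}. \<Sum>c\<in>{1..<i}. ?G2 c a + (if a = c then ?K c - ?G2 c c else 0))"
    by (intro sum.cong refl G1) auto
  also have "\<dots> = (\<Sum>a\<in>{1..<i}. \<Sum>c\<in>{1..<i}. ?G2 c a) + (\<Sum>a\<in>{1..<i}. ?K a - ?G2 a a)"
    by (simp add: sum.distrib)
  also have "(\<Sum>a\<in>{1..<i}. \<Sum>c\<in>{1..<i}. ?G2 c a) = (\<Sum>a\<in>{1..<i}. \<Sum>c\<in>{1..<i}. ?G2 a c)"
    by (rule sum.swap)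
  finally show ?thesis
    unfolding jm_append_def I
    by (simp add: s' K w_def [symmetric] sum_subtractf cong: sum.cong_simp)
qed

text \<open>The induction on \<open>b\<close> starts at \<open>Suc i\<close>, where the two-step
  recurrence applies; it lowers \<open>r\<close> by one or two, hence the strong induction on
  \<open>r\<close>. For larger \<open>b\<close> the permutation \<open>s\<close> fixes
  \<open>Suc b\<close> and permutes the smaller points, so it commutes with the new Jucys-Murphy
  element and the one-step recurrence suffices.\<close>

theorem wsum_relabel_adjacent:
  assumes f: "braid_invariant f" and i: "1 \<le> i" "Suc i \<le> b" and s: "s = transpose i (Suc i)"
  shows "wsum b r (\<lambda>fs. f (relabel s fs)) = wsum b r f"
  using i(2) f
proof (induction b arbitrary: f r rule: dec_induct)
  case base
  then show ?case
  proof (induction r arbitrary: f rule: less_induct)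
    case (less r)
    obtain k where k: "i = Suc k" using i by (cases i) auto
    let ?e1 = "\<lambda>f u. jm_append (Suc i) f u + jm_append i f u"
    let ?e2 = "\<lambda>f. jm_append (Suc i) (jm_append i f)"
    let ?fs = "\<lambda>u. f (relabel s u)"
    have id: "wsum k r ?fs = wsum k r f" for r
      by (rule wsum_relabel_id) (simp add: s k transpose_def)
    consider "r = 0" | "r = 1" | q where "r = Suc (Suc q)"
      by (metis One_nat_def not0_implies_Suc)
    then show ?case
    proof cases
      case 1 then show ?thesis by simp
    next
      case 2
      have "wsum (Suc i) (Suc 0) f = wsum k (Suc 0) f + ?e1 f []" for f :: "_ \<Rightarrow> 'a"
        unfolding k using wsum_Suc [of f "Suc k" 0] wsum_Suc [of f k 0] by (simp add: ac_simps)
      then show ?thesis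
        using 2 id [of 1] jm_append_e1_relabel [OF less.prems i(1) s, of "[]"] by simp
    next
      case 3
      have *: "wsum (Suc i) r f = wsum k r f + wsum (Suc i) (Suc q) (?e1 f) - wsum (Suc i) q (?e2 f)"
        for f :: "_ \<Rightarrow> 'a"
        unfolding 3 k by (rule wsum_two_steps)
      have e1: "?e1 ?fs = (\<lambda>u. ?e1 f (relabel s u))"
        using jm_append_e1_relabel [OF less.prems i(1) s] by blast
      have e2: "?e2 ?fs = (\<lambda>u. ?e2 f (relabel s u))"
        using jm_append_e2_relabel [OF less.prems i(1) s] by blast
      have "wsum (Suc i) (Suc q) (\<lambda>u. ?e1 f (relabel s u)) = wsum (Suc i) (Suc q) (?e1 f)"
        using 3 less.prems
        by (intro less.IH braid_invariant_add braid_invariant_jm_append) auto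
      moreover have "wsum (Suc i) q (\<lambda>u. ?e2 f (relabel s u)) = wsum (Suc i) q (?e2 f)"
        using 3 less.prems by (intro less.IH braid_invariant_jm_append) auto
      ultimately show ?thesis
        by (simp only: * [of f] * [of ?fs] e1 e2 id)
    qed
  qed
next
  case (step b)
  show ?case using step.prems
  proof (induction r arbitrary: f)
    case 0 then show ?case by simp
  next
    case (Suc r)
    have "bij_betw s {1..<Suc b} {1..<Suc b}"
    proof -
      have "s permutes {1..<Suc b}" unfolding s using i step.hyps by (intro permutes_swap_id) auto
      then show ?thesis by (rule permutes_imp_bij)
    qed
    moreover have "s (Suc b) = Suc b" using step.hyps by (simp add: s transpose_def)
    ultimately have "jm_append (Suc b) (\<lambda>u. f (relabel s u)) = (\<lambda>u. jm_append (Suc b) f (relabel s u))"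
      unfolding jm_append_def fun_eq_iff relabel_simps
      by (auto simp del: sum.op_ivl_Suc
        intro: sum.reindex_bij_betw [of s _ _ "\<lambda>a. f (relabel s _ @ [(a, Suc b)])"])
    then show ?case
      unfolding wsum_Suc using Suc.IH [OF braid_invariant_jm_append [OF Suc.prems], of "Suc b"]
        step.IH [OF Suc.prems] by (simp only:)
  qed
qed

text \<open>Centrality in the form used later: the mark travels to \<open>d\<close> one step at a
  time. Equivariance is required on monotone words only, but braid invariance on all words, since
  the rearrangements behind centrality leave the monotone ones.\<close>

corollary wsum_equivariant:
  assumes inv: "\<And>x. braid_invariant (\<lambda>fs. \<Psi> fs x)"
    and eq: "\<And>i fs. \<lbrakk>1 \<le> i; i < d; fs \<in> mwords {1..d} r\<rbrakk> \<Longrightarrow>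
      \<Psi> (relabel (transpose i (Suc i)) fs) (Suc i) = \<Psi> fs i"
    and x: "x \<in> {1..d}"
  shows "wsum d r (\<lambda>fs. \<Psi> fs x) = wsum d r (\<lambda>fs. \<Psi> fs d)"
proof -
  have "x \<le> d" "1 \<le> x" using x by auto
  then show ?thesis
  proof (induction rule: inc_induct)
    case base then show ?case by simp
  next
    case (step n)
    have "wsum d r (\<lambda>fs. \<Psi> fs n) =
        wsum d r (\<lambda>fs. \<Psi> (relabel (transpose n (Suc n)) fs) (Suc n))"
      using step by (intro sum.cong refl eq [symmetric]) auto
    also have "\<dots> = wsum d r (\<lambda>fs. \<Psi> fs (Suc n))"
      using step by (intro wsum_relabel_adjacent [where f = "\<lambda>fs. \<Psi> fs (Suc n)"] inv) auto
    finally show ?case using step by simp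
  qed
qed

section \<open>Transitivity and relabelling\<close>

lemma wperm_simps [simp]:
  "wperm [] = id"
  "wperm ((a, b) # fs) = transpose a b \<circ> wperm fs"
  by (simp_all add: wperm_def transps_def)

lemma wperm_append [simp]: "wperm (fs @ gs) = wperm fs \<circ> wperm gs"
  by (induction fs) (auto simp: fun_eq_iff)

lemma wperm_permutes:
  "set fs \<subseteq> S \<times> S \<Longrightarrow> wperm fs permutes S"
proof (induction fs)
  case (Cons x fs)
  obtain a b where x: "x = (a, b)" by (cases x)
  have "transpose a b permutes S" using Cons.prems x by (intro permutes_swap_id) auto
  moreover have "wperm fs permutes S" using Cons by auto
  ultimately show ?case unfolding x wperm_simps by (rule permutes_compose [rotated])
qed (simp add: permutes_id)

lemma mwords_letters: "fs \<in> mwords S r \<Longrightarrow> set fs \<subseteq> S \<times> S"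
  by (auto simp: mwords_def)

lemma mwords_permutes: "fs \<in> mwords S r \<Longrightarrow> wperm fs permutes S"
  by (intro wperm_permutes mwords_letters)

text \<open>The sets mapped to themselves by every transposition of the word, that is, the unions of
  orbits of the generated subgroup.\<close>

definition saturated :: "nat set \<Rightarrow> (nat \<times> nat) list \<Rightarrow> bool" where
  "saturated A fs \<longleftrightarrow> (\<forall>(a, b)\<in>set fs. a \<in> A \<longleftrightarrow> b \<in> A)"

lemma saturated_simps [simp]:
  "saturated A []"
  "saturated A ((a, b) # fs) \<longleftrightarrow> (a \<in> A \<longleftrightarrow> b \<in> A) \<and> saturated A fs"
  "saturated A (fs @ gs) \<longleftrightarrow> saturated A fs \<and> saturated A gs"
  by (simp_all add: saturated_def ball_Un)

lemma saturated_Int: "saturated A fs \<Longrightarrow> saturated B fs \<Longrightarrow> saturated (A \<inter> B) fs"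
  and saturated_Diff: "saturated A fs \<Longrightarrow> saturated B fs \<Longrightarrow> saturated (A - B) fs"
  by (simp_all add: saturated_def split_beta)

text \<open>Transitivity on \<open>S\<close> expressed by invariant sets instead of the group. In
  this form it makes sense for any \<open>S\<close>, in particular for one component of a word, and
  saturation is checked letter by letter.\<close>

definition linked :: "nat set \<Rightarrow> (nat \<times> nat) list \<Rightarrow> bool" where
  "linked S fs \<longleftrightarrow> (\<forall>A. saturated A fs \<longrightarrow> S \<subseteq> A \<or> S \<inter> A = {})"

lemma saturated_wperm: "saturated A fs \<Longrightarrow> wperm fs x \<in> A \<longleftrightarrow> x \<in> A"
proof (induction fs)
  case (Cons y fs)
  obtain a b where y: "y = (a, b)" by (cases y)
  have "transpose a b z \<in> A \<longleftrightarrow> z \<in> A" for z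
    using Cons.prems y by (auto simp: transpose_def)
  then show ?case using Cons y by simp
qed simp

text \<open>A saturated set is invariant under the whole subgroup, so transitivity leaves no room
  for one that separates points; conversely the orbit of \<open>x\<close> under the subgroup is
  itself saturated.\<close>

lemma transitive_on_iff_linked:
  assumes fs: "set fs \<subseteq> {1..d} \<times> {1..d}"
  shows "transitive_on d (generate (sym_group d) (set (transps fs))) \<longleftrightarrow> linked {1..d} fs"
    (is "transitive_on d ?G \<longleftrightarrow> _")
proof
  assume trans: "transitive_on d ?G"
  show "linked {1..d} fs"
    unfolding linked_def
  proof (intro allI impI)
    fix A assume A: "saturated A fs"
    have transp: "transpose a b x \<in> A \<longleftrightarrow> x \<in> A" if "(a, b) \<in> set fs" for a b x
      using that A by (auto simp: saturated_def transpose_def)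
    have G: "g x \<in> A \<longleftrightarrow> x \<in> A" if "g \<in> ?G" for g x
      using that
    proof (induction g arbitrary: x rule: generate.induct)
      case one
      then show ?case by (simp add: sym_group_one)
    next
      case (incl h)
      then show ?case using transp by (auto simp: transps_def)
    next
      case (inv h)
      then obtain a b where ab: "(a, b) \<in> set fs" "h = transpose a b"
        by (auto simp: transps_def)
      have "h permutes {1..d}" unfolding ab(2) using fs ab(1) by (intro permutes_swap_id) auto
      then have "inv\<^bsub>sym_group d\<^esub> h = inv' h"
        by (intro sym_group_inv_equality) (simp add: sym_group_carrier)
      then show ?case using ab transp by simp
    next
      case (eng g h)
      then show ?case by (simp add: sym_group_mult)
    qed
    show "{1..d} \<subseteq> A \<or> {1..d} \<inter> A = {}"
    proof (rule ccontr)
      assume "\<not> ?thesis"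
      then obtain x y where "x \<in> {1..d}" "x \<notin> A" "y \<in> {1..d}" "y \<in> A" by blast
      moreover from this obtain g where "g \<in> ?G" "g x = y"
        using trans unfolding transitive_on_def by metis
      ultimately show False using G by metis
    qed
  qed
next
  assume linked: "linked {1..d} fs"
  show "transitive_on d ?G"
    unfolding transitive_on_def
  proof (intro ballI)
    fix x y assume x: "x \<in> {1..d}" and y: "y \<in> {1..d}"
    define A where "A = (\<lambda>g. g x) ` ?G"
    have step: "transpose a b z \<in> A" if ab: "(a, b) \<in> set fs" and z: "z \<in> A" for a b z
    proof -
      obtain g where g: "g \<in> ?G" "z = g x" using z by (auto simp: A_def)
      have "transpose a b \<in> ?G" using ab by (intro generate.incl) (auto simp: transps_def intro: rev_image_eqI)
      then have "transpose a b \<otimes>\<^bsub>sym_group d\<^esub> g \<in> ?G" using g by (intro generate.eng)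
      then have "transpose a b \<circ> g \<in> ?G" by (simp add: sym_group_mult)
      then show ?thesis unfolding A_def g by (rule rev_image_eqI) simp
    qed
    have "saturated A fs"
      unfolding saturated_def
    proof clarify
      fix a b assume ab: "(a, b) \<in> set fs"
      show "a \<in> A \<longleftrightarrow> b \<in> A"
        using step [OF ab, of a] step [OF ab, of b] by auto
    qed
    moreover have "x \<in> A"
    proof -
      have "id \<in> ?G" using generate.one [of "sym_group d"] by (simp add: sym_group_one)
      then show ?thesis unfolding A_def by (rule rev_image_eqI) simp
    qed
    moreover have "{1..d} \<subseteq> A \<or> {1..d} \<inter> A = {}" if "saturated A fs"
      using linked that by (simp add: linked_def)
    ultimately have "y \<in> A" using x y by blast
    then show "\<exists>g\<in>?G. g x = y" by (auto simp: A_def)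
  qed
qed

text \<open>Each relation replaces one or two letters by a word with the same product and the same
  saturated sets, so a function of the product and of linkedness cannot see the change.\<close>

lemma braid_invariantI:
  assumes "\<And>fs gs. wperm fs = wperm gs \<Longrightarrow> (\<And>S. linked S fs \<longleftrightarrow> linked S gs) \<Longrightarrow> f fs = f gs"
  shows "braid_invariant f"
proof -
  have *: "f (u @ w @ v) = f (u @ w' @ v)"
    if "wperm w = wperm w'" "\<And>A. saturated A w \<longleftrightarrow> saturated A w'" for u v w w'
    using that by (intro assms) (simp_all add: linked_def)
  show ?thesis
    unfolding braid_invariant_def
  proof (intro conjI allI impI)
    show "f (u @ (a, b) # v) = f (u @ (b, a) # v)" for u v a b
    proof -
      have "f (u @ [(a, b)] @ v) = f (u @ [(b, a)] @ v)"
        by (intro *) (simp add: transpose_commute, auto)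
      then show ?thesis by simp
    qed
    show "f (u @ (a, b) # (c, d) # v) = f (u @ (c, d) # (a, b) # v)"
      if "distinct [a, b, c, d]" for u v a b c d
    proof -
      have "transpose a b \<circ> transpose c d = transpose c d \<circ> transpose a b"
        using that by (auto simp: fun_eq_iff transpose_def)
      then have "f (u @ [(a, b), (c, d)] @ v) = f (u @ [(c, d), (a, b)] @ v)"
        by (intro *) (simp, auto)
      then show ?thesis by simp
    qed
    show "f (u @ (a, b) # (b, c) # v) = f (u @ (b, c) # (c, a) # v)"
      if "distinct [a, b, c]" for u v a b c
    proof -
      have "transpose a b \<circ> transpose b c = transpose b c \<circ> transpose c a"
        using that by (auto simp: fun_eq_iff transpose_def)
      then have "f (u @ [(a, b), (b, c)] @ v) = f (u @ [(b, c), (c, a)] @ v)"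
        by (intro *) (simp, auto)
      then show ?thesis by simp
    qed
  qed
qed

section \<open>Relabelling as conjugation: products, orbits, transitivity\<close>

lemma wperm_relabel:
  assumes "inj_on \<phi> S" "set fs \<subseteq> S \<times> S" "x \<in> S"
  shows "wperm (relabel \<phi> fs) (\<phi> x) = \<phi> (wperm fs x)"
  using assms(2)
proof (induction fs)
  case (Cons y fs)
  obtain a b where y: "y = (a, b)" by (cases y)
  have ab: "a \<in> S" "b \<in> S" using Cons.prems y by auto
  have "wperm fs permutes S" using Cons.prems by (intro wperm_permutes) auto
  then have "wperm fs x \<in> S" using assms(3) by (simp add: permutes_in_image)
  then have "transpose (\<phi> a) (\<phi> b) (\<phi> (wperm fs x)) = \<phi> (transpose a b (wperm fs x))"
    using ab inj_on_eq_iff [OF assms(1)] by (auto simp: transpose_def)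
  moreover have "wperm (relabel \<phi> fs) (\<phi> x) = \<phi> (wperm fs x)"
    using Cons.prems by (intro Cons.IH) auto
  ultimately show ?case by (simp add: y)
qed simp

lemma orbit_relabel:
  assumes "inj_on \<phi> S" "set fs \<subseteq> S \<times> S" "x \<in> S" "finite S"
  shows "orbit (wperm (relabel \<phi> fs)) (\<phi> x) = \<phi> ` orbit (wperm fs) x"
proof -
  have "wperm fs permutes S" using assms(2) by (rule wperm_permutes)
  then have "x \<in> orbit (wperm fs) x" "orbit (wperm fs) x \<subseteq> S"
    using assms(3,4) permutes_orbit_subset [of _ S x] permutation_self_in_orbit
    unfolding permutation_permutes by metis+
  then show ?thesis
    by (intro orbit_inverse [symmetric] wperm_relabel [OF assms(1,2)]) auto
qed

lemma linked_relabel: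
  assumes inj: "inj_on \<phi> S" and fs: "set fs \<subseteq> S \<times> S"
  shows "linked (\<phi> ` S) (relabel \<phi> fs) \<longleftrightarrow> linked S fs"
proof
  assume L: "linked (\<phi> ` S) (relabel \<phi> fs)"
  show "linked S fs"
    unfolding linked_def
  proof (intro allI impI)
    fix A assume A: "saturated A fs"
    \<comment> \<open>\<open>A \<inter> S\<close> takes the place of \<open>A\<close> because
      \<open>\<phi>\<close> is injective on \<open>S\<close> only.\<close>
    have mem: "\<phi> a \<in> \<phi> ` (A \<inter> S) \<longleftrightarrow> a \<in> A" if "a \<in> S" for a
      using inj_on_image_mem_iff [OF inj that Int_lower2] that by simp
    have "saturated (\<phi> ` (A \<inter> S)) (relabel \<phi> fs)"
      unfolding saturated_def set_relabel
    proof clarify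
      fix a b assume ab: "(a, b) \<in> set fs"
      then have "a \<in> S" "b \<in> S" "a \<in> A \<longleftrightarrow> b \<in> A"
        using A fs by (auto simp: saturated_def)
      then show "\<phi> a \<in> \<phi> ` (A \<inter> S) \<longleftrightarrow> \<phi> b \<in> \<phi> ` (A \<inter> S)"
        by (simp only: mem)
    qed
    then have "\<phi> ` S = \<phi> ` (A \<inter> S) \<or> \<phi> ` S \<inter> \<phi> ` (A \<inter> S) = {}"
      using L unfolding linked_def by blast
    then show "S \<subseteq> A \<or> S \<inter> A = {}"
      using inj_on_image_eq_iff [OF inj, of S "A \<inter> S"]
        inj_on_image_Int [OF inj, of S "A \<inter> S"] by auto
  qed
next
  assume L: "linked S fs"
  show "linked (\<phi> ` S) (relabel \<phi> fs)"
    unfolding linked_def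
  proof (intro allI impI)
    fix A assume "saturated A (relabel \<phi> fs)"
    then have "saturated (\<phi> -` A) fs"
      by (auto simp: saturated_def set_relabel)
    then have "S \<subseteq> \<phi> -` A \<or> S \<inter> \<phi> -` A = {}" using L by (auto simp: linked_def)
    then show "\<phi> ` S \<subseteq> A \<or> \<phi> ` S \<inter> A = {}" by auto
  qed
qed

section \<open>Cycles and transpositions\<close>

definition cycles :: "nat set \<Rightarrow> (nat \<Rightarrow> nat) \<Rightarrow> nat set set" where
  "cycles S \<sigma> = orbit \<sigma> ` S"

lemma finite_cycles [simp]: "finite S \<Longrightarrow> finite (cycles S \<sigma>)"
  by (simp add: cycles_def)

lemma permutes_self_in_orbit: "\<sigma> permutes S \<Longrightarrow> finite S \<Longrightarrow> x \<in> orbit \<sigma> x"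
  using permutation_self_in_orbit permutation_permutes by metis

lemma permutes_orbit_eq_iff:
  assumes "\<sigma> permutes S" "finite S"
  shows "orbit \<sigma> x = orbit \<sigma> y \<longleftrightarrow> y \<in> orbit \<sigma> x"
proof
  assume "y \<in> orbit \<sigma> x"
  with cyclic_on_orbit [OF assms] show "orbit \<sigma> x = orbit \<sigma> y"
    using orbit_cyclic_eq3 by metis
qed (use permutes_self_in_orbit [OF assms] in auto)

lemma cycles_disjoint:
  assumes "\<sigma> permutes S" "finite S" "A \<in> cycles S \<sigma>" "B \<in> cycles S \<sigma>" "A \<noteq> B"
  shows "A \<inter> B = {}"
proof -
  obtain x y where xy: "A = orbit \<sigma> x" "B = orbit \<sigma> y" using assms by (auto simp: cycles_def)
  have "A = orbit \<sigma> z \<and> B = orbit \<sigma> z" if "z \<in> A \<inter> B" for z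
    using that unfolding xy permutes_orbit_eq_iff [OF assms(1,2)] by auto
  then show ?thesis using assms(5) by auto
qed

lemma cycles_subset: "\<sigma> permutes S \<Longrightarrow> A \<in> cycles S \<sigma> \<Longrightarrow> A \<subseteq> S"
  unfolding cycles_def using permutes_orbit_subset by fastforce

lemma cycles_nonempty: "A \<in> cycles S \<sigma> \<Longrightarrow> A \<noteq> {}"
  by (auto simp: cycles_def orbit_nonempty)

lemma cycles_eq_orbit:
  assumes "\<sigma> permutes S" "finite S" "A \<in> cycles S \<sigma>" "x \<in> A"
  shows "A = orbit \<sigma> x"
  using assms permutes_orbit_eq_iff [OF assms(1,2)] by (auto simp: cycles_def)

text \<open>The transposition stands on the right because the last letter of a word acts first. It
  gives \<open>\<tau> a = \<sigma> b\<close> and \<open>\<tau> b = \<sigma> a\<close>, so the new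
  cycle leaves \<open>a\<close>, runs through the cycle of \<open>b\<close> up to \<open>b\<close>
  and continues through the cycle of \<open>a\<close>.\<close>

lemma orbit_transpose_join:
  assumes \<sigma>: "\<sigma> permutes S" "finite S" and ab: "a \<in> S" "b \<in> S" "b \<notin> orbit \<sigma> a"
  shows "orbit (\<sigma> \<circ> transpose a b) a = orbit \<sigma> a \<union> orbit \<sigma> b"
    and "x \<notin> orbit \<sigma> a \<union> orbit \<sigma> b \<Longrightarrow> orbit (\<sigma> \<circ> transpose a b) x = orbit \<sigma> x"
proof -
  define \<tau> where "\<tau> = \<sigma> \<circ> transpose a b"
  note self = permutes_self_in_orbit [OF \<sigma>] and eq = permutes_orbit_eq_iff [OF \<sigma>]
  have \<tau>: "\<tau> permutes S" unfolding \<tau>_def using \<sigma> ab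
    by (intro permutes_compose permutes_swap_id)
  note self' = permutes_self_in_orbit [OF \<tau> \<sigma>(2)] and eq' = permutes_orbit_eq_iff [OF \<tau> \<sigma>(2)]
  have \<tau>_simps: "\<tau> a = \<sigma> b" "\<tau> b = \<sigma> a" "\<And>x. x \<noteq> a \<Longrightarrow> x \<noteq> b \<Longrightarrow> \<tau> x = \<sigma> x"
    by (auto simp: \<tau>_def transpose_def)
  have ba: "a \<notin> orbit \<sigma> b" using ab eq self by metis
  have sub1: "y \<in> orbit \<tau> a" if "y \<in> orbit \<sigma> b" for y
    using that
  proof induction
    case base
    then show ?case using orbit.base [of \<tau> a] \<tau>_simps by simp
  next
    \<comment> \<open>Inside the cycle of \<open>b\<close> the two maps agree except at
      \<open>b\<close>, where \<open>\<sigma> b = \<tau> a\<close> starts the orbit anew.\<close>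
    case (step y)
    then show ?case
      using orbit.base [of \<tau> a] orbit.step [of y \<tau> a] \<tau>_simps ba by metis
  qed
  have sub2: "y \<in> orbit \<tau> b" if "y \<in> orbit \<sigma> a" for y
    using that
  proof induction
    case base
    then show ?case using orbit.base [of \<tau> b] \<tau>_simps by simp
  next
    case (step y)
    then show ?case
      using orbit.base [of \<tau> b] orbit.step [of y \<tau> b] \<tau>_simps ab by metis
  qed
  have "orbit \<tau> a = orbit \<tau> b" using sub1 [of b] self eq' by blast
  then have sup: "orbit \<sigma> a \<union> orbit \<sigma> b \<subseteq> orbit \<tau> a" using sub1 sub2 by auto
  have "y \<in> orbit \<sigma> a \<union> orbit \<sigma> b" if "y \<in> orbit \<tau> a" for y
    using that
  proof induction
    case base
    then show ?case using \<tau>_simps orbit.base [of \<sigma>] by simp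
  next
    case (step y)
    then show ?case using \<tau>_simps orbit.base [of \<sigma>] orbit.step [of y \<sigma>] by (metis Un_iff)
  qed
  with sup show "orbit (\<sigma> \<circ> transpose a b) a = orbit \<sigma> a \<union> orbit \<sigma> b"
    unfolding \<tau>_def by blast
  assume x: "x \<notin> orbit \<sigma> a \<union> orbit \<sigma> b"
  have "orbit \<tau> x = orbit \<sigma> x"
  proof (rule orbit_cong [OF self])
    fix s assume "s \<in> orbit \<sigma> x"
    then have "orbit \<sigma> x = orbit \<sigma> s" by (simp add: eq)
    then have "s \<noteq> a" "s \<noteq> b" using x self by auto
    then show "\<tau> s = \<sigma> s" using \<tau>_simps by simp
  qed
  then show "orbit (\<sigma> \<circ> transpose a b) x = orbit \<sigma> x" by (simp add: \<tau>_def)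
qed

lemma cycles_transpose_join:
  assumes \<sigma>: "\<sigma> permutes S" "finite S" and ab: "a \<in> S" "b \<in> S" "b \<notin> orbit \<sigma> a"
  shows "cycles S (\<sigma> \<circ> transpose a b) =
    insert (orbit \<sigma> a \<union> orbit \<sigma> b) (cycles S \<sigma> - {orbit \<sigma> a, orbit \<sigma> b})"
proof -
  define \<tau> where "\<tau> = \<sigma> \<circ> transpose a b"
  define U where "U = orbit \<sigma> a \<union> orbit \<sigma> b"
  have \<tau>: "\<tau> permutes S" unfolding \<tau>_def using \<sigma> ab
    by (intro permutes_compose permutes_swap_id)
  note eq = permutes_orbit_eq_iff [OF \<sigma>] and eq' = permutes_orbit_eq_iff [OF \<tau> \<sigma>(2)]
  have a: "orbit \<tau> a = U" and x: "\<And>x. x \<notin> U \<Longrightarrow> orbit \<tau> x = orbit \<sigma> x"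
    using orbit_transpose_join [OF assms] unfolding \<tau>_def U_def by blast+
  have x': "orbit \<tau> x = U" if "x \<in> U" for x using that a eq' [of a x] by simp
  have U: "orbit \<sigma> x \<in> {orbit \<sigma> a, orbit \<sigma> b} \<longleftrightarrow> x \<in> U" for x
    unfolding U_def using eq [of a x] eq [of b x] by auto
  have U_S: "a \<in> U" using permutes_self_in_orbit [OF \<sigma>] by (simp add: U_def)
  have "cycles S \<tau> = insert U (orbit \<sigma> ` (S - U))"
  proof -
    have "S = insert a (S \<inter> U) \<union> (S - U)" using ab by auto
    then have "cycles S \<tau> = orbit \<tau> ` insert a (S \<inter> U) \<union> orbit \<tau> ` (S - U)"
      unfolding cycles_def by (metis image_Un)
    also have "orbit \<tau> ` insert a (S \<inter> U) = {U}" using U_S x' by auto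
    also have "orbit \<tau> ` (S - U) = orbit \<sigma> ` (S - U)" using x by auto
    finally show ?thesis by simp
  qed
  also have "orbit \<sigma> ` (S - U) = cycles S \<sigma> - {orbit \<sigma> a, orbit \<sigma> b}"
    unfolding cycles_def using U by blast
  finally show ?thesis unfolding \<tau>_def U_def .
qed

lemma orbit_power_image:
  assumes \<sigma>: "\<sigma> permutes S" "finite S"
  shows "inj_on (\<lambda>n. (\<sigma> ^^ n) a) {..<card (orbit \<sigma> a)}"
    and "orbit \<sigma> a = (\<lambda>n. (\<sigma> ^^ n) a) ` {..<card (orbit \<sigma> a)}"
proof -
  define k where "k = funpow_dist1 \<sigma> a a"
  have self: "a \<in> orbit \<sigma> a" by (rule permutes_self_in_orbit [OF \<sigma>])
  have inj: "inj_on (\<lambda>n. (\<sigma> ^^ n) a) {..<k}"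
    using inj_on_funpow_dist1 [OF self] by (simp add: k_def lessThan_atLeast0)
  have eq: "orbit \<sigma> a = (\<lambda>n. (\<sigma> ^^ n) a) ` {..<k}"
    using orbit_conv_funpow_dist1 [OF self] by (simp add: k_def lessThan_atLeast0)
  then have "card (orbit \<sigma> a) = k" using inj by (simp add: card_image)
  then show "inj_on (\<lambda>n. (\<sigma> ^^ n) a) {..<card (orbit \<sigma> a)}"
    and "orbit \<sigma> a = (\<lambda>n. (\<sigma> ^^ n) a) ` {..<card (orbit \<sigma> a)}"
    using inj eq by auto
qed

text \<open>From \<open>b\<close> the new permutation jumps to \<open>\<sigma> a\<close> and then
  follows \<open>\<sigma>\<close> until it is back at \<open>b\<close> after \<open>i\<close> steps,
  without meeting \<open>a\<close>.\<close>

lemma orbit_transpose_cut: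
  assumes \<sigma>: "\<sigma> permutes S" "finite S" and a: "a \<in> S"
    and i: "0 < i" "i < card (orbit \<sigma> a)" and b: "b = (\<sigma> ^^ i) a"
  shows "orbit (\<sigma> \<circ> transpose a b) b = (\<lambda>n. (\<sigma> ^^ n) a) ` {1..i}"
    and "a \<notin> orbit (\<sigma> \<circ> transpose a b) b"
    and "card (orbit (\<sigma> \<circ> transpose a b) b) = i"
proof -
  define k where "k = card (orbit \<sigma> a)"
  define \<tau> where "\<tau> = \<sigma> \<circ> transpose a b"
  have inj: "(\<sigma> ^^ m) a = (\<sigma> ^^ n) a \<longleftrightarrow> m = n" if "m < k" "n < k" for m n
    using orbit_power_image(1) [OF \<sigma>, of a] that by (auto simp: k_def inj_on_def)
  have \<tau>_b: "\<tau> b = \<sigma> a" by (simp add: \<tau>_def)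
  have \<tau>_n: "\<tau> ((\<sigma> ^^ n) a) = (\<sigma> ^^ Suc n) a" if "n \<in> {1..<i}" for n
  proof -
    have "(\<sigma> ^^ n) a \<noteq> a" "(\<sigma> ^^ n) a \<noteq> b"
      using that i inj [of n 0] inj [of n i] by (auto simp: b k_def)
    then show ?thesis by (simp add: \<tau>_def transpose_def)
  qed
  have "(\<sigma> ^^ n) a \<in> orbit \<tau> b" if "n \<in> {1..i}" for n
  proof -
    have "1 \<le> n" "n \<le> i" using that by auto
    then show ?thesis
    proof (induction n rule: dec_induct)
      case base
      then show ?case using orbit.base [of \<tau> b] by (simp add: \<tau>_b)
    next
      case (step n)
      then show ?case using orbit.step [of "(\<sigma> ^^ n) a" \<tau> b] \<tau>_n [of n] by simp
    qed
  qed
  moreover have "y \<in> (\<lambda>n. (\<sigma> ^^ n) a) ` {1..i}" if "y \<in> orbit \<tau> b" for y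
    using that
  proof induction
    case base
    show ?case unfolding \<tau>_b using i by (intro image_eqI [of _ _ 1]) auto
  next
    case (step y)
    then obtain n where n: "n \<in> {1..i}" "y = (\<sigma> ^^ n) a" by auto
    show ?case
    proof (cases "n = i")
      case True
      then have "\<tau> y = \<sigma> a" using n \<tau>_b b by simp
      then show ?thesis using i by (intro image_eqI [of _ _ 1]) auto
    next
      case False
      then show ?thesis using n \<tau>_n [of n] by (intro image_eqI [of _ _ "Suc n"]) auto
    qed
  qed
  ultimately have orb: "orbit \<tau> b = (\<lambda>n. (\<sigma> ^^ n) a) ` {1..i}" by blast
  then show "orbit (\<sigma> \<circ> transpose a b) b = (\<lambda>n. (\<sigma> ^^ n) a) ` {1..i}" by (simp add: \<tau>_def)
  have "a \<noteq> (\<sigma> ^^ n) a" if "n \<in> {1..i}" for n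
    using that i inj [of n 0] by (auto simp: k_def)
  then show "a \<notin> orbit (\<sigma> \<circ> transpose a b) b" using orb by (auto simp: \<tau>_def)
  have "inj_on (\<lambda>n. (\<sigma> ^^ n) a) {1..i}" using i inj by (auto simp: inj_on_def k_def)
  then show "card (orbit (\<sigma> \<circ> transpose a b) b) = i" using orb by (simp add: \<tau>_def card_image)
qed

text \<open>The cut is a join read backwards: \<open>\<tau> \<circ> transpose a b = \<sigma>\<close>
  and \<open>a\<close>, \<open>b\<close> lie in different cycles of \<open>\<tau>\<close>, so the
  join lemma for \<open>\<tau>\<close> describes \<open>\<sigma>\<close>. The non-membership
  conclusions are what \<open>pmon_insert\<close> asks for.\<close>

lemma cycles_transpose_cut:
  assumes \<sigma>: "\<sigma> permutes S" "finite S" and a: "a \<in> S"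
    and i: "0 < i" "i < card (orbit \<sigma> a)" and b: "b = (\<sigma> ^^ i) a"
  obtains A B where "cycles S (\<sigma> \<circ> transpose a b) = insert A (insert B (cycles S \<sigma> - {orbit \<sigma> a}))"
    "A \<noteq> B" "A \<notin> cycles S \<sigma> - {orbit \<sigma> a}" "B \<notin> cycles S \<sigma> - {orbit \<sigma> a}"
    "card A = card (orbit \<sigma> a) - i" "card B = i"
proof -
  define \<tau> where "\<tau> = \<sigma> \<circ> transpose a b"
  define A B where "A = orbit \<tau> a" and "B = orbit \<tau> b"
  have "(\<sigma> ^^ i) a \<in> orbit \<sigma> a"
    using permutes_self_in_orbit [OF \<sigma>] by (rule funpow_in_orbit)
  then have b_S: "b \<in> S" using permutes_orbit_subset [OF \<sigma>(1) a] b by auto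
  have \<tau>: "\<tau> permutes S" unfolding \<tau>_def using \<sigma> a b_S
    by (intro permutes_compose permutes_swap_id)
  note eq' = permutes_orbit_eq_iff [OF \<tau> \<sigma>(2)] and self' = permutes_self_in_orbit [OF \<tau> \<sigma>(2)]
  have aB: "a \<notin> B" and cB: "card B = i"
    using orbit_transpose_cut [OF assms] by (auto simp: B_def \<tau>_def)
  then have bA: "b \<notin> A" using eq' [of a b] self' [of a] by (auto simp: A_def B_def)
  have \<sigma>': "\<tau> \<circ> transpose a b = \<sigma>" by (simp add: \<tau>_def comp_assoc)
  have join: "cycles S \<sigma> = insert (A \<union> B) (cycles S \<tau> - {A, B})" "orbit \<sigma> a = A \<union> B"
    using cycles_transpose_join [OF \<tau> \<sigma>(2) a b_S] orbit_transpose_join(1) [OF \<tau> \<sigma>(2) a b_S] bA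
    by (simp_all add: \<sigma>' A_def B_def)
  have mem: "A \<in> cycles S \<tau>" "B \<in> cycles S \<tau>" using a b_S by (auto simp: cycles_def A_def B_def)
  have AB: "A \<noteq> B" using bA self' by (auto simp: A_def B_def)
  then have disj: "A \<inter> B = {}" using cycles_disjoint [OF \<tau> \<sigma>(2) mem] by simp
  have ne: "A \<noteq> {}" "B \<noteq> {}" using mem cycles_nonempty by auto
  have AUB: "A \<union> B \<notin> cycles S \<tau> - {A, B}"
    using cycles_disjoint [OF \<tau> \<sigma>(2) mem(1), of "A \<union> B"] ne by auto
  have "cycles S \<sigma> - {orbit \<sigma> a} = cycles S \<tau> - {A, B}" using join AUB by auto
  moreover have "cycles S \<tau> = insert A (insert B (cycles S \<tau> - {A, B}))" using mem by auto
  moreover have "card (orbit \<sigma> a) = card A + card B"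
    unfolding join(2) using disj cycles_subset [OF \<tau>] mem \<sigma>(2)
    by (intro card_Un_disjoint) (auto intro: finite_subset)
  ultimately show ?thesis using that [of A B] AB cB by (simp add: \<tau>_def)
qed

section \<open>Derivatives and the join-cut operators\<close>

lemma mps_coeff_sum [simp]: "mps_coeff (\<Sum>i\<in>I. f i) m = (\<Sum>i\<in>I. mps_coeff (f i) m)"
  by (induction I rule: infinite_finite_induct) auto

lemma mps_coeff_deriv:
  "mps_coeff (mps_deriv v f) m = of_nat (Suc (count m v)) * mps_coeff f (add_mset v m)"
  by (simp add: mps_deriv_def)

lemma mps_deriv_add [simp]: "mps_deriv v (f + g) = mps_deriv v f + mps_deriv v g"
  and mps_deriv_0 [simp]: "mps_deriv v 0 = 0"
  by (rule mps_eqI; simp add: mps_coeff_deriv algebra_simps)+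

lemma mps_deriv_sum [simp]: "mps_deriv v (\<Sum>i\<in>I. f i) = (\<Sum>i\<in>I. mps_deriv v (f i))"
  by (induction I rule: infinite_finite_induct) auto

text \<open>Only the splittings with \<open>v\<close> in the left part survive, and stripping one
  \<open>v\<close> off turns its exponent into the factor that \<open>mps_deriv\<close>
  produces.\<close>

lemma sum_splits_count_left:
  fixes f :: "'v multiset \<Rightarrow> 'a :: comm_ring_1"
  shows "(\<Sum>(a, b)\<in>splits (add_mset v m). of_nat (count a v) * (f a * g b)) =
    (\<Sum>(a, b)\<in>splits m. of_nat (Suc (count a v)) * f (add_mset v a) * g b)"
proof -
  have "(\<Sum>(a, b)\<in>splits (add_mset v m). of_nat (count a v) * (f a * g b)) =
      (\<Sum>(a, b)\<in>{x \<in> splits (add_mset v m). v \<in># fst x}. of_nat (count a v) * (f a * g b))"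
    by (rule sum.mono_neutral_right) (auto, metis count_inI mult_zero_left of_nat_0)
  also have "\<dots> = (\<Sum>(a, b)\<in>splits m. of_nat (Suc (count a v)) * f (add_mset v a) * g b)"
    by (rule sum.reindex_bij_witness [where
          j = "\<lambda>(a, b). (a - {#v#}, b)" and i = "\<lambda>(a, b). (add_mset v a, b)"])
      (auto simp: splits_def mult.assoc dest!: multi_member_split)
  finally show ?thesis .
qed

lemma sum_splits_swap:
  "(\<Sum>(a, b)\<in>splits m. f a b) = (\<Sum>(a, b)\<in>splits m. f b a)"
  by (rule sum.reindex_bij_witness [where i = prod.swap and j = prod.swap])
    (auto simp: splits_def ac_simps)

text \<open>The exponent of \<open>v\<close> in a product of monomials is the sum of the two
  exponents, which splits the factor in front of the coefficient.\<close>

lemma mps_deriv_mult: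
  "mps_deriv v (f * g) = mps_deriv v f * g + f * mps_deriv v (g :: ('v, 'a :: comm_ring_1) mps)"
proof (rule mps_eqI)
  fix m
  let ?c = mps_coeff and ?M = "add_mset v m"
  have "?c (mps_deriv v (f * g)) m =
      (\<Sum>(a, b)\<in>splits ?M. of_nat (Suc (count m v)) * (?c f a * ?c g b))"
    by (simp add: mps_coeff_deriv mps_coeff_mult sum_distrib_left case_prod_beta)
  also have "\<dots> = (\<Sum>(a, b)\<in>splits ?M.
      of_nat (count a v) * (?c f a * ?c g b) + of_nat (count b v) * (?c g b * ?c f a))"
  proof (rule sum.cong [OF refl], clarify)
    fix a b assume "(a, b) \<in> splits ?M"
    then have "a + b = ?M" by (simp add: splits_def)
    then have "count a v + count b v = Suc (count m v)"
      using count_union [of a b v] by simp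
    then have "of_nat (Suc (count m v)) = (of_nat (count a v) + of_nat (count b v) :: 'a)"
      by (metis of_nat_add)
    then show "of_nat (Suc (count m v)) * (?c f a * ?c g b) =
        of_nat (count a v) * (?c f a * ?c g b) + of_nat (count b v) * (?c g b * ?c f a)"
      by (simp only: distrib_right mult.commute [of "?c g b"])
  qed
  also have "\<dots> = (\<Sum>(a, b)\<in>splits ?M. of_nat (count a v) * (?c f a * ?c g b)) +
      (\<Sum>(a, b)\<in>splits ?M. of_nat (count b v) * (?c g b * ?c f a))"
    by (simp only: sum.distrib split_def)
  also have "(\<Sum>(a, b)\<in>splits ?M. of_nat (count b v) * (?c g b * ?c f a)) =
      (\<Sum>(a, b)\<in>splits ?M. of_nat (count a v) * (?c g a * ?c f b))"
    by (rule sum_splits_swap)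
  also have "(\<Sum>(a, b)\<in>splits ?M. of_nat (count a v) * (?c f a * ?c g b)) + \<dots> =
      ?c (mps_deriv v f * g + mps_deriv v g * f) m"
    unfolding sum_splits_count_left by (simp only: mps_coeff_ring mps_coeff_mult mps_coeff_deriv)
  also have "mps_deriv v f * g + mps_deriv v g * f = mps_deriv v f * g + f * mps_deriv v g"
    by (simp only: mult.commute)
  finally show "?c (mps_deriv v (f * g)) m = ?c (mps_deriv v f * g + f * mps_deriv v g) m" .
qed

lemma mps_deriv_1 [simp]: "mps_deriv v 1 = 0"
  by (rule mps_eqI) (simp add: mps_coeff_deriv one_mps_def)

lemma mps_deriv_var: "mps_deriv u (mps_var v) = (if u = v then 1 else 0)"
  by (rule mps_eqI) (auto simp: mps_coeff_deriv mps_var_def one_mps_def)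

lemma mps_deriv_prod:
  "finite X \<Longrightarrow> mps_deriv v (\<Prod>x\<in>X. f x) = (\<Sum>x\<in>X. mps_deriv v (f x) * (\<Prod>y\<in>X - {x}. f y))"
proof (induction X rule: finite_induct)
  case (insert x X)
  have "(\<Sum>y\<in>X. mps_deriv v (f y) * (\<Prod>z\<in>insert x X - {y}. f z)) =
      f x * (\<Sum>y\<in>X. mps_deriv v (f y) * (\<Prod>z\<in>X - {y}. f z))"
    unfolding sum_distrib_left
  proof (rule sum.cong [OF refl])
    fix y assume "y \<in> X"
    then have "insert x X - {y} = insert x (X - {y})" using insert by auto
    then show "mps_deriv v (f y) * (\<Prod>z\<in>insert x X - {y}. f z) =
        f x * (mps_deriv v (f y) * (\<Prod>z\<in>X - {y}. f z))"
      using insert by (simp add: ac_simps)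
  qed
  then show ?case using insert by (simp add: mps_deriv_mult)
qed simp

text \<open>Indexed by a set of cycles instead of a partition: a derivative then removes one cycle,
  and cycles of equal length remain distinct factors.\<close>

definition pmon :: "nat set set \<Rightarrow> (indet, rat) mps" where
  "pmon X = (\<Prod>c\<in>X. p_var (card c))"

lemma pmon_insert: "finite X \<Longrightarrow> A \<notin> X \<Longrightarrow> pmon (insert A X) = p_var (card A) * pmon X"
  by (simp add: pmon_def)

lemma pmon_Un: "finite X \<Longrightarrow> finite Y \<Longrightarrow> X \<inter> Y = {} \<Longrightarrow> pmon (X \<union> Y) = pmon X * pmon Y"
  by (simp add: pmon_def prod.union_disjoint)

text \<open>The product rule deletes one cycle at a time. Cardinality 0 is excluded because
  \<open>ind_p 0\<close> and \<open>ind_p 1\<close> are the same indeterminate.\<close>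

lemma deriv_pmon:
  assumes "finite X" "\<And>A. A \<in> X \<Longrightarrow> card A \<ge> 1" "i \<ge> 1"
  shows "mps_deriv (ind_p i) (pmon X) = (\<Sum>A\<in>X. if card A = i then pmon (X - {A}) else 0)"
  unfolding pmon_def mps_deriv_prod [OF assms(1)]
proof (rule sum.cong [OF refl])
  fix A assume "A \<in> X"
  then have "i - 1 = card A - 1 \<longleftrightarrow> card A = i" using assms(2) [of A] assms(3) by auto
  then show "mps_deriv (ind_p i) (p_var (card A)) * (\<Prod>c\<in>X - {A}. p_var (card c)) =
      (if card A = i then \<Prod>c\<in>X - {A}. p_var (card c) else 0)"
    by (simp add: mps_deriv_var)
qed

text \<open>The first two terms of the equation with both indices cut off at \<open>N\<close>, which
  loses nothing on monomials in the \<open>p\<close> whose indices are at most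
  \<open>N\<close>.\<close>

definition join_cut_lin :: "nat \<Rightarrow> (indet, rat) mps \<Rightarrow> (indet, rat) mps" where
  "join_cut_lin N q = (\<Sum>i\<in>{1..N}. \<Sum>j\<in>{1..N}.
     of_nat (i + j) * p_var i * p_var j * mps_deriv (ind_p (i + j)) q
     + of_nat (i * j) * p_var (i + j) * mps_deriv (ind_p i) (mps_deriv (ind_p j) q))"

text \<open>The quadratic term, polarised, since the two components of a split word contribute
  different coefficients.\<close>

definition join_cut_bil :: "nat \<Rightarrow> (indet, rat) mps \<Rightarrow> (indet, rat) mps \<Rightarrow> (indet, rat) mps" where
  "join_cut_bil N q r = (\<Sum>i\<in>{1..N}. \<Sum>j\<in>{1..N}.
     of_nat (i * j) * p_var (i + j) * mps_deriv (ind_p i) q * mps_deriv (ind_p j) r)"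

lemma sum_if_index:
  assumes "finite I" "k \<in> I"
  shows "(\<Sum>i\<in>I. if k = i then f i else 0) = f k"
  using assms by simp

lemma mult_if_0: "c * (if P then x else 0) = (if P then c * x else (0 :: 'a :: mult_zero))"
  by simp

lemma sum_pairs_of_sum:
  fixes k :: nat
  assumes "k \<le> N"
  shows "(\<Sum>i\<in>{1..N}. \<Sum>j\<in>{1..N}. if k = i + j then h i j else 0) = (\<Sum>i\<in>{1..<k}. h i (k - i))"
proof -
  have "(\<Sum>j\<in>{1..N}. if k = i + j then h i j else 0) = (if i \<in> {1..<k} then h i (k - i) else 0)"
    if "i \<in> {1..N}" for i
  proof -
    have "(k = i + j) = (k - i = j)" if "j \<in> {1..N}" for j using that by auto
    then have "(\<Sum>j\<in>{1..N}. if k = i + j then h i j else 0) =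
        (\<Sum>j\<in>{1..N}. if k - i = j then h i j else 0)"
      by (intro sum.cong refl) simp
    also have "\<dots> = (if k - i \<in> {1..N} then h i (k - i) else 0)" by simp
    also have "k - i \<in> {1..N} \<longleftrightarrow> i \<in> {1..<k}" using assms that by auto
    finally show ?thesis .
  qed
  then have "(\<Sum>i\<in>{1..N}. \<Sum>j\<in>{1..N}. if k = i + j then h i j else 0) =
      (\<Sum>i\<in>{1..N}. if i \<in> {1..<k} then h i (k - i) else 0)"
    by (rule sum.cong [OF refl])
  also have "\<dots> = (\<Sum>i\<in>{1..<k}. h i (k - i))"
    using assms by (subst sum.inter_restrict [symmetric]) (auto intro: sum.cong)
  finally show ?thesis .
qed

text \<open>The coefficients are numbers of points: \<open>card A\<close> counts the choices of
  \<open>a\<close> in the cycle to be cut, with \<open>i\<close> as the distance from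
  \<open>a\<close> to the other point, and \<open>card A * card B\<close> counts the pairs whose
  transposition joins the two cycles.\<close>

lemma join_cut_lin_pmon:
  assumes X: "finite X" "\<And>A. A \<in> X \<Longrightarrow> card A \<in> {1..N}"
  shows "join_cut_lin N (pmon X) = (\<Sum>A\<in>X.
     (\<Sum>i\<in>{1..<card A}. of_nat (card A) * p_var i * p_var (card A - i) * pmon (X - {A})) +
     (\<Sum>B\<in>X - {A}. of_nat (card A * card B) * p_var (card A + card B) * pmon (X - {A} - {B})))"
proof -
  let ?h = "\<lambda>i j A. of_nat (i + j) * p_var i * p_var j * pmon (X - {A})"
  have "(\<Sum>i\<in>{1..N}. \<Sum>j\<in>{1..N}. of_nat (i + j) * p_var i * p_var j * mps_deriv (ind_p (i + j)) (pmon X))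
      = (\<Sum>i\<in>{1..N}. \<Sum>j\<in>{1..N}. \<Sum>A\<in>X. if card A = i + j then ?h i j A else 0)"
  proof (intro sum.cong refl)
    fix i j assume "i \<in> {1..N}" "j \<in> {1..N}"
    then have "mps_deriv (ind_p (i + j)) (pmon X) = (\<Sum>A\<in>X. if card A = i + j then pmon (X - {A}) else 0)"
      using X by (intro deriv_pmon) auto
    then show "of_nat (i + j) * p_var i * p_var j * mps_deriv (ind_p (i + j)) (pmon X) =
        (\<Sum>A\<in>X. if card A = i + j then ?h i j A else 0)"
      by (simp only: sum_distrib_left) (intro sum.cong refl, simp)
  qed
  also have "\<dots> = (\<Sum>A\<in>X. \<Sum>i\<in>{1..N}. \<Sum>j\<in>{1..N}. if card A = i + j then ?h i j A else 0)"
    by (simp only: sum.swap [of _ _ X])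
  also have "\<dots> = (\<Sum>A\<in>X. \<Sum>i\<in>{1..<card A}. ?h i (card A - i) A)"
    using X by (intro sum.cong refl sum_pairs_of_sum) auto
  also have "\<dots> = (\<Sum>A\<in>X. \<Sum>i\<in>{1..<card A}. of_nat (card A) * p_var i * p_var (card A - i) * pmon (X - {A}))"
    by (intro sum.cong refl) auto
  finally have cut: "(\<Sum>i\<in>{1..N}. \<Sum>j\<in>{1..N}.
      of_nat (i + j) * p_var i * p_var j * mps_deriv (ind_p (i + j)) (pmon X)) = \<dots>" .
  let ?g = "\<lambda>i j A B. of_nat (i * j) * p_var (i + j) * pmon (X - {A} - {B})"
  have "(\<Sum>i\<in>{1..N}. \<Sum>j\<in>{1..N}.
      of_nat (i * j) * p_var (i + j) * mps_deriv (ind_p i) (mps_deriv (ind_p j) (pmon X)))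
      = (\<Sum>i\<in>{1..N}. \<Sum>j\<in>{1..N}. \<Sum>A\<in>X. if card A = j then \<Sum>B\<in>X - {A}.
          if card B = i then ?g i j A B else 0 else 0)"
  proof (intro sum.cong refl)
    fix i j assume ij: "i \<in> {1..N}" "j \<in> {1..N}"
    then have "mps_deriv (ind_p j) (pmon X) = (\<Sum>A\<in>X. if card A = j then pmon (X - {A}) else 0)"
      using X by (intro deriv_pmon) auto
    moreover have "mps_deriv (ind_p i) (if card A = j then pmon (X - {A}) else 0) =
        (if card A = j then \<Sum>B\<in>X - {A}. if card B = i then pmon (X - {A} - {B}) else 0 else 0)" for A
    proof -
      have "mps_deriv (ind_p i) (pmon (X - {A})) =
          (\<Sum>B\<in>X - {A}. if card B = i then pmon (X - {A} - {B}) else 0)"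
        using X ij by (intro deriv_pmon) auto
      then show ?thesis by (cases "card A = j") simp_all
    qed
    ultimately have "mps_deriv (ind_p i) (mps_deriv (ind_p j) (pmon X)) = (\<Sum>A\<in>X.
        if card A = j then \<Sum>B\<in>X - {A}. if card B = i then pmon (X - {A} - {B}) else 0 else 0)"
      by (simp only: mps_deriv_sum)
    then show "of_nat (i * j) * p_var (i + j) * mps_deriv (ind_p i) (mps_deriv (ind_p j) (pmon X)) =
        (\<Sum>A\<in>X. if card A = j then \<Sum>B\<in>X - {A}. if card B = i then ?g i j A B else 0 else 0)"
      by (simp only: sum_distrib_left mult_if_0)
  qed
  also have "\<dots> = (\<Sum>A\<in>X. \<Sum>i\<in>{1..N}. \<Sum>j\<in>{1..N}. if card A = j then \<Sum>B\<in>X - {A}.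
          if card B = i then ?g i j A B else 0 else 0)"
    by (simp only: sum.swap [of _ _ X])
  also have "\<dots> = (\<Sum>A\<in>X. \<Sum>B\<in>X - {A}. ?g (card B) (card A) A B)"
  proof (intro sum.cong refl)
    fix A assume A: "A \<in> X"
    then have "card A \<in> {1..N}" using X by auto
    then have "(\<Sum>i\<in>{1..N}. \<Sum>j\<in>{1..N}. if card A = j then \<Sum>B\<in>X - {A}.
          if card B = i then ?g i j A B else 0 else 0) =
        (\<Sum>i\<in>{1..N}. \<Sum>B\<in>X - {A}. if card B = i then ?g i (card A) A B else 0)"
      by (simp only: sum_if_index finite_atLeastAtMost)
    also have "\<dots> = (\<Sum>B\<in>X - {A}. \<Sum>i\<in>{1..N}. if card B = i then ?g i (card A) A B else 0)"
      by (rule sum.swap)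
    also have "\<dots> = (\<Sum>B\<in>X - {A}. ?g (card B) (card A) A B)"
      using X by (intro sum.cong refl sum_if_index) auto
    finally show "(\<Sum>i\<in>{1..N}. \<Sum>j\<in>{1..N}. if card A = j then \<Sum>B\<in>X - {A}.
          if card B = i then ?g i j A B else 0 else 0) = \<dots>" .
  qed
  also have "\<dots> = (\<Sum>A\<in>X. \<Sum>B\<in>X - {A}. ?g (card A) (card B) A B)"
    by (simp only: mult.commute add.commute)
  finally show ?thesis
    unfolding join_cut_lin_def sum.distrib cut by (simp only:)
qed

section \<open>Multiplication by all transpositions\<close>

lemma sum_over_orbits:
  fixes g :: "nat set \<Rightarrow> 'a :: comm_ring_1"
  assumes \<sigma>: "\<sigma> permutes S" "finite S"
  shows "(\<Sum>a\<in>S. g (orbit \<sigma> a)) = (\<Sum>A\<in>cycles S \<sigma>. of_nat (card A) * g A)"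
proof -
  have "(\<Sum>a\<in>S. g (orbit \<sigma> a)) = (\<Sum>A\<in>cycles S \<sigma>. \<Sum>a\<in>{a \<in> S. orbit \<sigma> a = A}. g (orbit \<sigma> a))"
    unfolding cycles_def using \<sigma>(2) by (rule sum.image_gen)
  also have "\<dots> = (\<Sum>A\<in>cycles S \<sigma>. of_nat (card A) * g A)"
  proof (intro sum.cong refl)
    fix A assume A: "A \<in> cycles S \<sigma>"
    have "{a \<in> S. orbit \<sigma> a = A} = A"
      using cycles_eq_orbit [OF \<sigma> A] cycles_subset [OF \<sigma>(1) A] permutes_self_in_orbit [OF \<sigma>] by blast
    then have "(\<Sum>a\<in>{a \<in> S. orbit \<sigma> a = A}. g (orbit \<sigma> a)) = (\<Sum>a\<in>A. g A)"
      by (intro sum.cong) auto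
    then show "(\<Sum>a\<in>{a \<in> S. orbit \<sigma> a = A}. g (orbit \<sigma> a)) = of_nat (card A) * g A" by simp
  qed
  finally show ?thesis .
qed

lemma card_cycles:
  assumes \<sigma>: "\<sigma> permutes S" "finite S" and A: "A \<in> cycles S \<sigma>"
  shows "finite A" "card A \<in> {1..card S}"
proof -
  have "A \<subseteq> S" using cycles_subset [OF \<sigma>(1) A] .
  then show "finite A" using \<sigma>(2) by (rule finite_subset)
  then show "card A \<in> {1..card S}"
    using cycles_nonempty [OF A] card_mono [OF \<sigma>(2) \<open>A \<subseteq> S\<close>] by (simp add: Suc_le_eq card_gt_0_iff)
qed

lemma pmon_transpose_join:
  assumes \<sigma>: "\<sigma> permutes S" "finite S" and ab: "a \<in> S" "b \<in> S" "b \<notin> orbit \<sigma> a"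
  shows "pmon (cycles S (\<sigma> \<circ> transpose a b)) = p_var (card (orbit \<sigma> a) + card (orbit \<sigma> b)) *
    pmon (cycles S \<sigma> - {orbit \<sigma> a} - {orbit \<sigma> b})"
proof -
  define A B where "A = orbit \<sigma> a" and "B = orbit \<sigma> b"
  have mem: "A \<in> cycles S \<sigma>" "B \<in> cycles S \<sigma>" using ab by (auto simp: cycles_def A_def B_def)
  have "A \<noteq> B" unfolding A_def B_def using permutes_orbit_eq_iff [OF \<sigma>] ab by blast
  then have AB: "A \<inter> B = {}" by (rule cycles_disjoint [OF \<sigma> mem])
  have ne: "A \<noteq> {}" "B \<noteq> {}" using mem cycles_nonempty by auto
  have "A \<union> B \<notin> cycles S \<sigma> - {A, B}"
    using cycles_disjoint [OF \<sigma> mem(1), of "A \<union> B"] ne by auto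
  moreover have "cycles S (\<sigma> \<circ> transpose a b) = insert (A \<union> B) (cycles S \<sigma> - {A, B})"
    using cycles_transpose_join [OF \<sigma> ab] by (simp only: A_def B_def)
  moreover have "card (A \<union> B) = card A + card B"
    using card_cycles(1) [OF \<sigma>] mem AB by (intro card_Un_disjoint) auto
  moreover have "cycles S \<sigma> - {A, B} = cycles S \<sigma> - {A} - {B}" by auto
  ultimately show ?thesis using \<sigma>(2) by (simp add: pmon_insert A_def B_def)
qed

lemma sum_transpose_pmon:
  assumes \<sigma>: "\<sigma> permutes S" "finite S" and a: "a \<in> S"
  defines "X \<equiv> cycles S \<sigma>" and "A \<equiv> orbit \<sigma> a"
  shows "(\<Sum>b\<in>S - {a}. pmon (cycles S (\<sigma> \<circ> transpose a b))) =
    (\<Sum>i\<in>{1..<card A}. p_var i * p_var (card A - i) * pmon (X - {A})) +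
    (\<Sum>B\<in>X - {A}. of_nat (card B) * (p_var (card A + card B) * pmon (X - {A} - {B})))"
proof -
  let ?f = "\<lambda>b. pmon (cycles S (\<sigma> \<circ> transpose a b))"
  have AX: "A \<in> X" using a by (auto simp: A_def X_def cycles_def)
  have aA: "a \<in> A" using permutes_self_in_orbit [OF \<sigma>] by (simp add: A_def)
  have AS: "A \<subseteq> S" using cycles_subset [OF \<sigma>(1)] AX by (simp add: X_def)
  have fX: "finite X" using \<sigma>(2) by (simp add: X_def)
  have "sum ?f (S - {a}) = sum ?f ((A - {a}) \<union> (S - A))"
    using aA AS by (intro arg_cong [of _ _ "sum ?f"]) auto
  also have "\<dots> = sum ?f (A - {a}) + sum ?f (S - A)"
    using \<sigma>(2) AS by (intro sum.union_disjoint) (auto intro: finite_subset)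
  \<comment> \<open>The points of the cycle other than \<open>a\<close> are the iterates
    \<open>\<sigma>^i a\<close> with \<open>0 < i < card A\<close>, and the choice of
    \<open>i\<close> determines the lengths of the two pieces.\<close>
  also have "sum ?f (A - {a}) = (\<Sum>i\<in>{1..<card A}. ?f ((\<sigma> ^^ i) a))"
  proof (rule sum.reindex_bij_betw [symmetric])
    note pow = orbit_power_image [OF \<sigma>, of a, folded A_def]
    have "inj_on (\<lambda>i. (\<sigma> ^^ i) a) {1..<card A}"
      by (rule inj_on_subset [OF pow(1)]) auto
    moreover have "(\<lambda>i. (\<sigma> ^^ i) a) ` {1..<card A} = A - {a}"
    proof -
      have "{..<card A} - {0} = {1..<card A}" by auto
      moreover have "(\<lambda>i. (\<sigma> ^^ i) a) ` ({..<card A} - {0}) = A - (\<lambda>i. (\<sigma> ^^ i) a) ` {0}"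
        using pow(2) card_cycles(2) [OF \<sigma>, of A] AX unfolding X_def
        by (subst inj_on_image_set_diff [OF pow(1)]) auto
      ultimately show ?thesis by simp
    qed
    ultimately show "bij_betw (\<lambda>i. (\<sigma> ^^ i) a) {1..<card A} (A - {a})" by (simp add: bij_betw_def)
  qed
  also have "\<dots> = (\<Sum>i\<in>{1..<card A}. p_var i * p_var (card A - i) * pmon (X - {A}))"
  proof (rule sum.cong [OF refl])
    fix i assume i: "i \<in> {1..<card A}"
    then have "0 < i" "i < card (orbit \<sigma> a)" by (auto simp: A_def)
    from cycles_transpose_cut [OF \<sigma> a this refl] obtain C B where
      "cycles S (\<sigma> \<circ> transpose a ((\<sigma> ^^ i) a)) = insert C (insert B (X - {A}))"
      "C \<noteq> B" "C \<notin> X - {A}" "B \<notin> X - {A}" "card C = card A - i" "card B = i"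
      unfolding A_def X_def by metis
    then show "?f ((\<sigma> ^^ i) a) = p_var i * p_var (card A - i) * pmon (X - {A})"
      using fX by (simp add: pmon_insert)
  qed
  also have "sum ?f (S - A) =
      (\<Sum>b\<in>S - A. p_var (card A + card (orbit \<sigma> b)) * pmon (X - {A} - {orbit \<sigma> b}))"
    using pmon_transpose_join [OF \<sigma> a] by (intro sum.cong refl) (auto simp: A_def X_def)
  \<comment> \<open>The value 0 on the cycle \<open>A\<close> makes the summand a function of the
    orbit on all of \<open>S\<close>, as \<open>sum_over_orbits\<close> requires.\<close>
  also have "\<dots> = (\<Sum>b\<in>S. if orbit \<sigma> b = A then 0 else
      p_var (card A + card (orbit \<sigma> b)) * pmon (X - {A} - {orbit \<sigma> b}))"
    (is "_ = (\<Sum>b\<in>S. ?g (orbit \<sigma> b))")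
  proof (rule sum.mono_neutral_cong_left)
    have eq: "orbit \<sigma> b = A \<longleftrightarrow> b \<in> A" for b
      using permutes_orbit_eq_iff [OF \<sigma>, of a b] by (auto simp: A_def)
    show "\<forall>b\<in>S - (S - A). ?g (orbit \<sigma> b) = 0" using eq by auto
    show "\<And>b. b \<in> S - A \<Longrightarrow> p_var (card A + card (orbit \<sigma> b)) * pmon (X - {A} - {orbit \<sigma> b}) = ?g (orbit \<sigma> b)"
      using eq by auto
  qed (use \<sigma>(2) in auto)
  also have "\<dots> = (\<Sum>B\<in>X. of_nat (card B) * ?g B)"
    unfolding X_def by (rule sum_over_orbits [OF \<sigma>])
  also have "\<dots> = (\<Sum>B\<in>X - {A}. of_nat (card B) * ?g B)"
    using fX by (intro sum.mono_neutral_right) auto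
  also have "\<dots> = (\<Sum>B\<in>X - {A}. of_nat (card B) * (p_var (card A + card B) * pmon (X - {A} - {B})))"
    by (intro sum.cong refl) auto
  finally show ?thesis .
qed

lemma sum_transposes_pmon:
  assumes \<sigma>: "\<sigma> permutes S" "finite S" and N: "card S \<le> N"
  shows "(\<Sum>a\<in>S. \<Sum>b\<in>S - {a}. pmon (cycles S (\<sigma> \<circ> transpose a b))) =
    join_cut_lin N (pmon (cycles S \<sigma>))"
proof -
  define X where "X = cycles S \<sigma>"
  define g where "g A = (\<Sum>i\<in>{1..<card A}. p_var i * p_var (card A - i) * pmon (X - {A})) +
    (\<Sum>B\<in>X - {A}. of_nat (card B) * (p_var (card A + card B) * pmon (X - {A} - {B})))" for A
  have "(\<Sum>a\<in>S. \<Sum>b\<in>S - {a}. pmon (cycles S (\<sigma> \<circ> transpose a b))) = (\<Sum>a\<in>S. g (orbit \<sigma> a))"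
    unfolding g_def X_def by (intro sum.cong refl sum_transpose_pmon [OF \<sigma>])
  also have "\<dots> = (\<Sum>A\<in>X. of_nat (card A) * g A)"
    unfolding X_def by (rule sum_over_orbits [OF \<sigma>])
  also have "\<dots> = join_cut_lin N (pmon X)"
  proof (subst join_cut_lin_pmon)
    show "finite X" using \<sigma>(2) by (simp add: X_def)
    show "card A \<in> {1..N}" if "A \<in> X" for A using card_cycles(2) [OF \<sigma>] that N by (force simp: X_def)
  qed (simp add: g_def distrib_left sum_distrib_left mult.assoc)
  finally show ?thesis by (simp add: X_def)
qed

section \<open>Additivity of the cut-off operators\<close>

lemma join_cut_lin_add: "join_cut_lin N (f + g) = join_cut_lin N f + join_cut_lin N g"
  unfolding join_cut_lin_def by (simp add: sum.distrib [symmetric] distrib_left add_ac)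

lemma join_cut_lin_0 [simp]: "join_cut_lin N 0 = 0"
  by (simp add: join_cut_lin_def)

lemma join_cut_lin_sum: "join_cut_lin N (\<Sum>x\<in>I. f x) = (\<Sum>x\<in>I. join_cut_lin N (f x))"
  by (induction I rule: infinite_finite_induct) (simp_all add: join_cut_lin_add)

lemma join_cut_bil_add_left: "join_cut_bil N (f + g) h = join_cut_bil N f h + join_cut_bil N g h"
  and join_cut_bil_add_right: "join_cut_bil N h (f + g) = join_cut_bil N h f + join_cut_bil N h g"
  unfolding join_cut_bil_def by (simp_all add: sum.distrib [symmetric] distrib_left distrib_right)

lemma join_cut_bil_0 [simp]: "join_cut_bil N 0 h = 0" "join_cut_bil N h 0 = 0"
  by (simp_all add: join_cut_bil_def)

lemma join_cut_bil_sum_left: "join_cut_bil N (\<Sum>x\<in>I. f x) h = (\<Sum>x\<in>I. join_cut_bil N (f x) h)"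
  by (induction I rule: infinite_finite_induct) (simp_all add: join_cut_bil_add_left)

lemma join_cut_bil_sum_right: "join_cut_bil N h (\<Sum>x\<in>I. f x) = (\<Sum>x\<in>I. join_cut_bil N h (f x))"
  by (induction I rule: infinite_finite_induct) (simp_all add: join_cut_bil_add_right)

section \<open>Averaging over the marked point\<close>

lemma relabel_relabel: "relabel \<phi> (relabel \<psi> fs) = relabel (\<phi> \<circ> \<psi>) fs"
  by (simp add: relabel_def map_prod_def comp_def split_beta)

text \<open>Order-preserving relabellings do respect monotone words; they transport results from
  \<open>{1..n}\<close> to every set of \<open>n\<close> points.\<close>

lemma relabel_mwords:
  assumes "strict_mono_on S \<phi>" "fs \<in> mwords S r"
  shows "relabel \<phi> fs \<in> mwords (\<phi> ` S) r"
proof -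
  have S: "a \<in> S \<and> b \<in> S \<and> a < b" if "(a, b) \<in> set fs" for a b
    using assms(2) that by (auto simp: mwords_def)
  have "map snd (relabel \<phi> fs) = map \<phi> (map snd fs)" by (simp add: relabel_def)
  moreover have "sorted (map \<phi> (map snd fs))"
    unfolding sorted_map
  proof (rule sorted_wrt_mono_rel)
    show "sorted (map snd fs)" using assms(2) by (simp add: mwords_def)
    show "\<phi> x \<le> \<phi> y" if "x \<in> set (map snd fs)" "y \<in> set (map snd fs)" "x \<le> y" for x y
    proof -
      have "x \<in> S" "y \<in> S" using that(1,2) S by auto
      then show ?thesis using strict_mono_on_imp_mono_on [OF assms(1)] that(3) by (simp add: mono_on_def)
    qed
  qed
  moreover have "\<phi> a < \<phi> b" if "(a, b) \<in> set fs" for a b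
    using S [OF that] strict_mono_onD [OF assms(1)] by blast
  ultimately show ?thesis using S assms(2) by (fastforce simp: mwords_def set_relabel)
qed

lemma bij_betw_relabel_mwords:
  assumes "strict_mono_on S \<phi>"
  shows "bij_betw (relabel \<phi>) (mwords S r) (mwords (\<phi> ` S) r)"
proof -
  define \<psi> where "\<psi> = inv_into S \<phi>"
  have inj: "inj_on \<phi> S" using assms by (rule strict_mono_on_imp_inj_on)
  have \<psi>: "\<psi> (\<phi> x) = x" if "x \<in> S" for x using inv_into_f_f [OF inj that] by (simp add: \<psi>_def)
  have "strict_mono_on (\<phi> ` S) \<psi>"
    by (rule strict_mono_onI) (auto simp: \<psi> strict_mono_on_less [OF assms])
  moreover have "\<psi> ` \<phi> ` S = S" using \<psi> by force
  ultimately have inverse: "relabel \<psi> fs \<in> mwords S r" if "fs \<in> mwords (\<phi> ` S) r" for fs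
    using relabel_mwords [of "\<phi> ` S" \<psi> fs r] that by simp
  show ?thesis
  proof (rule bij_betwI [where g = "relabel \<psi>"])
    show "relabel \<psi> (relabel \<phi> fs) = fs" if "fs \<in> mwords S r" for fs
      unfolding relabel_relabel using that \<psi> by (intro relabel_id) (auto simp: mwords_def)
    show "relabel \<phi> (relabel \<psi> fs) = fs" if "fs \<in> mwords (\<phi> ` S) r" for fs
      unfolding relabel_relabel using that \<psi> by (intro relabel_id) (fastforce simp: mwords_def)
  qed (use relabel_mwords [OF assms] inverse in auto)
qed

lemma ex_strict_mono_image:
  assumes "finite (S :: nat set)"
  obtains \<phi> where "strict_mono_on {1..card S} \<phi>" "\<phi> ` {1..card S} = S"
proof -
  obtain h where h: "bij_betw h {..<card S} S" "strict_mono_on {..<card S} h"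
    using ex_bij_betw_strict_mono_card [OF assms] by blast
  have "strict_mono_on {1..card S} (\<lambda>i. h (i - 1))"
    by (rule strict_mono_onI, rule strict_mono_onD [OF h(2)]) auto
  moreover have "(\<lambda>i. h (i - 1)) ` {1..card S} = h ` {..<card S}"
    unfolding image_Suc_lessThan [symmetric] image_image by simp
  ultimately show ?thesis using that h(1) by (simp add: bij_betw_def)
qed

lemma pmon_image:
  assumes inj: "inj_on \<phi> S" and X: "\<And>A. A \<in> X \<Longrightarrow> A \<subseteq> S"
  shows "pmon ((`) \<phi> ` X) = pmon X"
proof -
  have "inj_on ((`) \<phi>) X" by (intro inj_on_image inj_on_subset [OF inj] Union_least X)
  then have "pmon ((`) \<phi> ` X) = (\<Prod>A\<in>X. p_var (card (\<phi> ` A)))"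
    unfolding pmon_def by (simp only: prod.reindex comp_def)
  moreover have "(\<Prod>A\<in>X. p_var (card (\<phi> ` A))) = pmon X"
    unfolding pmon_def
  proof (rule prod.cong [OF refl])
    fix A assume "A \<in> X"
    then have "inj_on \<phi> A" by (intro inj_on_subset [OF inj] X)
    then have "card (\<phi> ` A) = card A" by (rule card_image)
    then show "p_var (card (\<phi> ` A)) = p_var (card A)" by (simp only:)
  qed
  ultimately show ?thesis by (simp only:)
qed

context
  fixes \<phi> :: "nat \<Rightarrow> nat" and S :: "nat set" and fs :: "(nat \<times> nat) list"
  assumes inj: "inj_on \<phi> S" and fin: "finite S"
    and fs: "set fs \<subseteq> S \<times> S"
begin

lemma cycles_relabel:
  "cycles (\<phi> ` S) (wperm (relabel \<phi> fs)) = (`) \<phi> ` cycles S (wperm fs)"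
  unfolding cycles_def image_image
  using orbit_relabel [OF inj fs _ fin] by (intro image_cong refl) auto

lemma cycles_wperm_subset: "A \<in> cycles S (wperm fs) \<Longrightarrow> A \<subseteq> S"
  using cycles_subset [OF wperm_permutes [OF fs]] by blast

lemma pmon_cycles_relabel:
  "pmon (cycles (\<phi> ` S) (wperm (relabel \<phi> fs))) = pmon (cycles S (wperm fs))"
  unfolding cycles_relabel using inj cycles_wperm_subset by (rule pmon_image)

lemma card_orbit_relabel:
  assumes "x \<in> S"
  shows "card (orbit (wperm (relabel \<phi> fs)) (\<phi> x)) = card (orbit (wperm fs) x)"
  unfolding orbit_relabel [OF inj fs assms fin] using assms cycles_wperm_subset [of "orbit (wperm fs) x"]
  by (intro card_image inj_on_subset [OF inj]) (auto simp: cycles_def)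

lemma pmon_cycles_remove_relabel:
  assumes x: "x \<in> S"
  shows "pmon (cycles (\<phi> ` S) (wperm (relabel \<phi> fs)) - {orbit (wperm (relabel \<phi> fs)) (\<phi> x)}) =
    pmon (cycles S (wperm fs) - {orbit (wperm fs) x})"
proof -
  have X: "A \<subseteq> S" if "A \<in> cycles S (wperm fs)" for A using that by (rule cycles_wperm_subset)
  have "inj_on ((`) \<phi>) (cycles S (wperm fs))"
    using inj_on_image_eq_iff [OF inj] X by (auto simp: inj_on_def)
  moreover have "{orbit (wperm fs) x} \<subseteq> cycles S (wperm fs)" using x by (auto simp: cycles_def)
  ultimately have "cycles (\<phi> ` S) (wperm (relabel \<phi> fs)) - {orbit (wperm (relabel \<phi> fs)) (\<phi> x)} =
      (`) \<phi> ` (cycles S (wperm fs) - {orbit (wperm fs) x})"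
    unfolding cycles_relabel orbit_relabel [OF inj fs x fin]
    by (subst inj_on_image_set_diff [OF _ Diff_subset]) auto
  then show ?thesis using pmon_image [OF inj, of "cycles S (wperm fs) - {orbit (wperm fs) x}"] X by auto
qed

end

definition weight :: "nat set \<Rightarrow> (nat \<times> nat) list \<Rightarrow> (indet, rat) mps" where
  "weight S fs = (if linked S fs then pmon (cycles S (wperm fs)) else 0)"

text \<open>For \<open>d \<ge> 1\<close> this is d! times the coefficient of z^d t^r in the
  generating function. At \<open>d = 0\<close> the empty word counts, so \<open>hcoef 0 0\<close> is
  the constant 1.\<close>

definition hcoef :: "nat \<Rightarrow> nat \<Rightarrow> (indet, rat) mps" where
  "hcoef d r = wsum d r (weight {1..d})"

text \<open>The contribution of the words for which \<open>x\<close> lies in a cycle of length \<open>k\<close>, that cycle being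
  left out of the monomial.\<close>

definition marked_weight :: "nat \<Rightarrow> nat set \<Rightarrow> nat \<Rightarrow> (nat \<times> nat) list \<Rightarrow> (indet, rat) mps" where
  "marked_weight k S x fs = (if linked S fs \<and> card (orbit (wperm fs) x) = k
     then pmon (cycles S (wperm fs) - {orbit (wperm fs) x}) else 0)"

lemma weight_relabel:
  assumes "inj_on \<phi> S" "finite S" "set fs \<subseteq> S \<times> S"
  shows "weight (\<phi> ` S) (relabel \<phi> fs) = weight S fs"
  by (simp add: weight_def linked_relabel [OF assms(1,3)] pmon_cycles_relabel [OF assms])

lemma marked_weight_relabel:
  assumes "inj_on \<phi> S" "finite S" "set fs \<subseteq> S \<times> S" "x \<in> S"
  shows "marked_weight k (\<phi> ` S) (\<phi> x) (relabel \<phi> fs) = marked_weight k S x fs"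
  by (simp add: marked_weight_def linked_relabel [OF assms(1,3)] pmon_cycles_remove_relabel [OF assms]
      card_orbit_relabel [OF assms])

lemma sum_weight_eq_hcoef:
  assumes "finite S"
  shows "(\<Sum>fs\<in>mwords S r. weight S fs) = hcoef (card S) r"
proof -
  obtain \<phi> where \<phi>: "strict_mono_on {1..card S} \<phi>" "\<phi> ` {1..card S} = S"
    using assms by (rule ex_strict_mono_image)
  have "(\<Sum>fs\<in>mwords S r. weight S fs) = (\<Sum>fs\<in>mwords {1..card S} r. weight S (relabel \<phi> fs))"
    using bij_betw_relabel_mwords [OF \<phi>(1), of r] unfolding \<phi>(2)
    by (rule sum.reindex_bij_betw [symmetric])
  also have "\<dots> = hcoef (card S) r"
    unfolding hcoef_def
  proof (rule sum.cong [OF refl])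
    fix fs assume "fs \<in> mwords {1..card S} r"
    from weight_relabel [OF strict_mono_on_imp_inj_on [OF \<phi>(1)] finite_atLeastAtMost mwords_letters [OF this]]
    show "weight S (relabel \<phi> fs) = weight {1..card S} fs" unfolding \<phi>(2) .
  qed
  finally show ?thesis .
qed

lemma transpose_interval:
  "1 \<le> i \<Longrightarrow> i < d \<Longrightarrow> transpose i (Suc i) ` {1..d} = {1..d}"
  by (rule permutes_image, rule permutes_swap_id) auto

lemma sum_marked_weight:
  assumes "finite S"
  shows "(\<Sum>x\<in>S. \<Sum>fs\<in>mwords S r. marked_weight k S x fs) = of_nat k *
    (\<Sum>fs\<in>mwords S r. if linked S fs then \<Sum>A\<in>cycles S (wperm fs).
       if card A = k then pmon (cycles S (wperm fs) - {A}) else 0 else 0)"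
  unfolding sum.swap [of _ _ S] sum_distrib_left
proof (rule sum.cong [OF refl])
  fix fs assume fs: "fs \<in> mwords S r"
  let ?X = "cycles S (wperm fs)" and ?o = "orbit (wperm fs)"
  have "(\<Sum>x\<in>S. marked_weight k S x fs) =
      (if linked S fs then \<Sum>x\<in>S. if card (?o x) = k then pmon (?X - {?o x}) else 0 else 0)"
    by (simp add: marked_weight_def)
  also have "(\<Sum>x\<in>S. if card (?o x) = k then pmon (?X - {?o x}) else 0) =
      (\<Sum>A\<in>?X. of_nat (card A) * (if card A = k then pmon (?X - {A}) else 0))"
    by (rule sum_over_orbits [OF mwords_permutes [OF fs] assms])
  also have "\<dots> = of_nat k * (\<Sum>A\<in>?X. if card A = k then pmon (?X - {A}) else 0)"
    unfolding sum_distrib_left by (intro sum.cong) auto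
  finally show "(\<Sum>x\<in>S. marked_weight k S x fs) = of_nat k * (if linked S fs then
      \<Sum>A\<in>?X. if card A = k then pmon (?X - {A}) else 0 else 0)" by simp
qed

text \<open>Marking a point realises the operator \<open>k\<close> times the derivative by p_k: the
  derivative removes a cycle of length \<open>k\<close>, and any of its \<open>k\<close> points can
  carry the mark.\<close>

lemma sum_marked_weight_eq_deriv:
  assumes S: "finite S" and k: "k \<ge> 1"
  shows "(\<Sum>x\<in>S. \<Sum>fs\<in>mwords S r. marked_weight k S x fs) =
    of_nat k * mps_deriv (ind_p k) (hcoef (card S) r)"
proof -
  have "mps_deriv (ind_p k) (weight S fs) = (if linked S fs then \<Sum>A\<in>cycles S (wperm fs).
       if card A = k then pmon (cycles S (wperm fs) - {A}) else 0 else 0)"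
    if fs: "fs \<in> mwords S r" for fs
  proof -
    have "card A \<ge> 1" if "A \<in> cycles S (wperm fs)" for A
      using card_cycles [OF mwords_permutes [OF fs] S that] by simp
    then have "mps_deriv (ind_p k) (pmon (cycles S (wperm fs))) = (\<Sum>A\<in>cycles S (wperm fs).
       if card A = k then pmon (cycles S (wperm fs) - {A}) else 0)"
      using S k by (intro deriv_pmon) auto
    then show ?thesis by (simp add: weight_def)
  qed
  then show ?thesis
    unfolding sum_marked_weight [OF S] sum_weight_eq_hcoef [OF S, symmetric] mps_deriv_sum by simp
qed

text \<open>The sums for the \<open>card S\<close> marks are equal by centrality and add up to the
  sum over all marks. Centrality is available on \<open>{1..n}\<close> only, so \<open>S\<close> is
  carried there by the order isomorphism.\<close>

lemma marked_weight_average: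
  assumes S: "finite S" and x: "x \<in> S" and k: "k \<ge> 1"
  shows "of_nat (card S) * (\<Sum>fs\<in>mwords S r. marked_weight k S x fs) =
    of_nat k * mps_deriv (ind_p k) (hcoef (card S) r)"
proof -
  define n where "n = card S"
  obtain \<phi> where \<phi>: "strict_mono_on {1..n} \<phi>" "\<phi> ` {1..n} = S"
    using S unfolding n_def by (rule ex_strict_mono_image)
  have indep: "wsum n r (marked_weight k {1..n} y) = wsum n r (marked_weight k {1..n} n)"
    if "y \<in> {1..n}" for y
  proof (rule wsum_equivariant [where \<Psi> = "\<lambda>fs y. marked_weight k {1..n} y fs", OF _ _ that])
    show "braid_invariant (marked_weight k {1..n} x)" for x
      by (rule braid_invariantI) (simp add: marked_weight_def)
    fix i fs assume i: "1 \<le> i" "i < n" and fs: "fs \<in> mwords {1..n} r"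
    have "inj_on (transpose i (Suc i)) {1..n}" by simp
    from marked_weight_relabel [OF this finite_atLeastAtMost mwords_letters [OF fs], of i]
    show "marked_weight k {1..n} (Suc i) (relabel (transpose i (Suc i)) fs) = marked_weight k {1..n} i fs"
      using i by (simp only: transpose_interval) simp
  qed
  obtain y where y: "y \<in> {1..n}" "x = \<phi> y" using x \<phi>(2) by auto
  have "(\<Sum>fs\<in>mwords S r. marked_weight k S x fs) = wsum n r (\<lambda>fs. marked_weight k S x (relabel \<phi> fs))"
    using bij_betw_relabel_mwords [OF \<phi>(1), of r] unfolding \<phi>(2)
    by (rule sum.reindex_bij_betw [symmetric])
  also have "\<dots> = wsum n r (marked_weight k {1..n} y)"
  proof (rule sum.cong [OF refl])
    fix fs assume "fs \<in> mwords {1..n} r"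
    from marked_weight_relabel [OF strict_mono_on_imp_inj_on [OF \<phi>(1)] finite_atLeastAtMost
        mwords_letters [OF this] y(1)]
    show "marked_weight k S x (relabel \<phi> fs) = marked_weight k {1..n} y fs" unfolding \<phi>(2) y(2) .
  qed
  finally have "(\<Sum>fs\<in>mwords S r. marked_weight k S x fs) = wsum n r (marked_weight k {1..n} n)"
    using indep [OF y(1)] by simp
  moreover have "(\<Sum>y\<in>{1..n}. wsum n r (marked_weight k {1..n} y)) =
      of_nat k * mps_deriv (ind_p k) (hcoef n r)"
    using sum_marked_weight_eq_deriv [OF finite_atLeastAtMost k, of 1 n r] by simp
  moreover have "(\<Sum>y\<in>{1..n}. wsum n r (marked_weight k {1..n} y)) =
      (\<Sum>y\<in>{1..n}. wsum n r (marked_weight k {1..n} n))"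
    by (rule sum.cong [OF refl indep])
  ultimately show ?thesis by (simp add: n_def)
qed

text \<open>Averaging over the end \<open>d\<close> of the last transposition lets both of its ends
  run through all of \<open>{1..d}\<close>.\<close>

lemma sum_linked_transpose:
  assumes d: "d \<ge> 1" and N: "d \<le> N"
  shows "of_nat d * wsum d r (\<lambda>fs. if linked {1..d} fs
      then \<Sum>a\<in>{1..d} - {d}. pmon (cycles {1..d} (wperm fs \<circ> transpose d a)) else 0) =
    join_cut_lin N (hcoef d r)"
proof -
  \<comment> \<open>The transposition is appended to the word rather than composed with its product,
    so that relabelling moves it together with the rest. Transitivity is tested on the word without
    it.\<close>
  define \<Psi> where "\<Psi> fs x = (if linked {1..d} fs
      then \<Sum>a\<in>{1..d} - {x}. pmon (cycles {1..d} (wperm (fs @ [(x, a)]))) else 0)" for fs x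
  have indep: "wsum d r (\<lambda>fs. \<Psi> fs y) = wsum d r (\<lambda>fs. \<Psi> fs d)" if "y \<in> {1..d}" for y
  proof (rule wsum_equivariant [OF _ _ that])
    show "braid_invariant (\<lambda>fs. \<Psi> fs x)" for x
      by (rule braid_invariantI) (simp add: \<Psi>_def)
    fix i fs assume i: "1 \<le> i" "i < d" and fs: "fs \<in> mwords {1..d} r"
    define s where "s = transpose i (Suc i)"
    have inj: "inj_on s {1..d}" by (simp add: s_def)
    have img: "s ` {1..d} = {1..d}" unfolding s_def using i by (rule transpose_interval)
    have si: "s i = Suc i" by (simp add: s_def)
    have bij: "bij_betw s ({1..d} - {i}) ({1..d} - {Suc i})"
      unfolding bij_betw_def
      using inj_on_image_set_diff [OF inj, of "{1..d}" "{i}"] img si i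
      by (auto intro: inj_on_subset [OF inj])
    have "\<Psi> (relabel s fs) (Suc i) = (if linked {1..d} fs
        then \<Sum>a\<in>{1..d} - {i}. pmon (cycles {1..d} (wperm (relabel s fs @ [(Suc i, s a)]))) else 0)"
      using linked_relabel [OF inj mwords_letters [OF fs]]
        sum.reindex_bij_betw [OF bij, of "\<lambda>a. pmon (cycles {1..d} (wperm (relabel s fs @ [(Suc i, a)])))"]
      by (simp only: \<Psi>_def img)
    also have "\<dots> = \<Psi> fs i"
    proof -
      have "pmon (cycles {1..d} (wperm (relabel s fs @ [(Suc i, s a)]))) =
          pmon (cycles {1..d} (wperm (fs @ [(i, a)])))" if "a \<in> {1..d} - {i}" for a
      proof -
        have "set (fs @ [(i, a)]) \<subseteq> {1..d} \<times> {1..d}"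
          using mwords_letters [OF fs] that i by auto
        from pmon_cycles_relabel [OF inj finite_atLeastAtMost this] show ?thesis
          by (simp only: img relabel_simps si)
      qed
      then show ?thesis unfolding \<Psi>_def by (intro if_cong refl sum.cong)
    qed
    finally show "\<Psi> (relabel (transpose i (Suc i)) fs) (Suc i) = \<Psi> fs i" by (simp only: s_def)
  qed
  have "of_nat d * wsum d r (\<lambda>fs. \<Psi> fs d) = (\<Sum>x\<in>{1..d}. wsum d r (\<lambda>fs. \<Psi> fs d))"
    by simp
  also have "\<dots> = (\<Sum>x\<in>{1..d}. wsum d r (\<lambda>fs. \<Psi> fs x))"
    by (rule sum.cong [OF refl indep [symmetric]])
  also have "\<dots> = wsum d r (\<lambda>fs. \<Sum>x\<in>{1..d}. \<Psi> fs x)" by (rule sum.swap)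
  also have "\<dots> = wsum d r (\<lambda>fs. join_cut_lin N (weight {1..d} fs))"
  proof (rule sum.cong [OF refl])
    fix fs assume "fs \<in> mwords {1..d} r"
    then have "wperm fs permutes {1..d}" by (rule mwords_permutes)
    from sum_transposes_pmon [OF this, of N] N
    show "(\<Sum>x\<in>{1..d}. \<Psi> fs x) = join_cut_lin N (weight {1..d} fs)"
      by (auto simp: \<Psi>_def weight_def simp del: One_nat_def)
  qed
  finally show ?thesis
    by (simp only: \<Psi>_def hcoef_def join_cut_lin_sum wperm_append wperm_simps comp_id)
qed

section \<open>Splitting into two components\<close>

lemma linkedD: "linked S fs \<Longrightarrow> saturated A fs \<Longrightarrow> S \<subseteq> A \<or> S \<inter> A = {}"
  by (simp add: linked_def)

lemma saturated_Compl [simp]: "saturated (- A) fs \<longleftrightarrow> saturated A fs"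
  by (auto simp: saturated_def)

lemma wperm_filter:
  assumes "saturated A fs" "x \<in> A"
  shows "wperm (filter (\<lambda>e. snd e \<in> A) fs) x = wperm fs x"
  using assms(1)
proof (induction fs)
  case (Cons e fs)
  obtain a b where e: "e = (a, b)" by (cases e)
  have "wperm fs x \<in> A" using Cons.prems assms(2) e by (simp add: saturated_wperm)
  moreover have "a \<in> A \<longleftrightarrow> b \<in> A" using Cons.prems e by simp
  ultimately have "b \<notin> A \<Longrightarrow> transpose a b (wperm fs x) = wperm fs x"
    by (intro transpose_apply_other) auto
  moreover have "wperm (filter (\<lambda>e. snd e \<in> A) fs) x = wperm fs x" using Cons e by simp
  ultimately show ?case by (simp add: e)
qed simp

lemma orbit_filter:
  assumes "saturated A fs" "x \<in> A"
  shows "orbit (wperm (filter (\<lambda>e. snd e \<in> A) fs)) x = orbit (wperm fs) x"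
  by (rule orbit_cong0 [OF assms(2)]) (use assms(1) in \<open>auto simp: wperm_filter saturated_wperm\<close>)

lemma linked_filter:
  assumes A: "saturated A fs" "S \<subseteq> A"
  shows "linked S (filter (\<lambda>e. snd e \<in> A) fs) \<longleftrightarrow> linked S fs"
proof
  assume L: "linked S (filter (\<lambda>e. snd e \<in> A) fs)"
  show "linked S fs"
    unfolding linked_def
  proof (intro allI impI)
    fix B assume "saturated B fs"
    then have "saturated B (filter (\<lambda>e. snd e \<in> A) fs)" by (auto simp: saturated_def)
    then show "S \<subseteq> B \<or> S \<inter> B = {}" by (rule linkedD [OF L])
  qed
next
  assume L: "linked S fs"
  show "linked S (filter (\<lambda>e. snd e \<in> A) fs)"
    unfolding linked_def
  proof (intro allI impI)
    fix B assume "saturated B (filter (\<lambda>e. snd e \<in> A) fs)"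
    \<comment> \<open>\<open>B\<close> itself may be split by the discarded letters, but these lie
      outside \<open>A\<close> and cannot split \<open>A \<inter> B\<close>.\<close>
    then have "saturated (A \<inter> B) fs" using A(1) by (auto simp: saturated_def)
    then have "S \<subseteq> A \<inter> B \<or> S \<inter> (A \<inter> B) = {}" by (rule linkedD [OF L])
    then show "S \<subseteq> B \<or> S \<inter> B = {}" using A(2) by blast
  qed
qed

definition splits_at :: "nat set \<Rightarrow> (nat \<times> nat) list \<Rightarrow> nat set \<Rightarrow> bool" where
  "splits_at S fs A \<longleftrightarrow> saturated A fs \<and> linked A fs \<and> linked (S - A) fs"

text \<open>The component of \<open>d\<close> is a proper part of \<open>S\<close>, and one more transposition can only join
  it to a single other component.\<close>

lemma linked_snoc_iff:
  assumes fs: "set fs \<subseteq> S \<times> S" and d: "d \<in> S" and a: "a \<in> S"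
  shows "\<not> linked S fs \<and> linked S (fs @ [(a, d)]) \<longleftrightarrow>
    (\<exists>A\<subseteq>S. d \<in> A \<and> a \<notin> A \<and> splits_at S fs A)"
proof
  assume L: "\<not> linked S fs \<and> linked S (fs @ [(a, d)])"
  have satS: "saturated S fs" using fs by (auto simp: saturated_def)
  obtain B where B: "saturated B fs" "\<not> S \<subseteq> B" "S \<inter> B \<noteq> {}"
    using L by (auto simp: linked_def)
  define A where "A = (if d \<in> B then S \<inter> B else S - B)"
  have A: "saturated A fs" "A \<subseteq> S" "A \<noteq> S" "d \<in> A"
    using B d satS by (auto simp: A_def saturated_Int saturated_Diff)
  \<comment> \<open>Saturation under the longer word asks in addition that \<open>a\<close> and
    \<open>d\<close> lie on the same side. Of the two pieces into which a set \<open>C\<close>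
    divides \<open>A\<close>, or \<open>S - A\<close>, one contains neither point and is therefore
    empty.\<close>
  have key: "S \<subseteq> C \<or> S \<inter> C = {}" if "saturated C fs" "a \<in> C \<longleftrightarrow> d \<in> C" for C
    using linkedD [of S "fs @ [(a, d)]" C] L that by simp
  have aA: "a \<notin> A" using key [OF A(1)] A by auto
  have "linked A fs"
    unfolding linked_def
  proof (intro allI impI)
    fix C assume C: "saturated C fs"
    have "saturated (A \<inter> C) fs" "saturated (A - C) fs"
      using A C by (simp_all add: saturated_Int saturated_Diff)
    then show "A \<subseteq> C \<or> A \<inter> C = {}" using key [of "A \<inter> C"] key [of "A - C"] A aA by blast
  qed
  moreover have "linked (S - A) fs"
    unfolding linked_def
  proof (intro allI impI)
    fix C assume C: "saturated C fs"
    have "saturated ((S - A) \<inter> C) fs" "saturated ((S - A) - C) fs"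
      using A C satS by (simp_all add: saturated_Int saturated_Diff)
    then show "S - A \<subseteq> C \<or> (S - A) \<inter> C = {}"
      using key [of "(S - A) \<inter> C"] key [of "(S - A) - C"] A aA a by blast
  qed
  ultimately show "\<exists>A\<subseteq>S. d \<in> A \<and> a \<notin> A \<and> splits_at S fs A"
    using A aA by (auto simp: splits_at_def)
next
  assume "\<exists>A\<subseteq>S. d \<in> A \<and> a \<notin> A \<and> splits_at S fs A"
  then obtain A where A: "A \<subseteq> S" "d \<in> A" "a \<notin> A" "saturated A fs" "linked A fs" "linked (S - A) fs"
    by (auto simp: splits_at_def)
  have "linked S (fs @ [(a, d)])"
    unfolding linked_def
  proof (intro allI impI)
    fix C assume "saturated C (fs @ [(a, d)])"
    then have C: "saturated C fs" "a \<in> C \<longleftrightarrow> d \<in> C" by simp_all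
    have "A \<subseteq> C \<or> A \<inter> C = {}" "S - A \<subseteq> C \<or> (S - A) \<inter> C = {}"
      using linkedD [OF A(5) C(1)] linkedD [OF A(6) C(1)] .
    then show "S \<subseteq> C \<or> S \<inter> C = {}" using C(2) A(1-3) a by blast
  qed
  moreover have "\<not> linked S fs" using linkedD [of S fs A] A a d by blast
  ultimately show "\<not> linked S fs \<and> linked S (fs @ [(a, d)])" by simp
qed

lemma splits_at_unique:
  assumes "splits_at S fs A" "splits_at S fs B" "d \<in> A" "d \<in> B"
  shows "A = B"
proof -
  have AB: "saturated A fs" "saturated B fs" "linked A fs" "linked B fs"
    using assms(1,2) by (simp_all add: splits_at_def)
  have "A \<subseteq> B \<or> A \<inter> B = {}" "B \<subseteq> A \<or> B \<inter> A = {}"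
    using linkedD [OF AB(3,2)] linkedD [OF AB(4,1)] .
  then show ?thesis using assms(3,4) by blast
qed

text \<open>The component of \<open>d\<close> is unique, so the right side has at most one nonzero
  term; in this form the sum over \<open>A\<close> can be moved outside.\<close>

lemma sum_over_splits:
  fixes g :: "'b :: comm_monoid_add"
  assumes fs: "set fs \<subseteq> S \<times> S" and S: "finite S" and d: "d \<in> S" and a: "a \<in> S"
  shows "(if \<not> linked S fs \<and> linked S (fs @ [(a, d)]) then g else 0) =
    (\<Sum>A\<in>{A \<in> Pow S. d \<in> A}. if a \<notin> A \<and> splits_at S fs A then g else 0)"
proof (cases "\<exists>A\<subseteq>S. d \<in> A \<and> a \<notin> A \<and> splits_at S fs A")
  case True
  then obtain A where A: "A \<subseteq> S" "d \<in> A" "a \<notin> A" "splits_at S fs A" by blast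
  have "(\<Sum>B\<in>{A \<in> Pow S. d \<in> A}. if a \<notin> B \<and> splits_at S fs B then g else 0) =
      (\<Sum>B\<in>{A \<in> Pow S. d \<in> A}. if B = A then g else 0)"
  proof (rule sum.cong [OF refl])
    fix B assume "B \<in> {A \<in> Pow S. d \<in> A}"
    then have "a \<notin> B \<and> splits_at S fs B \<longleftrightarrow> B = A"
      using splits_at_unique [of S fs B A d] A by auto
    then show "(if a \<notin> B \<and> splits_at S fs B then g else 0) = (if B = A then g else 0)" by simp
  qed
  also have "\<dots> = g" using A S by (simp add: sum.delta)
  finally show ?thesis using True linked_snoc_iff [OF fs d a] by simp
next
  case False
  then have "(\<Sum>B\<in>{A \<in> Pow S. d \<in> A}. if a \<notin> B \<and> splits_at S fs B then g else 0) = 0"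
    by (intro sum.neutral) auto
  then show ?thesis by (simp only: linked_snoc_iff [OF fs d a] False if_False)
qed

text \<open>A word all of whose letters stay inside \<open>A\<close> or inside its complement is determined by the two
  subwords: no second entry occurs in both subwords, so they have only one monotone shuffle.\<close>

lemma sum_mwords_saturated:
  fixes F :: "(nat \<times> nat) list \<Rightarrow> (nat \<times> nat) list \<Rightarrow> 'b :: comm_monoid_add"
  assumes A: "A \<subseteq> S" "finite S"
  shows "(\<Sum>fs\<in>{fs \<in> mwords S r. saturated A fs}.
      F (filter (\<lambda>e. snd e \<in> A) fs) (filter (\<lambda>e. snd e \<in> - A) fs)) =
    (\<Sum>q\<in>{..r}. \<Sum>u\<in>mwords A q. \<Sum>v\<in>mwords (S - A) (r - q). F u v)"
proof -
  let ?P = "\<lambda>e :: nat \<times> nat. snd e \<in> A" and ?Q = "\<lambda>e :: nat \<times> nat. snd e \<in> - A"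
  have fin: "finite A" using A by (rule finite_subset)
  have "(\<Sum>fs\<in>{fs \<in> mwords S r. saturated A fs}. F (filter ?P fs) (filter ?Q fs)) =
      (\<Sum>(q, u, v)\<in>Sigma {..r} (\<lambda>q. mwords A q \<times> mwords (S - A) (r - q)). F u v)"
  proof (rule sum.reindex_bij_witness [where
        j = "\<lambda>fs. (length (filter ?P fs), filter ?P fs, filter ?Q fs)" and
        i = "\<lambda>(q, u, v). sort_key snd (u @ v)"])
    fix fs assume "fs \<in> {fs \<in> mwords S r. saturated A fs}"
    then have fs: "fs \<in> mwords S r" "saturated A fs" by auto
    have sorted: "sorted (map snd fs)" using fs by (simp add: mwords_def)
    have Q: "filter ?Q fs = filter (\<lambda>e. \<not> ?P e) fs" by simp
    have len: "length (filter ?P fs) + length (filter ?Q fs) = r"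
      unfolding Q sum_length_filter_compl using fs by (simp add: mwords_def)
    show "(case (length (filter ?P fs), filter ?P fs, filter ?Q fs) of
        (q, u, v) \<Rightarrow> sort_key snd (u @ v)) = fs"
      unfolding prod.case
    proof (rule properties_for_sort_key)
      show "mset fs = mset (filter ?P fs @ filter ?Q fs)"
        unfolding Q by (induction fs) auto
      \<comment> \<open>Stable sorting restores the word because all letters with a given second
        entry belong to the same subword and keep their order there.\<close>
      show "filter (\<lambda>x. snd k = snd x) fs = filter (\<lambda>x. snd k = snd x) (filter ?P fs @ filter ?Q fs)" for k
      proof -
        have "filter (\<lambda>x. snd k = snd x) (filter ?P fs) =
            (if snd k \<in> A then filter (\<lambda>x. snd k = snd x) fs else [])"
          by (induction fs) auto
        moreover have "filter (\<lambda>x. snd k = snd x) (filter ?Q fs) =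
            (if snd k \<in> A then [] else filter (\<lambda>x. snd k = snd x) fs)"
          by (induction fs) auto
        ultimately show ?thesis by simp
      qed
      show "sorted (map snd fs)" by (rule sorted)
    qed
    have letters: "a \<in> S \<and> b \<in> S \<and> a < b \<and> (a \<in> A \<longleftrightarrow> b \<in> A)" if "(a, b) \<in> set fs" for a b
      using fs that by (auto simp: mwords_def saturated_def)
    have "filter ?P fs \<in> mwords A (length (filter ?P fs))"
      using letters by (auto simp: mwords_def intro: sorted_filter sorted)
    moreover have "length (filter ?Q fs) = r - length (filter ?P fs)" using len by simp
    then have "filter ?Q fs \<in> mwords (S - A) (r - length (filter ?P fs))"
      using letters by (auto simp: mwords_def intro: sorted_filter sorted)
    ultimately show "(length (filter ?P fs), filter ?P fs, filter ?Q fs) \<in>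
        Sigma {..r} (\<lambda>q. mwords A q \<times> mwords (S - A) (r - q))"
      using len by auto
  next
    fix x assume "x \<in> Sigma {..r} (\<lambda>q. mwords A q \<times> mwords (S - A) (r - q))"
    then obtain q u v where x: "x = (q, u, v)" "q \<le> r" "u \<in> mwords A q" "v \<in> mwords (S - A) (r - q)"
      by auto
    have u: "filter ?P u = u" "filter ?Q u = []" and v: "filter ?P v = []" "filter ?Q v = v"
      using x by (auto simp: mwords_def filter_empty_conv filter_id_conv)
    have sort: "sort_key snd u = u" "sort_key snd v = v"
      using x by (auto simp: mwords_def intro: sort_key_id_if_sorted)
    have "filter ?P (sort_key snd (u @ v)) = u" "filter ?Q (sort_key snd (u @ v)) = v"
      by (simp_all only: filter_sort filter_append u v append_Nil append_Nil2 sort)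
    moreover have "length u = q" using x by (simp add: mwords_def)
    ultimately show "(length (filter ?P (case x of (q, u, v) \<Rightarrow> sort_key snd (u @ v))),
        filter ?P (case x of (q, u, v) \<Rightarrow> sort_key snd (u @ v)),
        filter ?Q (case x of (q, u, v) \<Rightarrow> sort_key snd (u @ v))) = x"
      unfolding x prod.case by simp
    show "(case x of (q, u, v) \<Rightarrow> sort_key snd (u @ v)) \<in> {fs \<in> mwords S r. saturated A fs}"
      unfolding x prod.case using x(2-4) A by (auto simp: mwords_def saturated_def)
  qed auto
  also have "\<dots> = (\<Sum>q\<in>{..r}. \<Sum>(u, v)\<in>mwords A q \<times> mwords (S - A) (r - q). F u v)"
    using A fin by (subst sum.Sigma) auto
  also have "\<dots> = (\<Sum>q\<in>{..r}. \<Sum>u\<in>mwords A q. \<Sum>v\<in>mwords (S - A) (r - q). F u v)"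
    by (simp only: sum.cartesian_product)
  finally show ?thesis .
qed

section \<open>Constants and rearrangements of finite sums\<close>

lemma mps_coeff_const_mult: "mps_coeff (mps_const c * f) m = c * mps_coeff f m"
proof -
  have "mps_coeff (mps_const c * f) m = (\<Sum>x\<in>splits m. if x = ({#}, m) then c * mps_coeff f m else 0)"
    unfolding mps_coeff_mult mps_const_def by (auto simp: splits_def intro!: sum.cong)
  also have "\<dots> = c * mps_coeff f m"
    by (simp add: sum.delta) (simp add: splits_def)
  finally show ?thesis .
qed

lemma mps_const_mult: "mps_const a * mps_const b = mps_const (a * b)"
  and mps_const_add: "mps_const a + mps_const b = mps_const (a + b)"
  by (rule mps_eqI; simp add: mps_coeff_const_mult, simp add: mps_const_def)+

lemma mps_const_0 [simp]: "mps_const 0 = 0"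
  and mps_const_1 [simp]: "mps_const 1 = 1"
  by (rule mps_eqI; simp add: mps_const_def one_mps_def)+

lemma of_nat_eq_mps_const: "of_nat n = mps_const (of_nat n)"
  by (induction n) (simp, metis mps_const_1 mps_const_add of_nat_Suc)

lemma if_sum_0: "(if P then \<Sum>i\<in>I. f i else 0) = (\<Sum>i\<in>I. if P then f i else (0 :: 'a :: comm_monoid_add))"
  by simp

lemma sum_double_delta:
  fixes x y :: "'a :: comm_ring_1"
  assumes "finite I" "finite J" "k \<in> I" "l \<in> J"
  shows "(\<Sum>i\<in>I. \<Sum>j\<in>J. h i j * (if k = i then x else 0) * (if l = j then y else 0)) = h k l * x * y"
proof -
  have "(\<Sum>j\<in>J. h i j * (if k = i then x else 0) * (if l = j then y else 0)) =
      (if k = i then h i l * x * y else 0)" for i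
    using assms(2,4) by (cases "k = i") (simp_all add: mult_if_0)
  then show ?thesis using assms(1,3) by (simp only: sum_if_index)
qed

lemma mult_sum_mult_sum:
  fixes p :: "'a :: comm_ring_1"
  shows "p * (\<Sum>u\<in>U. f u) * (\<Sum>v\<in>V. g v) = (\<Sum>u\<in>U. \<Sum>v\<in>V. p * f u * g v)"
  by (simp only: mult.assoc [of p] sum_product) (simp only: sum_distrib_left)

lemma sum_distrib_left3:
  fixes c :: "'a :: comm_ring_1"
  shows "c * (\<Sum>q\<in>I. \<Sum>i\<in>J. \<Sum>j\<in>K. X q i j) = (\<Sum>q\<in>I. \<Sum>i\<in>J. \<Sum>j\<in>K. c * X q i j)"
  by (simp only: sum_distrib_left)

text \<open>The last transposition joins the cycle of \<open>d\<close> inside \<open>A\<close> to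
  the cycle of \<open>a\<close> outside. As \<open>a\<close> runs through the whole complement, the
  second factor is \<open>j\<close> times a derivative outright; \<open>d\<close> is a single mark
  in \<open>A\<close>, and the factor \<open>card A\<close> turns it into an average.\<close>

lemma sum_splits_at:
  assumes A: "A \<subseteq> S" "finite S" and d: "d \<in> A" and N: "card S \<le> N"
  shows "of_nat (card A) * (\<Sum>fs\<in>mwords S r. if splits_at S fs A
      then \<Sum>a\<in>S - A. pmon (cycles S (wperm fs \<circ> transpose d a)) else 0) =
    (\<Sum>q\<in>{..r}. join_cut_bil N (hcoef (card A) q) (hcoef (card (S - A)) (r - q)))"
proof -
  define B where "B = S - A"
  let ?P = "\<lambda>e :: nat \<times> nat. snd e \<in> A" and ?Q = "\<lambda>e :: nat \<times> nat. snd e \<in> - A"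
  have fin: "finite A" "finite B" using A by (auto simp: B_def intro: finite_subset)
  have cards: "card A \<le> N" "card B \<le> N"
    using card_mono [OF A(2,1)] card_mono [OF A(2), of B] N by (auto simp: B_def)
  define G where "G u v a = p_var (card (orbit (wperm u) d) + card (orbit (wperm v) a)) *
    pmon (cycles A (wperm u) - {orbit (wperm u) d}) * pmon (cycles B (wperm v) - {orbit (wperm v) a})"
    for u v a
  have summand: "(\<Sum>a\<in>B. pmon (cycles S (wperm fs \<circ> transpose d a))) =
      (\<Sum>a\<in>B. G (filter ?P fs) (filter ?Q fs) a)"
    if fs: "fs \<in> mwords S r" and sat: "saturated A fs" for fs
  proof (rule sum.cong [OF refl])
    fix a assume a: "a \<in> B"
    define \<sigma> where "\<sigma> = wperm fs"
    have \<sigma>: "\<sigma> permutes S" unfolding \<sigma>_def using fs by (rule mwords_permutes)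
    have orbA: "orbit (wperm (filter ?P fs)) x = orbit \<sigma> x" if "x \<in> A" for x
      unfolding \<sigma>_def using sat that by (rule orbit_filter)
    have orbB: "orbit (wperm (filter ?Q fs)) x = orbit \<sigma> x" if "x \<in> B" for x
      unfolding \<sigma>_def using sat that by (intro orbit_filter) (simp_all add: B_def)
    have subA: "orbit \<sigma> x \<subseteq> A" if "x \<in> A" for x
    proof
      fix y assume "y \<in> orbit \<sigma> x"
      then show "y \<in> A" by induction (use that sat in \<open>simp_all add: \<sigma>_def saturated_wperm\<close>)
    qed
    have subB: "orbit \<sigma> x \<subseteq> - A" if "x \<in> B" for x
    proof
      fix y assume "y \<in> orbit \<sigma> x"
      then show "y \<in> - A" by induction (use that sat in \<open>simp_all add: \<sigma>_def saturated_wperm B_def\<close>)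
    qed
    have cyc: "cycles A (wperm (filter ?P fs)) = orbit \<sigma> ` A" "cycles B (wperm (filter ?Q fs)) = orbit \<sigma> ` B"
      unfolding cycles_def using orbA orbB by simp_all
    define XA XB where "XA = orbit \<sigma> ` A" and "XB = orbit \<sigma> ` B"
    have disj: "XA \<inter> XB = {}"
    proof (rule equals0I)
      fix C assume "C \<in> XA \<inter> XB"
      then obtain x y where xy: "x \<in> A" "C = orbit \<sigma> x" "y \<in> B" "C = orbit \<sigma> y"
        unfolding XA_def XB_def by (elim IntE imageE)
      have "C \<subseteq> A" using subA [OF xy(1)] xy(2) by simp
      moreover have "C \<subseteq> - A" using subB [OF xy(3)] xy(4) by simp
      moreover have "C \<noteq> {}" unfolding xy(2) by (rule orbit_nonempty)
      ultimately show False by blast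
    qed
    have mem: "orbit \<sigma> d \<in> XA" "orbit \<sigma> a \<in> XB" using d a by (simp_all add: XA_def XB_def)
    have "S = A \<union> B" using A by (auto simp: B_def)
    then have "cycles S \<sigma> = XA \<union> XB" by (simp add: cycles_def XA_def XB_def image_Un)
    then have "cycles S \<sigma> - {orbit \<sigma> d} - {orbit \<sigma> a} = (XA - {orbit \<sigma> d}) \<union> (XB - {orbit \<sigma> a})"
      using disj mem by blast
    moreover have "(XA - {orbit \<sigma> d}) \<inter> (XB - {orbit \<sigma> a}) = {}" using disj by blast
    moreover have "finite XA" "finite XB" using fin by (simp_all add: XA_def XB_def)
    ultimately have "pmon (cycles S \<sigma> - {orbit \<sigma> d} - {orbit \<sigma> a}) =
        pmon (XA - {orbit \<sigma> d}) * pmon (XB - {orbit \<sigma> a})"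
      by (simp add: pmon_Un)
    moreover have "a \<notin> orbit \<sigma> d" using subA [OF d] a by (auto simp: B_def)
    then have "pmon (cycles S (\<sigma> \<circ> transpose d a)) = p_var (card (orbit \<sigma> d) + card (orbit \<sigma> a)) *
        pmon (cycles S \<sigma> - {orbit \<sigma> d} - {orbit \<sigma> a})"
      using A d a by (intro pmon_transpose_join [OF \<sigma>]) (auto simp: B_def)
    ultimately show "pmon (cycles S (wperm fs \<circ> transpose d a)) = G (filter ?P fs) (filter ?Q fs) a"
      unfolding G_def cyc orbA [OF d] orbB [OF a]
      by (simp only: \<sigma>_def XA_def XB_def mult.assoc)
  qed
  have "(\<Sum>fs\<in>mwords S r. if splits_at S fs A
      then \<Sum>a\<in>B. pmon (cycles S (wperm fs \<circ> transpose d a)) else 0) =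
      (\<Sum>fs\<in>{fs \<in> mwords S r. saturated A fs}. if linked A (filter ?P fs) \<and> linked B (filter ?Q fs)
        then \<Sum>a\<in>B. G (filter ?P fs) (filter ?Q fs) a else 0)"
  proof (rule sum.mono_neutral_cong_right)
    show "finite (mwords S r)" using A by simp
    show "\<forall>fs\<in>mwords S r - {fs \<in> mwords S r. saturated A fs}. (if splits_at S fs A
      then \<Sum>a\<in>B. pmon (cycles S (wperm fs \<circ> transpose d a)) else 0) = 0"
      by (auto simp: splits_at_def)
    fix fs assume "fs \<in> {fs \<in> mwords S r. saturated A fs}"
    then have fs: "fs \<in> mwords S r" "saturated A fs" by auto
    have "linked A (filter ?P fs) \<longleftrightarrow> linked A fs" using fs(2) by (intro linked_filter) auto
    moreover have "linked B (filter ?Q fs) \<longleftrightarrow> linked B fs"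
      using fs(2) by (intro linked_filter) (auto simp: B_def)
    ultimately show "(if splits_at S fs A
        then \<Sum>a\<in>B. pmon (cycles S (wperm fs \<circ> transpose d a)) else 0) =
      (if linked A (filter ?P fs) \<and> linked B (filter ?Q fs)
        then \<Sum>a\<in>B. G (filter ?P fs) (filter ?Q fs) a else 0)"
      using summand [OF fs] fs(2) by (simp only: splits_at_def B_def [symmetric] simp_thms)
  qed auto
  also have "\<dots> = (\<Sum>q\<in>{..r}. \<Sum>u\<in>mwords A q. \<Sum>v\<in>mwords B (r - q).
      if linked A u \<and> linked B v then \<Sum>a\<in>B. G u v a else 0)"
    unfolding B_def by (rule sum_mwords_saturated [OF A])
  \<comment> \<open>The lengths of the two joined cycles become summation indices, with at most one
    pair \<open>(i, j)\<close> contributing for each \<open>u\<close>, \<open>v\<close>,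
    \<open>a\<close>. This separates the factor that depends on \<open>u\<close> from the one that
    depends on \<open>v\<close>.\<close>
  also have "\<dots> = (\<Sum>q\<in>{..r}. \<Sum>u\<in>mwords A q. \<Sum>v\<in>mwords B (r - q). \<Sum>a\<in>B. \<Sum>i\<in>{1..N}. \<Sum>j\<in>{1..N}.
      p_var (i + j) * marked_weight i A d u * marked_weight j B a v)"
  proof (intro sum.cong refl)
    fix q u v assume u: "u \<in> mwords A q" and v: "v \<in> mwords B (r - q)"
    have "(if linked A u \<and> linked B v then G u v a else 0) = (\<Sum>i\<in>{1..N}. \<Sum>j\<in>{1..N}.
      p_var (i + j) * marked_weight i A d u * marked_weight j B a v)" if a: "a \<in> B" for a
    proof -
      have "card (orbit (wperm u) d) \<in> {1..N}"
        using card_cycles(2) [OF mwords_permutes [OF u] fin(1), of "orbit (wperm u) d"] d cards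
        by (simp add: cycles_def)
      moreover have "card (orbit (wperm v) a) \<in> {1..N}"
        using card_cycles(2) [OF mwords_permutes [OF v] fin(2), of "orbit (wperm v) a"] a cards
        by (simp add: cycles_def)
      ultimately have *: "(\<Sum>i\<in>{1..N}. \<Sum>j\<in>{1..N}.
          p_var (i + j) * (if card (orbit (wperm u) d) = i then x else 0) *
            (if card (orbit (wperm v) a) = j then y else 0)) =
          p_var (card (orbit (wperm u) d) + card (orbit (wperm v) a)) * x * y" for x y
        by (intro sum_double_delta finite_atLeastAtMost)
      show ?thesis
      proof (cases "linked A u \<and> linked B v")
        case True
        then show ?thesis by (simp only: G_def marked_weight_def simp_thms if_True *)
      next
        case False
        then have "p_var (i + j) * marked_weight i A d u * marked_weight j B a v = 0" for i j
          by (auto simp: marked_weight_def)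
        then show ?thesis using False by (simp only: if_False sum.neutral_const)
      qed
    qed
    then show "(if linked A u \<and> linked B v then \<Sum>a\<in>B. G u v a else 0) =
        (\<Sum>a\<in>B. \<Sum>i\<in>{1..N}. \<Sum>j\<in>{1..N}. p_var (i + j) * marked_weight i A d u * marked_weight j B a v)"
      by (simp only: if_sum_0 cong: sum.cong)
  qed
  also have "\<dots> = (\<Sum>q\<in>{..r}. \<Sum>i\<in>{1..N}. \<Sum>j\<in>{1..N}. p_var (i + j) *
      (\<Sum>u\<in>mwords A q. marked_weight i A d u) *
      (\<Sum>a\<in>B. \<Sum>v\<in>mwords B (r - q). marked_weight j B a v))"
  proof (rule sum.cong [OF refl])
    fix q
    let ?U = "mwords A q" and ?V = "mwords B (r - q)"
    let ?t = "\<lambda>i j u v a. p_var (i + j) * marked_weight i A d u * marked_weight j B a v"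
    have "(\<Sum>u\<in>?U. \<Sum>v\<in>?V. \<Sum>a\<in>B. \<Sum>i\<in>{1..N}. \<Sum>j\<in>{1..N}. ?t i j u v a) =
        (\<Sum>i\<in>{1..N}. \<Sum>j\<in>{1..N}. \<Sum>u\<in>?U. \<Sum>v\<in>?V. \<Sum>a\<in>B. ?t i j u v a)"
      by (simp only: sum.swap [of _ "{1..N}" ?U] sum.swap [of _ "{1..N}" ?V] sum.swap [of _ "{1..N}" B])
    also have "\<dots> = (\<Sum>i\<in>{1..N}. \<Sum>j\<in>{1..N}. p_var (i + j) *
        (\<Sum>u\<in>?U. marked_weight i A d u) * (\<Sum>v\<in>?V. \<Sum>a\<in>B. marked_weight j B a v))"
      unfolding mult_sum_mult_sum by (simp only: sum_distrib_left)
    also have "\<dots> = (\<Sum>i\<in>{1..N}. \<Sum>j\<in>{1..N}. p_var (i + j) *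
        (\<Sum>u\<in>?U. marked_weight i A d u) * (\<Sum>a\<in>B. \<Sum>v\<in>?V. marked_weight j B a v))"
      by (intro sum.cong refl arg_cong2 [where f = "(*)"] sum.swap)
    finally show "(\<Sum>u\<in>?U. \<Sum>v\<in>?V. \<Sum>a\<in>B. \<Sum>i\<in>{1..N}. \<Sum>j\<in>{1..N}. ?t i j u v a) = \<dots>" .
  qed
  finally have expand: "(\<Sum>fs\<in>mwords S r. if splits_at S fs A
      then \<Sum>a\<in>B. pmon (cycles S (wperm fs \<circ> transpose d a)) else 0) = \<dots>" .
  show ?thesis
    unfolding B_def [symmetric] expand
      sum_distrib_left3 join_cut_bil_def
  proof (intro sum.cong refl)
    fix q i j assume "i \<in> {1..N}" "j \<in> {1..N}"
    then have "i \<ge> 1" "j \<ge> 1" by auto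
    note average = marked_weight_average [OF fin(1) d this(1), of q]
      and deriv = sum_marked_weight_eq_deriv [OF fin(2) this(2), of "r - q"]
    have "c * (p * x * y) = p * (c * x) * y" for c p x y :: "(indet, rat) mps"
      by (simp only: ac_simps)
    then show "of_nat (card A) * (p_var (i + j) * (\<Sum>u\<in>mwords A q. marked_weight i A d u) *
        (\<Sum>a\<in>B. \<Sum>v\<in>mwords B (r - q). marked_weight j B a v)) =
      of_nat (i * j) * p_var (i + j) * mps_deriv (ind_p i) (hcoef (card A) q) *
        mps_deriv (ind_p j) (hcoef (card B) (r - q))"
      by (simp only: average deriv of_nat_mult) (simp only: ac_simps)
  qed
qed

text \<open>The letters miss the point \<open>Suc b\<close>, so a transitive word of positive length
  must end in a letter \<open>(a, Suc b)\<close>. Positive length matters, as the empty word is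
  linked on a single point.\<close>

lemma not_linked_interval:
  assumes "fs \<in> mwords {1..b} (Suc r)"
  shows "\<not> linked {1..Suc b} fs"
proof -
  have b: "b \<ge> 1" using assms by (cases fs) (auto simp: mwords_def)
  have "saturated {1..b} fs" using mwords_letters [OF assms] by (auto simp: saturated_def)
  then show ?thesis using linkedD [of "{1..Suc b}" fs "{1..b}"] b by fastforce
qed

lemma weight_snoc:
  "weight S (fs @ [(a, d)]) =
    (if linked S fs then pmon (cycles S (wperm fs \<circ> transpose d a)) else 0) +
    (if \<not> linked S fs \<and> linked S (fs @ [(a, d)])
     then pmon (cycles S (wperm fs \<circ> transpose d a)) else 0)"
proof -
  have "linked S (fs @ [(a, d)])" if "linked S fs" using that by (simp add: linked_def)
  moreover have "wperm (fs @ [(a, d)]) = wperm fs \<circ> transpose d a"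
    by (simp add: transpose_commute)
  ultimately show ?thesis unfolding weight_def by (cases "linked S fs") (simp_all only: simp_thms if_True if_False add_0 add_0_right)
qed

text \<open>The factor \<open>d\<close> stays in front because the linear term is an average over
  all \<open>d\<close> points, whereas the quadratic term has been averaged within \<open>A\<close>
  alone, at the cost of \<open>1 / card A\<close>. The choice \<open>A = {1..d}\<close> contributes
  nothing, since the derivatives of \<open>hcoef 0\<close> vanish.\<close>

lemma hcoef_Suc:
  assumes d: "d \<ge> 1" and N: "d \<le> N"
  shows "of_nat d * hcoef d (Suc r) = join_cut_lin N (hcoef d r) +
    of_nat d * (\<Sum>A\<in>{A \<in> Pow {1..d}. d \<in> A}. mps_const (1 / of_nat (card A)) *
      (\<Sum>q\<in>{..r}. join_cut_bil N (hcoef (card A) q) (hcoef (d - card A) (r - q))))"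
proof -
  define S where "S = {1..d}"
  obtain b where b: "d = Suc b" using d by (cases d) auto
  have S: "finite S" "d \<in> S" "card S = d" using d by (auto simp: S_def)
  let ?g = "\<lambda>fs a. pmon (cycles S (wperm fs \<circ> transpose d a))"
  have "hcoef d (Suc r) = wsum b (Suc r) (weight S) + wsum d r (jm_append d (weight S))"
    unfolding hcoef_def S_def b by (rule wsum_Suc)
  also have "wsum b (Suc r) (weight S) = 0"
    using not_linked_interval by (intro sum.neutral) (auto simp: weight_def S_def b)
  also have "wsum d r (jm_append d (weight S)) =
      (\<Sum>fs\<in>mwords S r. \<Sum>a\<in>S - {d}. weight S (fs @ [(a, d)]))"
    unfolding jm_append_def S_def by (intro sum.cong refl) auto
  also have "\<dots> = (\<Sum>fs\<in>mwords S r. \<Sum>a\<in>S - {d}. if linked S fs then ?g fs a else 0) +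
      (\<Sum>fs\<in>mwords S r. \<Sum>a\<in>S - {d}. if \<not> linked S fs \<and> linked S (fs @ [(a, d)]) then ?g fs a else 0)"
    unfolding weight_snoc sum.distrib by (rule refl)
  also have "(\<Sum>fs\<in>mwords S r. \<Sum>a\<in>S - {d}. if linked S fs then ?g fs a else 0) =
      wsum d r (\<lambda>fs. if linked S fs then \<Sum>a\<in>S - {d}. ?g fs a else 0)"
    unfolding if_sum_0 S_def by (rule refl)
  also have "(\<Sum>fs\<in>mwords S r. \<Sum>a\<in>S - {d}.
        if \<not> linked S fs \<and> linked S (fs @ [(a, d)]) then ?g fs a else 0) =
      (\<Sum>A\<in>{A \<in> Pow S. d \<in> A}. \<Sum>fs\<in>mwords S r. \<Sum>a\<in>S - {d}.
        if a \<notin> A \<and> splits_at S fs A then ?g fs a else 0)" (is "?L = ?R")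
  proof -
    have "?L = (\<Sum>fs\<in>mwords S r. \<Sum>a\<in>S - {d}. \<Sum>A\<in>{A \<in> Pow S. d \<in> A}.
        if a \<notin> A \<and> splits_at S fs A then ?g fs a else 0)"
    proof (intro sum.cong refl)
      fix fs a assume "fs \<in> mwords S r" "a \<in> S - {d}"
      then show "(if \<not> linked S fs \<and> linked S (fs @ [(a, d)]) then ?g fs a else 0) =
          (\<Sum>A\<in>{A \<in> Pow S. d \<in> A}. if a \<notin> A \<and> splits_at S fs A then ?g fs a else 0)"
        using S mwords_letters by (intro sum_over_splits) auto
    qed
    also have "\<dots> = (\<Sum>fs\<in>mwords S r. \<Sum>A\<in>{A \<in> Pow S. d \<in> A}. \<Sum>a\<in>S - {d}.
        if a \<notin> A \<and> splits_at S fs A then ?g fs a else 0)"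
      by (intro sum.cong refl sum.swap)
    also have "\<dots> = ?R" by (rule sum.swap)
    finally show ?thesis .
  qed
  also have "\<dots> = (\<Sum>A\<in>{A \<in> Pow S. d \<in> A}. mps_const (1 / of_nat (card A)) *
      (\<Sum>q\<in>{..r}. join_cut_bil N (hcoef (card A) q) (hcoef (d - card A) (r - q))))"
  proof (rule sum.cong [OF refl])
    fix A assume A: "A \<in> {A \<in> Pow S. d \<in> A}"
    then have A': "A \<subseteq> S" "d \<in> A" "finite A" using S by (auto intro: finite_subset)
    have inner: "(\<Sum>a\<in>S - {d}. if a \<notin> A \<and> splits_at S fs A then ?g fs a else 0) =
        (if splits_at S fs A then \<Sum>a\<in>S - A. ?g fs a else 0)" for fs
    proof -
      have "(\<Sum>a\<in>S - {d}. if a \<notin> A then ?g fs a else 0) = (\<Sum>a\<in>S - A. ?g fs a)"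
        using A' S by (intro sum.mono_neutral_cong_right) auto
      then show ?thesis by (cases "splits_at S fs A") (simp_all only: simp_thms if_False sum.neutral_const if_True)
    qed
    have "card (S - A) = d - card A" using A' S by (simp add: card_Diff_subset)
    then have *: "of_nat (card A) * (\<Sum>fs\<in>mwords S r. if splits_at S fs A then \<Sum>a\<in>S - A. ?g fs a else 0) =
        (\<Sum>q\<in>{..r}. join_cut_bil N (hcoef (card A) q) (hcoef (d - card A) (r - q)))"
      using sum_splits_at [OF A'(1) S(1) A'(2), of N r] N S(3) by simp
    have "card A > 0" using A' by (auto simp: card_gt_0_iff)
    then have "mps_const (1 / of_nat (card A)) * (of_nat (card A) * f) = f" for f :: "(indet, rat) mps"
      unfolding of_nat_eq_mps_const mult.assoc [symmetric] mps_const_mult by simp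
    from this [of "\<Sum>fs\<in>mwords S r. if splits_at S fs A then \<Sum>a\<in>S - A. ?g fs a else 0"]
    show "(\<Sum>fs\<in>mwords S r. \<Sum>a\<in>S - {d}. if a \<notin> A \<and> splits_at S fs A then ?g fs a else 0) =
        mps_const (1 / of_nat (card A)) *
        (\<Sum>q\<in>{..r}. join_cut_bil N (hcoef (card A) q) (hcoef (d - card A) (r - q)))"
      unfolding inner * by (rule sym)
  qed
  finally show ?thesis
    by (simp only: S_def add_0 distrib_left sum_linked_transpose [OF d N])
qed

lemma sum_Pow_with_max:
  fixes g :: "nat \<Rightarrow> 'a :: comm_ring_1"
  assumes d: "d \<ge> 1"
  shows "(\<Sum>A\<in>{A \<in> Pow {1..d}. d \<in> A}. g (card A)) = (\<Sum>n\<in>{1..d}. of_nat ((d - 1) choose (n - 1)) * g n)"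
proof -
  let ?P = "{A \<in> Pow {1..d}. d \<in> A}"
  have "card A \<in> {1..d}" if "A \<in> ?P" for A
  proof -
    have "finite A" "A \<noteq> {}" using that by (auto intro: finite_subset)
    then show ?thesis using card_mono [of "{1..d}" A] that by (simp add: Suc_le_eq card_gt_0_iff)
  qed
  then have "(\<Sum>A\<in>?P. g (card A)) = (\<Sum>n\<in>{1..d}. \<Sum>A\<in>{A \<in> ?P. card A = n}. g (card A))"
    by (intro sum.group [symmetric]) auto
  also have "\<dots> = (\<Sum>n\<in>{1..d}. of_nat ((d - 1) choose (n - 1)) * g n)"
  proof (rule sum.cong [OF refl])
    fix n assume n: "n \<in> {1..d}"
    have "{A \<in> ?P. card A = n} = insert d ` {B. B \<subseteq> {1..d - 1} \<and> card B = n - 1}"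
    proof (intro equalityI subsetI)
      fix A assume A: "A \<in> {A \<in> ?P. card A = n}"
      then have "A - {d} \<subseteq> {1..d - 1}" by fastforce
      moreover have "card (A - {d}) = n - 1" using A by simp
      ultimately show "A \<in> insert d ` {B. B \<subseteq> {1..d - 1} \<and> card B = n - 1}"
        using A by (intro image_eqI [of _ _ "A - {d}"]) auto
    next
      fix A assume "A \<in> insert d ` {B. B \<subseteq> {1..d - 1} \<and> card B = n - 1}"
      then obtain B where B: "A = insert d B" "B \<subseteq> {1..d - 1}" "card B = n - 1" by auto
      then have "finite B" "d \<notin> B" using d by (auto intro: finite_subset)
      then show "A \<in> {A \<in> ?P. card A = n}" using B n d by fastforce
    qed
    moreover have "inj_on (insert d) {B. B \<subseteq> {1..d - 1} \<and> card B = n - 1}"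
    proof (rule inj_onI)
      fix B C assume "B \<in> {B. B \<subseteq> {1..d - 1} \<and> card B = n - 1}" "C \<in> {B. B \<subseteq> {1..d - 1} \<and> card B = n - 1}"
        and eq: "insert d B = insert d C"
      then have "d \<notin> B" "d \<notin> C" using d by auto
      then show "B = C" using eq by auto
    qed
    ultimately have "card {A \<in> ?P. card A = n} = (d - 1) choose (n - 1)"
      by (simp add: card_image n_subsets)
    moreover have "(\<Sum>A\<in>{A \<in> ?P. card A = n}. g (card A)) = (\<Sum>A\<in>{A \<in> ?P. card A = n}. g n)"
      by (intro sum.cong refl) auto
    ultimately show "(\<Sum>A\<in>{A \<in> ?P. card A = n}. g (card A)) = of_nat ((d - 1) choose (n - 1)) * g n"
      by (simp only: sum_constant)
  qed
  finally show ?thesis .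
qed

text \<open>\<open>d / d!\<close> times the binomial coefficient times \<open>1 / n\<close> is
  \<open>1 / (n! (d - n)!)\<close>, so the sum over components becomes a convolution, as in a
  product of exponential generating functions.\<close>

theorem hcoef_recurrence:
  assumes d: "d \<ge> 1" and N: "d \<le> N"
  shows "of_nat d * (mps_const (1 / fact d) * hcoef d (Suc r)) =
    mps_const (1 / fact d) * join_cut_lin N (hcoef d r) +
    (\<Sum>n\<in>{1..d}. mps_const (1 / fact n) * mps_const (1 / fact (d - n)) *
      (\<Sum>q\<in>{..r}. join_cut_bil N (hcoef n q) (hcoef (d - n) (r - q))))"
proof -
  define K where "K n = (\<Sum>q\<in>{..r}. join_cut_bil N (hcoef n q) (hcoef (d - n) (r - q)))" for n
  have "of_nat d * (mps_const (1 / fact d) * hcoef d (Suc r)) =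
      mps_const (1 / fact d) * (of_nat d * hcoef d (Suc r))" by (simp only: mult.left_commute)
  also have "\<dots> = mps_const (1 / fact d) * join_cut_lin N (hcoef d r) +
      mps_const (1 / fact d) * (of_nat d *
        (\<Sum>n\<in>{1..d}. of_nat ((d - 1) choose (n - 1)) * (mps_const (1 / of_nat n) * K n)))"
    unfolding hcoef_Suc [OF d N] distrib_left K_def [symmetric]
    by (subst sum_Pow_with_max [OF d, of "\<lambda>n. mps_const (1 / of_nat n) * K n"]) (rule refl)
  also have "mps_const (1 / fact d) * (of_nat d *
        (\<Sum>n\<in>{1..d}. of_nat ((d - 1) choose (n - 1)) * (mps_const (1 / of_nat n) * K n))) =
      (\<Sum>n\<in>{1..d}. mps_const (1 / fact n) * mps_const (1 / fact (d - n)) * K n)"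
    unfolding sum_distrib_left
  proof (rule sum.cong [OF refl])
    fix n assume n: "n \<in> {1..d}"
    have "1 / fact d * (of_nat d * (of_nat ((d - 1) choose (n - 1)) * (1 / of_nat n))) =
        (1 / fact n * (1 / fact (d - n)) :: rat)"
    proof -
      obtain k where k: "n = Suc k" using n by (cases n) auto
      obtain e where e: "d = Suc e" using d by (cases d) auto
      have "of_nat (e choose k) = (fact e / (fact k * fact (e - k)) :: rat)"
        using n k e by (intro binomial_fact) simp
      moreover have "1 / (a * x) * (a * (x / (y * z) * (1 / b))) = 1 / (b * y) * (1 / z)"
        if "a \<noteq> 0" "x \<noteq> 0" for a b x y z :: rat
        using that by simp
      ultimately show ?thesis
        unfolding k e fact_Suc diff_Suc_Suc diff_Suc_1 by (simp del: of_nat_Suc)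
    qed
    then show "mps_const (1 / fact d) * (of_nat d *
        (of_nat ((d - 1) choose (n - 1)) * (mps_const (1 / of_nat n) * K n))) =
        mps_const (1 / fact n) * mps_const (1 / fact (d - n)) * K n"
      unfolding of_nat_eq_mps_const mult.assoc [symmetric] mps_const_mult
      by (simp only: mult.assoc)
  qed
  finally show ?thesis unfolding K_def .
qed

section \<open>Coefficients of the generating function\<close>

lemma mps_coeff_var_times:
  "mps_coeff (mps_var v * f) m = (if v \<in># m then mps_coeff f (m - {#v#}) else 0)"
proof (cases "v \<in># m")
  case True
  have "mps_coeff (mps_var v * f) m = (\<Sum>x\<in>splits m. if x = ({#v#}, m - {#v#}) then mps_coeff f (m - {#v#}) else 0)"
    unfolding mps_coeff_mult mps_var_def by (auto simp: splits_def intro!: sum.cong)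
  also have "\<dots> = mps_coeff f (m - {#v#})"
    using True by (simp add: sum.delta) (simp add: splits_def)
  finally show ?thesis using True by simp
next
  case False
  then show ?thesis using mps_coeff_var_mult [of v f m] by auto
qed

lemma mps_coeff_var_power_times:
  "mps_coeff (mps_var v ^ n * f) m =
    (if n \<le> count m v then mps_coeff f (m - replicate_mset n v) else 0)"
proof (induction n arbitrary: m)
  case (Suc n)
  have "mps_coeff (mps_var v ^ Suc n * f) m = mps_coeff (mps_var v * (mps_var v ^ n * f)) m"
    by (simp add: mult.assoc)
  then show ?case
    by (auto simp: mps_coeff_var_times Suc.IH Suc_le_eq count_greater_zero_iff [symmetric]
        simp del: count_greater_zero_iff)
qed simp

lemma mps_coeff_sum_infinite:
  assumes "finite J" "J \<subseteq> I" "\<And>i. i \<in> I - J \<Longrightarrow> mps_coeff (F i) m = 0"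
  shows "mps_coeff (mps_sum I F) m = (\<Sum>i\<in>J. mps_coeff (F i) m)"
  unfolding mps_sum_def mps_coeff_Abs using assms by (intro sum.mono_neutral_left) auto

lemma mps_coeff_var_deriv:
  "mps_coeff (mps_var v * mps_deriv v f) m = of_nat (count m v) * mps_coeff f m"
  by (auto simp: mps_coeff_var_times mps_coeff_deriv not_in_iff Suc_pred
      simp del: of_nat_Suc)

text \<open>Series in the \<open>p\<close> alone. If \<open>q\<close> is one of them, the
  coefficients of z^d t^r q factor: the exponents of z and t must be \<open>d\<close> and
  \<open>r\<close>, and the rest of the monomial is read off in \<open>q\<close>.\<close>

definition zt_free :: "(indet, rat) mps \<Rightarrow> bool" where
  "zt_free q \<longleftrightarrow> (\<forall>m. mps_coeff q m \<noteq> 0 \<longrightarrow> Ind_z \<notin># m \<and> Ind_t \<notin># m)"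

lemma zt_free_add: "zt_free f \<Longrightarrow> zt_free g \<Longrightarrow> zt_free (f + g)"
  unfolding zt_free_def by (metis add.right_neutral add.left_neutral mps_coeff_ring(2))

lemma zt_free_0 [simp]: "zt_free 0"
  and zt_free_1 [simp]: "zt_free 1"
  and zt_free_p_var [simp]: "zt_free (mps_var (Ind_p k))"
  by (simp_all add: zt_free_def one_mps_def mps_var_def)

lemma zt_free_sum: "(\<And>i. i \<in> I \<Longrightarrow> zt_free (f i)) \<Longrightarrow> zt_free (\<Sum>i\<in>I. f i)"
  by (induction I rule: infinite_finite_induct) (auto intro: zt_free_add)

lemma zt_free_of_nat [simp]: "zt_free (of_nat n)"
  by (induction n) (auto intro: zt_free_add)

lemma zt_free_mult:
  assumes "zt_free f" "zt_free g"
  shows "zt_free (f * g)"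
  unfolding zt_free_def
proof (intro allI impI)
  fix m assume "mps_coeff (f * g) m \<noteq> 0"
  then have "(\<Sum>x\<in>splits m. mps_coeff f (fst x) * mps_coeff g (snd x)) \<noteq> 0"
    by (simp add: mps_coeff_mult case_prod_beta)
  then obtain x where x: "x \<in> splits m" "mps_coeff f (fst x) * mps_coeff g (snd x) \<noteq> 0"
    by (rule sum.not_neutral_contains_not_neutral)
  moreover have "m = fst x + snd x" using x(1) by (auto simp: splits_def)
  ultimately show "Ind_z \<notin># m \<and> Ind_t \<notin># m" using assms by (auto simp: zt_free_def)
qed

lemma zt_free_prod: "(\<And>i. i \<in> I \<Longrightarrow> zt_free (f i)) \<Longrightarrow> zt_free (\<Prod>i\<in>I. f i)"
  by (induction I rule: infinite_finite_induct) (auto intro: zt_free_mult)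

lemma zt_free_deriv: "zt_free f \<Longrightarrow> zt_free (mps_deriv v f)"
  unfolding zt_free_def
proof (intro allI impI)
  fix m assume f: "\<forall>m. mps_coeff f m \<noteq> 0 \<longrightarrow> Ind_z \<notin># m \<and> Ind_t \<notin># m"
    and m: "mps_coeff (mps_deriv v f) m \<noteq> 0"
  have "mps_coeff f (add_mset v m) \<noteq> 0" using m by (auto simp: mps_coeff_deriv)
  then show "Ind_z \<notin># m \<and> Ind_t \<notin># m" using f by (metis insert_iff set_mset_add_mset_insert)
qed

lemma zt_free_hcoef: "zt_free (hcoef d r)"
  unfolding hcoef_def weight_def pmon_def by (auto intro!: zt_free_sum zt_free_prod)

lemma zt_free_join_cut_lin: "zt_free q \<Longrightarrow> zt_free (join_cut_lin N q)"
  unfolding join_cut_lin_def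
  by (intro zt_free_sum zt_free_add zt_free_mult zt_free_deriv zt_free_of_nat zt_free_p_var)

lemma zt_free_join_cut_bil: "zt_free q \<Longrightarrow> zt_free r \<Longrightarrow> zt_free (join_cut_bil N q r)"
  unfolding join_cut_bil_def
  by (intro zt_free_sum zt_free_add zt_free_mult zt_free_deriv zt_free_of_nat zt_free_p_var)

definition p_part :: "indet multiset \<Rightarrow> indet multiset" where
  "p_part m = filter_mset (\<lambda>v. v \<noteq> Ind_z \<and> v \<noteq> Ind_t) m"

text \<open>The operators of the right side differentiate by the \<open>p\<close> only, so such
  factors pass through them.\<close>

definition zt_monom :: "nat \<Rightarrow> nat \<Rightarrow> rat \<Rightarrow> (indet, rat) mps" where
  "zt_monom d r c = z_var ^ d * (t_var ^ r * mps_const c)"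

lemma mps_coeff_zt_times:
  assumes "zt_free q"
  shows "mps_coeff (z_var ^ d * (t_var ^ r * q)) m =
    (if count m Ind_z = d \<and> count m Ind_t = r then mps_coeff q (p_part m) else 0)"
proof (cases "d \<le> count m Ind_z \<and> r \<le> count m Ind_t")
  case True
  define m' where "m' = m - replicate_mset d Ind_z - replicate_mset r Ind_t"
  have eq: "mps_coeff (z_var ^ d * (t_var ^ r * q)) m = mps_coeff q m'"
    using True by (simp add: mps_coeff_var_power_times m'_def)
  have cnt: "count m' Ind_z = count m Ind_z - d" "count m' Ind_t = count m Ind_t - r"
    by (simp_all add: m'_def)
  show ?thesis
  proof (cases "count m Ind_z = d \<and> count m Ind_t = r")
    case True
    then have "m' = p_part m" by (intro multiset_eqI) (auto simp: m'_def p_part_def)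
    then show ?thesis using eq True by simp
  next
    case False
    then have "Ind_z \<in># m' \<or> Ind_t \<in># m'"
      using \<open>d \<le> count m Ind_z \<and> r \<le> count m Ind_t\<close> cnt by (auto simp: count_greater_zero_iff [symmetric]
        simp del: count_greater_zero_iff)
    then have "mps_coeff q m' = 0" using assms by (auto simp: zt_free_def)
    then show ?thesis by (simp only: eq False if_False)
  qed
next
  case False
  then show ?thesis by (auto simp: mps_coeff_var_power_times)
qed

lemma mps_coeff_zt_monom_times:
  assumes "zt_free q"
  shows "mps_coeff (zt_monom d r c * q) m =
    (if count m Ind_z = d \<and> count m Ind_t = r then c * mps_coeff q (p_part m) else 0)"
proof -
  have "zt_free (mps_const c)" by (simp add: zt_free_def mps_const_def)
  then have "zt_free (mps_const c * q)" using assms by (rule zt_free_mult)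
  then show ?thesis
    by (simp add: zt_monom_def mult.assoc mps_coeff_zt_times mps_coeff_const_mult)
qed

lemma zt_monom_mult: "zt_monom d r c * zt_monom e s c' = zt_monom (d + e) (r + s) (c * c')"
  unfolding zt_monom_def power_add mps_const_mult [symmetric] by (simp only: ac_simps)

lemma mps_deriv_const [simp]: "mps_deriv v (mps_const c) = 0"
  by (rule mps_eqI) (simp add: mps_coeff_deriv mps_const_def)

lemma mps_deriv_power_var: "u \<noteq> v \<Longrightarrow> mps_deriv u (mps_var v ^ n) = 0"
  by (induction n) (simp_all add: mps_deriv_mult mps_deriv_var)

lemma mps_deriv_zt_monom: "mps_deriv (Ind_p k) (zt_monom d r c * q) = zt_monom d r c * mps_deriv (Ind_p k) q"
  by (simp add: zt_monom_def mps_deriv_mult mps_deriv_power_var)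

lemma join_cut_lin_zt_monom: "join_cut_lin N (zt_monom d r c * q) = zt_monom d r c * join_cut_lin N q"
  unfolding join_cut_lin_def mps_deriv_zt_monom sum_distrib_left distrib_left by (simp only: ac_simps)

lemma join_cut_bil_zt_monom:
  "join_cut_bil N (zt_monom d r c * q) (zt_monom e s c' * q') =
    zt_monom (d + e) (r + s) (c * c') * join_cut_bil N q q'"
  unfolding join_cut_bil_def mps_deriv_zt_monom sum_distrib_left zt_monom_mult [symmetric]
  by (simp only: ac_simps)

section \<open>Cycle types and monotone Hurwitz numbers\<close>

lemma sum_card_cycles:
  assumes "\<sigma> permutes S" "finite S"
  shows "(\<Sum>A\<in>cycles S \<sigma>. card A) = card S"
proof -
  \<comment> \<open>The integers stand in for the natural numbers because
    \<open>sum_over_orbits\<close> is stated over a ring.\<close>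
  have "(\<Sum>a\<in>S. 1 :: int) = (\<Sum>A\<in>cycles S \<sigma>. int (card A) * 1)"
    by (rule sum_over_orbits [OF assms, of "\<lambda>_. 1"])
  then have "int (card S) = int (\<Sum>A\<in>cycles S \<sigma>. card A)" by simp
  then show ?thesis by (simp only: of_nat_eq_iff)
qed

lemma cycle_type_in_partitions:
  assumes "\<sigma> permutes {1..d}"
  shows "cycle_type d \<sigma> \<in> partitions d"
proof -
  have "0 \<notin># cycle_type d \<sigma>"
    using card_cycles(2) [OF assms] unfolding cycle_type_def cycles_def [symmetric] by fastforce
  moreover have "sum_mset (cycle_type d \<sigma>) = d"
    using sum_card_cycles [OF assms] unfolding cycle_type_def cycles_def [symmetric] sum_unfold_sum_mset
    by simp
  ultimately show ?thesis by (simp add: partitions_def)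
qed

lemma p_monomial_cycle_type: "p_monomial (cycle_type d \<sigma>) = pmon (cycles {1..d} \<sigma>)"
  by (simp add: p_monomial_def cycle_type_def pmon_def cycles_def prod_unfold_prod_mset
      image_mset.compositionality comp_def)

lemma monotone_factorizations_eq:
  assumes "\<alpha> \<in> partitions d"
  shows "monotone_factorizations r \<alpha> =
    {fs \<in> mwords {1..d} r. cycle_type d (wperm fs) = \<alpha> \<and> linked {1..d} fs}"
proof -
  have d: "sum_mset \<alpha> = d" using assms by (simp add: partitions_def)
  have "fs \<in> monotone_factorizations r \<alpha> \<longleftrightarrow>
      fs \<in> mwords {1..d} r \<and> cycle_type d (wperm fs) = \<alpha> \<and>
      transitive_on d (generate (sym_group d) (set (transps fs)))" for fs
    by (auto simp: monotone_factorizations_def mwords_def d wperm_def Let_def)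
  then show ?thesis using transitive_on_iff_linked [OF mwords_letters] by blast
qed

text \<open>Grouping the words by the cycle type of their product links them to the numbers of the
  statement.\<close>

lemma sum_monotone_hurwitz:
  "(\<Sum>\<alpha>\<in>partitions d. of_nat (monotone_hurwitz r \<alpha>) * p_monomial \<alpha>) = hcoef d r"
proof -
  let ?W = "{fs \<in> mwords {1..d} r. linked {1..d} fs}" and ?t = "\<lambda>fs. cycle_type d (wperm fs)"
  have "hcoef d r = (\<Sum>fs\<in>?W. p_monomial (?t fs))"
    unfolding hcoef_def weight_def p_monomial_cycle_type [symmetric]
    by (subst sum.inter_filter) auto
  also have "\<dots> = (\<Sum>\<alpha>\<in>partitions d. \<Sum>fs\<in>{fs \<in> ?W. ?t fs = \<alpha>}. p_monomial (?t fs))"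
    using cycle_type_in_partitions mwords_permutes
    by (intro sum.group [symmetric]) (auto simp: finite_partitions)
  also have "\<dots> = (\<Sum>\<alpha>\<in>partitions d. of_nat (monotone_hurwitz r \<alpha>) * p_monomial \<alpha>)"
  proof (rule sum.cong [OF refl])
    fix \<alpha> assume \<alpha>: "\<alpha> \<in> partitions d"
    have "(\<Sum>fs\<in>{fs \<in> ?W. ?t fs = \<alpha>}. p_monomial (?t fs)) =
        (\<Sum>fs\<in>monotone_factorizations r \<alpha>. p_monomial \<alpha>)"
      unfolding monotone_factorizations_eq [OF \<alpha>] by (rule sum.cong) auto
    then show "(\<Sum>fs\<in>{fs \<in> ?W. ?t fs = \<alpha>}. p_monomial (?t fs)) =
        of_nat (monotone_hurwitz r \<alpha>) * p_monomial \<alpha>"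
      by (simp only: sum_constant monotone_hurwitz_def)
  qed
  finally show ?thesis ..
qed

lemma mps_coeff_t_series:
  assumes "\<And>r. zt_free (q r)"
  shows "mps_coeff (mps_sum UNIV (\<lambda>r. t_var ^ r * q r)) m =
    mps_coeff (t_var ^ count m Ind_t * q (count m Ind_t)) m"
proof -
  have "mps_coeff (t_var ^ r * q r) m = 0" if "r \<noteq> count m Ind_t" for r
    using mps_coeff_zt_times [OF assms, of 0 r r m] that by simp
  then show ?thesis
    by (subst mps_coeff_sum_infinite [where J = "{count m Ind_t}"]) auto
qed

lemma mps_coeff_hurwitz_series:
  "mps_coeff hurwitz_series m = (if count m Ind_z = 0 then 0
     else 1 / fact (count m Ind_z) * mps_coeff (hcoef (count m Ind_z) (count m Ind_t)) (p_part m))"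
proof -
  let ?D = "count m Ind_z" and ?R = "count m Ind_t"
  let ?T = "\<lambda>d. mps_const (1 / fact d) * z_var ^ d * mps_sum UNIV (\<lambda>r. t_var ^ r * hcoef d r)"
  have T: "mps_coeff (?T d) m = (if ?D = d then 1 / fact d * mps_coeff (hcoef d ?R) (p_part m) else 0)" for d
  proof -
    have "mps_coeff (?T d) m = 1 / fact d * mps_coeff (z_var ^ d * mps_sum UNIV (\<lambda>r. t_var ^ r * hcoef d r)) m"
      by (simp only: mult.assoc mps_coeff_const_mult)
    also have "mps_coeff (z_var ^ d * mps_sum UNIV (\<lambda>r. t_var ^ r * hcoef d r)) m =
        mps_coeff (z_var ^ d * (t_var ^ ?R * hcoef d ?R)) m"
      by (simp add: mps_coeff_var_power_times [of Ind_z] mps_coeff_t_series zt_free_hcoef)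
    also have "\<dots> = (if ?D = d then mps_coeff (hcoef d ?R) (p_part m) else 0)"
      by (simp add: mps_coeff_zt_times zt_free_hcoef)
    finally show ?thesis by simp
  qed
  define D where "D = ?D"
  have "mps_coeff hurwitz_series m = (\<Sum>d\<in>(if D = 0 then {} else {D}). mps_coeff (?T d) m)"
    unfolding hurwitz_series_def sum_monotone_hurwitz
    by (rule mps_coeff_sum_infinite) (auto simp: T D_def [symmetric] split: if_splits)
  then show ?thesis unfolding T D_def [symmetric] by (cases "D = 0") simp_all
qed

section \<open>The differential equation\<close>

definition zt_degree :: "indet multiset \<Rightarrow> nat" where
  "zt_degree m = count m Ind_z + count m Ind_t"

text \<open>The degree in the \<open>p\<close> is ignored, so that agreement survives the
  derivatives by the \<open>p\<close>. The relation serves both to replace the generating function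
  by a finite sum and to run the induction for uniqueness.\<close>

definition agree :: "nat \<Rightarrow> (indet, rat) mps \<Rightarrow> (indet, rat) mps \<Rightarrow> bool" where
  "agree n F G \<longleftrightarrow> (\<forall>m. zt_degree m \<le> n \<longrightarrow> mps_coeff F m = mps_coeff G m)"

lemma agree_refl [simp]: "agree n F F"
  by (simp add: agree_def)

lemma agree_add: "agree n F G \<Longrightarrow> agree n F' G' \<Longrightarrow> agree n (F + F') (G + G')"
  by (simp add: agree_def)

lemma agree_sum: "(\<And>i. i \<in> I \<Longrightarrow> agree n (F i) (G i)) \<Longrightarrow> agree n (\<Sum>i\<in>I. F i) (\<Sum>i\<in>I. G i)"
  by (simp add: agree_def)

lemma agree_mult:
  assumes "agree n F G" "agree n F' G'"
  shows "agree n (F * F') (G * G')"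
  unfolding agree_def
proof (intro allI impI)
  fix m assume m: "zt_degree m \<le> n"
  show "mps_coeff (F * F') m = mps_coeff (G * G') m"
    unfolding mps_coeff_mult
  proof (rule sum.cong [OF refl], clarify)
    fix a b assume "(a, b) \<in> splits m"
    then have "zt_degree m = zt_degree a + zt_degree b" by (auto simp: splits_def zt_degree_def)
    then show "mps_coeff F a * mps_coeff F' b = mps_coeff G a * mps_coeff G' b"
      using assms m by (simp add: agree_def)
  qed
qed

lemma agree_deriv: "agree n F G \<Longrightarrow> agree n (mps_deriv (Ind_p k) F) (mps_deriv (Ind_p k) G)"
  by (simp add: agree_def mps_coeff_deriv zt_degree_def)

lemma agree_join_cut_lin: "agree n F G \<Longrightarrow> agree n (join_cut_lin N F) (join_cut_lin N G)"
  unfolding join_cut_lin_def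
  by (intro agree_sum agree_add agree_mult agree_deriv agree_refl)

lemma agree_join_cut_bil: "agree n F G \<Longrightarrow> agree n (join_cut_bil N F F) (join_cut_bil N G G)"
  unfolding join_cut_bil_def by (intro agree_sum agree_mult agree_deriv agree_refl)

definition join_cut :: "(indet, rat) mps \<Rightarrow> (indet, rat) mps" where
  "join_cut F = mps_sum ({1..} \<times> {1..}) (\<lambda>(i, j). join_cut_term F i j)"

text \<open>By local finiteness only finitely many pairs \<open>(i, j)\<close> reach a given
  monomial. The bound leaves \<open>N\<close> free above \<open>N0\<close>, so that two series can
  share one cut-off and further demands on \<open>N\<close> can be met.\<close>

lemma mps_coeff_join_cut:
  obtains N0 where
    "\<And>N. N \<ge> N0 \<Longrightarrow> mps_coeff (join_cut F) m = mps_coeff (join_cut_lin N F + join_cut_bil N F F) m"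
proof -
  let ?f = "\<lambda>(i, j). join_cut_term F i j"
  define K where "K = {x \<in> {1..} \<times> {1..}. mps_coeff (?f x) m \<noteq> 0}"
  have "finite K" using join_cut_locally_finite [of F] by (simp add: locally_finite_def K_def)
  then have "finite (fst ` K \<union> snd ` K)" by simp
  then obtain N0 where N0: "\<And>k. k \<in> fst ` K \<union> snd ` K \<Longrightarrow> k \<le> N0"
    unfolding finite_nat_set_iff_bounded_le by blast
  have "mps_coeff (join_cut F) m = mps_coeff (join_cut_lin N F + join_cut_bil N F F) m" if N: "N \<ge> N0" for N
  proof -
    have "mps_coeff (join_cut F) m = (\<Sum>x\<in>{1..N} \<times> {1..N}. mps_coeff (?f x) m)"
      unfolding join_cut_def
    proof (rule mps_coeff_sum_infinite)
      fix x assume x: "x \<in> {1..} \<times> {1..} - {1..N} \<times> {1..N :: nat}"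
      show "mps_coeff (?f x) m = 0"
      proof (rule ccontr)
        assume "mps_coeff (?f x) m \<noteq> 0"
        then have "x \<in> K" using x by (simp add: K_def)
        then have "fst x \<le> N" "snd x \<le> N" using N0 N by (meson UnCI imageI order_trans)+
        then show False using x by (cases x) auto
      qed
    qed auto
    also have "\<dots> = mps_coeff (\<Sum>i\<in>{1..N}. \<Sum>j\<in>{1..N}. join_cut_term F i j) m"
      unfolding mps_coeff_sum sum.cartesian_product by (simp add: case_prod_beta)
    also have "(\<Sum>i\<in>{1..N}. \<Sum>j\<in>{1..N}. join_cut_term F i j) = join_cut_lin N F + join_cut_bil N F F"
      unfolding join_cut_term_def join_cut_lin_def join_cut_bil_def by (simp only: sum.distrib)
    finally show ?thesis .
  qed
  then show ?thesis using that by blast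
qed

lemma agree_join_cut:
  assumes "agree n F G"
  shows "agree n (join_cut F) (join_cut G)"
  unfolding agree_def
proof (intro allI impI)
  fix m assume m: "zt_degree m \<le> n"
  obtain N1 where N1: "\<And>N. N \<ge> N1 \<Longrightarrow>
      mps_coeff (join_cut F) m = mps_coeff (join_cut_lin N F + join_cut_bil N F F) m"
    using mps_coeff_join_cut [of F m] by blast
  obtain N2 where N2: "\<And>N. N \<ge> N2 \<Longrightarrow>
      mps_coeff (join_cut G) m = mps_coeff (join_cut_lin N G + join_cut_bil N G G) m"
    using mps_coeff_join_cut [of G m] by blast
  have "agree n (join_cut_lin N F + join_cut_bil N F F) (join_cut_lin N G + join_cut_bil N G G)" for N
    using assms by (intro agree_add agree_join_cut_lin agree_join_cut_bil)
  then show "mps_coeff (join_cut F) m = mps_coeff (join_cut G) m"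
    using N1 [of "max N1 N2"] N2 [of "max N1 N2"] m by (simp add: agree_def)
qed

text \<open>\<open>hcoef 0 r\<close> is 1 or 0. This removes the degenerate splitting in which the
  second component is empty.\<close>

lemma mps_deriv_hcoef_0: "mps_deriv v (hcoef 0 r) = 0"
proof (cases r)
  case 0
  then show ?thesis by (simp add: hcoef_def weight_def pmon_def cycles_def)
next
  case (Suc r)
  have "mwords {} (Suc r) = {}"
    using mwords_letters [of _ "{}" "Suc r"] by (fastforce simp: mwords_def)
  then show ?thesis by (simp add: hcoef_def Suc)
qed

text \<open>The empty word is transitive on a single point only; this is the origin of the term z
  p_1 in the equation.\<close>

lemma hcoef_no_transpositions:
  assumes "d \<ge> 1"
  shows "hcoef d 0 = (if d = 1 then p_var 1 else 0)"
proof (cases "d = 1")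
  case True
  have "orbit id (1 :: nat) = {1}" by (simp add: orbit_eq_singleton_iff)
  then have "cycles {1 :: nat} id = {{1}}" by (simp add: cycles_def)
  moreover have "linked {1} []" by (auto simp: linked_def)
  ultimately show ?thesis using True by (simp add: hcoef_def weight_def pmon_def)
next
  case False
  have "\<not> linked {1..d} []"
  proof
    assume "linked {1..d} []"
    then have "{1..d} \<subseteq> {1} \<or> {1..d} \<inter> {1} = {}" by (rule linkedD) simp
    moreover have "1 \<in> {1..d}" "d \<in> {1..d}" using assms by auto
    ultimately show False using False by blast
  qed
  then show ?thesis using False by (simp add: hcoef_def weight_def)
qed

definition hurwitz_trunc :: "nat \<Rightarrow> (indet, rat) mps" where
  "hurwitz_trunc n = (\<Sum>d\<in>{1..n}. \<Sum>r\<in>{..n}. zt_monom d r (1 / fact d) * hcoef d r)"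

lemma sum_delta2:
  assumes "finite I" "finite J"
  shows "(\<Sum>i\<in>I. \<Sum>j\<in>J. if k = i \<and> l = j then f i j else 0) =
    (if k \<in> I \<and> l \<in> J then f k l else (0 :: 'a :: comm_monoid_add))"
proof -
  have "(\<Sum>j\<in>J. if k = i \<and> l = j then f i j else 0) = (if k = i then if l \<in> J then f i l else 0 else 0)" for i
    using assms(2) by (cases "k = i") simp_all
  then show ?thesis using assms(1) by simp
qed

lemma agree_hurwitz_trunc: "agree n hurwitz_series (hurwitz_trunc n)"
  unfolding agree_def
proof (intro allI impI)
  fix m assume m: "zt_degree m \<le> n"
  define D R where "D = count m Ind_z" and "R = count m Ind_t"
  have "mps_coeff (hurwitz_trunc n) m = (\<Sum>d\<in>{1..n}. \<Sum>r\<in>{..n}. if D = d \<and> R = r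
      then 1 / fact d * mps_coeff (hcoef d r) (p_part m) else 0)"
    by (simp only: hurwitz_trunc_def mps_coeff_sum mps_coeff_zt_monom_times zt_free_hcoef D_def R_def)
  also have "\<dots> = (if D \<in> {1..n} \<and> R \<in> {..n} then 1 / fact D * mps_coeff (hcoef D R) (p_part m) else 0)"
    by (intro sum_delta2) auto
  also have "\<dots> = mps_coeff hurwitz_series m"
    using m unfolding mps_coeff_hurwitz_series D_def [symmetric] R_def [symmetric]
    by (auto simp: zt_degree_def D_def [symmetric] R_def [symmetric])
  finally show "mps_coeff hurwitz_series m = mps_coeff (hurwitz_trunc n) m" ..
qed

text \<open>On the right, \<open>d = D\<close> leaves 0 for the other index, a value that
  \<open>e\<close> never takes on the left. The assumption on \<open>f d r 0 s\<close> closes this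
  gap.\<close>

lemma sum_delta_convolution:
  fixes f :: "nat \<Rightarrow> nat \<Rightarrow> nat \<Rightarrow> nat \<Rightarrow> 'a :: comm_monoid_add"
  assumes "D \<le> n" "R \<le> n" and 0: "\<And>d r s. f d r 0 s = 0"
  shows "(\<Sum>d\<in>{1..n}. \<Sum>r\<in>{..n}. \<Sum>e\<in>{1..n}. \<Sum>s\<in>{..n}. if D = d + e \<and> R = r + s then f d r e s else 0) =
    (\<Sum>d\<in>{1..D}. \<Sum>r\<in>{..R}. f d r (D - d) (R - r))"
proof -
  have "(\<Sum>e\<in>{1..n}. \<Sum>s\<in>{..n}. if D = d + e \<and> R = r + s then f d r e s else 0) =
      (if d \<in> {1..D} then if r \<in> {..R} then f d r (D - d) (R - r) else 0 else 0)"
    if "d \<in> {1..n}" for d r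
  proof (cases "d \<le> D \<and> r \<le> R")
    case True
    then have eq: "D = d + e \<and> R = r + s \<longleftrightarrow> D - d = e \<and> R - r = s" for e s by auto
    show ?thesis
      unfolding eq using True that assms(1,2) 0 by (subst sum_delta2) (auto simp: le_eq_less_or_eq)
  next
    case False
    then have "(\<Sum>e\<in>{1..n}. \<Sum>s\<in>{..n}. if D = d + e \<and> R = r + s then f d r e s else 0) = 0"
      by (intro sum.neutral ballI) auto
    then show ?thesis using False by auto
  qed
  then have "(\<Sum>d\<in>{1..n}. \<Sum>r\<in>{..n}. \<Sum>e\<in>{1..n}. \<Sum>s\<in>{..n}. if D = d + e \<and> R = r + s then f d r e s else 0)
      = (\<Sum>d\<in>{1..n}. \<Sum>r\<in>{..n}. if d \<in> {1..D} then if r \<in> {..R} then f d r (D - d) (R - r) else 0 else 0)"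
    by (intro sum.cong refl)
  also have "\<dots> = (\<Sum>d\<in>{1..n}. if d \<in> {1..D} then \<Sum>r\<in>{..n}. if r \<in> {..R} then f d r (D - d) (R - r) else 0 else 0)"
    by (simp only: if_sum_0)
  also have "\<dots> = (\<Sum>d\<in>{1..D}. \<Sum>r\<in>{..n}. if r \<in> {..R} then f d r (D - d) (R - r) else 0)"
    using assms(1) by (intro sum.mono_neutral_cong_right) auto
  also have "\<dots> = (\<Sum>d\<in>{1..D}. \<Sum>r\<in>{..R}. f d r (D - d) (R - r))"
    using assms(2) by (intro sum.cong refl sum.mono_neutral_cong_right) auto
  finally show ?thesis .
qed

lemma mps_coeff_of_nat_mult: "mps_coeff (of_nat n * f) m = of_nat n * mps_coeff f m"
  unfolding of_nat_eq_mps_const mps_coeff_const_mult by simp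

text \<open>Up to the degree of \<open>m\<close> in z and t the series agrees with a finite sum, to
  which the operators apply termwise. What results is the right side of
  \<open>hcoef_recurrence\<close>; its left side is what is stated.\<close>

lemma mps_coeff_join_cut_hurwitz_series:
  "mps_coeff (join_cut hurwitz_series) m = of_nat (count m Ind_z) *
     (1 / fact (count m Ind_z) * mps_coeff (hcoef (count m Ind_z) (Suc (count m Ind_t))) (p_part m))"
proof -
  define D R n where "D = count m Ind_z" and "R = count m Ind_t" and "n = zt_degree m"
  let ?p = "p_part m" and ?T = "hurwitz_trunc n"
  have n: "D \<le> n" "R \<le> n" by (simp_all add: D_def R_def n_def zt_degree_def)
  obtain N0 where N0: "\<And>N. N \<ge> N0 \<Longrightarrow>
      mps_coeff (join_cut ?T) m = mps_coeff (join_cut_lin N ?T + join_cut_bil N ?T ?T) m"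
    using mps_coeff_join_cut [of ?T m] by blast
  \<comment> \<open>Large enough both for the infinite sum at \<open>m\<close> and for the
    recurrence in degree \<open>D\<close>.\<close>
  define N where "N = max N0 D"
  have "mps_coeff (join_cut hurwitz_series) m = mps_coeff (join_cut ?T) m"
    using agree_join_cut [OF agree_hurwitz_trunc [of n]] by (simp add: agree_def n_def)
  also have "\<dots> = mps_coeff (join_cut_lin N ?T) m + mps_coeff (join_cut_bil N ?T ?T) m"
    using N0 [of N] by (simp add: N_def)
  also have "mps_coeff (join_cut_lin N ?T) m = (\<Sum>d\<in>{1..n}. \<Sum>r\<in>{..n}. if D = d \<and> R = r
      then 1 / fact d * mps_coeff (join_cut_lin N (hcoef d r)) ?p else 0)"
    by (simp only: hurwitz_trunc_def join_cut_lin_sum join_cut_lin_zt_monom mps_coeff_sum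
        mps_coeff_zt_monom_times zt_free_join_cut_lin zt_free_hcoef D_def R_def)
  also have "\<dots> = (if D \<in> {1..n} \<and> R \<in> {..n}
      then 1 / fact D * mps_coeff (join_cut_lin N (hcoef D R)) ?p else 0)"
    by (intro sum_delta2) auto
  also have "mps_coeff (join_cut_bil N ?T ?T) m =
      (\<Sum>d\<in>{1..n}. \<Sum>r\<in>{..n}. \<Sum>e\<in>{1..n}. \<Sum>s\<in>{..n}. if D = d + e \<and> R = r + s
        then 1 / fact d * (1 / fact e) * mps_coeff (join_cut_bil N (hcoef d r) (hcoef e s)) ?p else 0)"
    by (simp only: hurwitz_trunc_def join_cut_bil_sum_left)
      (simp only: join_cut_bil_sum_right join_cut_bil_zt_monom mps_coeff_sum mps_coeff_zt_monom_times
        zt_free_join_cut_bil zt_free_hcoef D_def R_def)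
  also have "\<dots> = (\<Sum>d\<in>{1..D}. \<Sum>r\<in>{..R}. 1 / fact d * (1 / fact (D - d)) *
      mps_coeff (join_cut_bil N (hcoef d r) (hcoef (D - d) (R - r))) ?p)"
    by (rule sum_delta_convolution [OF n]) (simp add: join_cut_bil_def mps_deriv_hcoef_0)
  also have "(if D \<in> {1..n} \<and> R \<in> {..n}
      then 1 / fact D * mps_coeff (join_cut_lin N (hcoef D R)) ?p else 0) + \<dots> =
      of_nat D * (1 / fact D * mps_coeff (hcoef D (Suc R)) ?p)"
  proof (cases "D = 0")
    case False
    then have D: "D \<ge> 1" "D \<le> N" by (simp_all add: N_def)
    have "of_nat D * (1 / fact D * mps_coeff (hcoef D (Suc R)) ?p) =
        mps_coeff (of_nat D * (mps_const (1 / fact D) * hcoef D (Suc R))) ?p"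
      by (simp only: mps_coeff_of_nat_mult mps_coeff_const_mult)
    also have "\<dots> = 1 / fact D * mps_coeff (join_cut_lin N (hcoef D R)) ?p +
        (\<Sum>d\<in>{1..D}. \<Sum>r\<in>{..R}. 1 / fact d * (1 / fact (D - d)) *
          mps_coeff (join_cut_bil N (hcoef d r) (hcoef (D - d) (R - r))) ?p)"
      unfolding hcoef_recurrence [OF D]
      by (simp only: mps_coeff_ring mps_coeff_sum mps_coeff_const_mult mps_const_mult sum_distrib_left)
    finally show ?thesis using D n by simp
  qed simp
  finally show ?thesis by (simp only: D_def R_def)
qed

lemma mps_coeff_t_times_join_cut:
  "mps_coeff (t_var * join_cut F) m =
    (if Ind_t \<in># m then mps_coeff (join_cut F) (m - {#Ind_t#}) else 0)"
  by (rule mps_coeff_var_times)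

lemma p_part_eq_single:
  assumes "count m Ind_z = 1" "count m Ind_t = 0"
  shows "p_part m = {#ind_p 1#} \<longleftrightarrow> m = {#Ind_z, ind_p 1#}"
proof
  assume "p_part m = {#ind_p 1#}"
  then have "count (p_part m) v = count {#ind_p 1#} v" for v by simp
  then have "count m v = count {#Ind_z, ind_p 1#} v" for v
    using assms by (cases v) (force simp: p_part_def split: if_splits)+
  then show "m = {#Ind_z, ind_p 1#}" by (rule multiset_eqI)
qed (simp add: p_part_def)

lemma mps_coeff_z_p1: "mps_coeff (z_var * p_var 1) m = (if m = {#Ind_z, ind_p 1#} then 1 else 0)"
  unfolding mps_coeff_var_times by (auto simp: mps_var_def dest!: multi_member_split)

text \<open>At a monomial divisible by t the equation is the recurrence for the number of letters.
  At the others the right side vanishes, and on the left the contribution of the empty word is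
  cancelled by z p_1.\<close>

lemma hurwitz_series_equation:
  "z_var * mps_deriv Ind_z hurwitz_series - z_var * p_var 1 = t_var * join_cut hurwitz_series"
proof (rule mps_eqI)
  fix m
  let ?H = hurwitz_series
  define D R where "D = count m Ind_z" and "R = count m Ind_t"
  have H: "of_nat D * mps_coeff ?H m = of_nat D * (1 / fact D * mps_coeff (hcoef D R) (p_part m))"
    unfolding mps_coeff_hurwitz_series D_def [symmetric] R_def [symmetric] by (cases "D = 0") simp_all
  have "mps_coeff (z_var * mps_deriv Ind_z ?H - z_var * p_var 1) m =
      of_nat D * mps_coeff ?H m - (if m = {#Ind_z, ind_p 1#} then 1 else 0)"
    by (simp only: mps_coeff_ring mps_coeff_var_deriv mps_coeff_z_p1 D_def)
  also have "\<dots> = mps_coeff (t_var * join_cut ?H) m"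
  proof (cases "Ind_t \<in># m")
    case True
    then obtain m' where m': "m = add_mset Ind_t m'" by (blast dest: multi_member_split)
    have "count m' Ind_z = D" "Suc (count m' Ind_t) = R" "p_part m' = p_part m"
      by (simp_all add: m' D_def R_def p_part_def)
    then have "mps_coeff (t_var * join_cut ?H) m =
        of_nat D * (1 / fact D * mps_coeff (hcoef D R) (p_part m))"
      using True by (simp add: mps_coeff_var_times m' mps_coeff_join_cut_hurwitz_series)
    moreover have "m \<noteq> {#Ind_z, ind_p 1#}" using True by auto
    ultimately show ?thesis unfolding H by simp
  next
    case False
    then have R: "R = 0" by (simp add: R_def not_in_iff)
    have "of_nat D * (1 / fact D * mps_coeff (hcoef D R) (p_part m)) =
        (if m = {#Ind_z, ind_p 1#} then 1 else 0)"
    proof (cases "D = 1")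
      case True
      then show ?thesis using p_part_eq_single [of m] R
        by (simp add: hcoef_no_transpositions D_def R_def mps_var_def)
    next
      case False
      then have "m \<noteq> {#Ind_z, ind_p 1#}" by (auto simp: D_def)
      then show ?thesis using False R by (cases "D = 0") (simp_all add: hcoef_no_transpositions)
    qed
    then show ?thesis unfolding H using False by (simp add: mps_coeff_var_times)
  qed
  finally show "mps_coeff (z_var * mps_deriv Ind_z ?H - z_var * p_var 1) m =
      mps_coeff (t_var * join_cut ?H) m" .
qed

section \<open>Initial condition and uniqueness\<close>

lemma hurwitz_series_initial: "mps_pow_coeff Ind_z 0 hurwitz_series = 0"
  by (rule mps_eqI) (simp add: mps_pow_coeff_def mps_coeff_hurwitz_series not_in_iff)

text \<open>The operator z d/dz multiplies each coefficient by its exponent of z, so the equation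
  determines the coefficients in which z occurs and the initial condition supplies the
  others.\<close>

lemma join_cut_equation_unique:
  assumes F: "z_var * mps_deriv Ind_z F - z_var * p_var 1 = t_var * join_cut F"
    and F0: "mps_pow_coeff Ind_z 0 F = 0"
    and G: "z_var * mps_deriv Ind_z G - z_var * p_var 1 = t_var * join_cut G"
    and G0: "mps_pow_coeff Ind_z 0 G = 0"
  shows "F = G"
proof (rule mps_eqI)
  fix m
  have initial: "mps_coeff E m = 0" if "mps_pow_coeff Ind_z 0 E = 0" "Ind_z \<notin># m"
    for E :: "(indet, rat) mps" and m
    using arg_cong [OF that(1), of "\<lambda>f. mps_coeff f m"] that(2) by (simp add: mps_pow_coeff_def)
  have equation: "of_nat (count m Ind_z) * mps_coeff E m = mps_coeff (z_var * p_var 1) m +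
      (if Ind_t \<in># m then mps_coeff (join_cut E) (m - {#Ind_t#}) else 0)"
    if "z_var * mps_deriv Ind_z E - z_var * p_var 1 = t_var * join_cut E" for E m
    using arg_cong [OF that, of "\<lambda>f. mps_coeff f m"]
    by (simp only: mps_coeff_ring mps_coeff_var_deriv mps_coeff_t_times_join_cut diff_eq_eq add.commute)
  show "mps_coeff F m = mps_coeff G m"
  \<comment> \<open>The factor t lowers this degree by one on the right side, and
    \<open>join_cut\<close> preserves agreement up to a given degree in z and t.\<close>
  proof (induction m rule: measure_induct_rule [of zt_degree])
    case (less m)
    show ?case
    proof (cases "Ind_z \<in># m")
      case False
      then show ?thesis using initial F0 G0 by simp
    next
      case True
      have "mps_coeff (join_cut F) (m - {#Ind_t#}) = mps_coeff (join_cut G) (m - {#Ind_t#})"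
        if t: "Ind_t \<in># m"
      proof -
        have deg: "zt_degree m = Suc (zt_degree (m - {#Ind_t#}))"
          using multi_member_split [OF t] by (auto simp: zt_degree_def)
        then have "agree (zt_degree (m - {#Ind_t#})) F G"
          unfolding agree_def using less by simp
        then have "agree (zt_degree (m - {#Ind_t#})) (join_cut F) (join_cut G)" by (rule agree_join_cut)
        then show ?thesis by (simp add: agree_def)
      qed
      then have "of_nat (count m Ind_z) * mps_coeff F m = of_nat (count m Ind_z) * mps_coeff G m"
        unfolding equation [OF F] equation [OF G] by simp
      then show ?thesis using True by (simp add: count_eq_zero_iff)
    qed
  qed
qed

text \<open>The embedding in the field of fractions is injective and multiplicative, so clearing the
  denominator 2t gives an equation between power series.\<close>

lemma fract_equation_iff:
  fixes A B :: "(indet, rat) mps"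
  shows "1 / (2 * to_fract t_var) * to_fract A = 1 / 2 * to_fract B \<longleftrightarrow> A = t_var * B"
proof -
  have t: "to_fract t_var \<noteq> 0" and two: "(2 :: (indet, rat) mps fract) \<noteq> 0"
    using two_t_nonzero by auto
  have "1 / (2 * to_fract t_var) * to_fract A = 1 / 2 * to_fract B \<longleftrightarrow>
      to_fract A = to_fract t_var * to_fract B"
    using t two by (simp add: field_simps)
  also have "to_fract t_var * to_fract B = to_fract (t_var * B)"
    by (simp add: to_fract_def)
  also have "to_fract A = to_fract (t_var * B) \<longleftrightarrow> A = t_var * B"
    by (simp add: to_fract_def eq_fract)
  finally show ?thesis .
qed

theorem theorem1p2:
  fixes F :: "(indet, rat) mps"
  shows "(1 / (2 * to_fract t_var)
              * to_fract (z_var * mps_deriv Ind_z F - z_var * p_var 1)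
            = 1 / 2 * to_fract (mps_sum ({1..} \<times> {1..}) (\<lambda>(i, j). join_cut_term F i j))
          \<and> mps_pow_coeff Ind_z 0 F = 0)
         \<longleftrightarrow> F = hurwitz_series"
  unfolding fract_equation_iff join_cut_def [symmetric]
  using hurwitz_series_equation hurwitz_series_initial join_cut_equation_unique by blast

end
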